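(* Let $X$ be a locally compact Hausdorff space, let $H$ be a complex Hilbert space, and let $\pi:\mathrm{C}_0(X)\to\mathcal{B}(H)_{\mathrm{sa}}$ be a positive (not necessarily multiplicative) operator. Let $L$ be a strongly closed complex linear subspace of $\mathcal{B}(H)$ that contains $\pi(\mathrm{C}_0(X))$, and let $L_{\mathrm{sa}}$ denote the real vector space that consists of the self-adjoint operators in $L$, supplied with the partial ordering that is inherited from the usual partial ordering on $\mathcal{B}(H)_{\mathrm{sa}}$. Then there exists a unique regular Borel measure $\mu:\mathscr{B}\to\overline{L_{\mathrm{sa}}^+}$ on the Borel $\sigma$-algebra $\mathscr{B}$ of $X$ such that \[ \pi(f)=\int_X^{\mathrm{o}} f\,\mathrm{d}\mu\qquad(\ast) \] for all $f\in\mathrm{C}_{\mathrm c}(X)$. The measure $\mu$ is finite, and $(\ast)$ also holds for all $f\in\mathrm{C}_0(X)$. If $V$ is a non-empty open subset of $X$, then $\mu(V)=\bigvee\{\pi(f): f\prec V\}$ in $L_{\mathrm{sa}}$. If $K$ is a compact subset of $X$, then $\mu(K)=\bigwedge\{\pi(f): K\prec f\}$ in $L_{\mathrm{sa}}$. Suppose that $\{\Delta_n\}_{n=1}^\infty$ is a pairwise disjoint sequence in $\mathscr{B}$. Then, for $x\in H$, $\mu\left(\bigcup_{n=1}^\infty\Delta_n\right)x=\sum_{n=1}^\infty\mu(\Delta_n)x$ in the norm topology of $H$. Define the extension $\pi:\mathcal{L}^1(X,\mathscr{B},\mu;\mathbb{R})\to L_{\mathrm{sa}}$ via $(\ast)$.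 For $x\in H$ and $\Delta\in\mathscr{B}$, set $\mu_x(\Delta)=\langle\mu(\Delta)x,x\rangle$. Then $\mu_x:\mathscr{B}\to\mathbb{R}^+$ is a regular Borel measure on $X$ and, for $f\in\mathcal{L}^1(X,\mathscr{B},\mu;\mathbb{R})$, $\pi(f)$ is the unique element of $\mathcal{B}(H)$ such that \[ \langle\pi(f)x,x\rangle=\int_X f\,\mathrm{d}\mu_x \] for all $x\in H$. Furthermore, the SOT-closed real linear subspaces of $\mathcal{B}(H)$ that are generated by the following sets are equal: (1) $\{\pi(f): f\in\mathrm{C}_{\mathrm c}(X)\}$; (2) $\{\pi(f): f\in\mathrm{C}_0(X)\}$; (3) $\{\pi(f): f\in\mathcal{B}(X,\mathscr{B};\mathbb{R})\}$; (4) $\{\pi(f): f\in\mathcal{L}^1(X,\mathscr{B},\mu;\mathbb{R})\}$; (5) $\{\mu(V): V\text{ is an open subset of }X\}$; (6) $\{\mu(K): K\text{ is a compact subset of }X\}$; (7) $\{\mu(\Delta):\Delta\text{ is a Borel subset of }X\}$. The analogous statement for the equality of the seven SOT-closed complex linear subspaces of $\mathcal{B}(H)$ generated by these sets is also true.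
   Context: $\mathcal{B}(H)$ is the space of bounded linear operators on $H$, $\mathcal{B}(H)_{\mathrm{sa}}$ its real subspace of self-adjoint operators with the usual order ($T\ge0$ iff $\langle Tx,x\rangle\ge0$ for all $x\in H$). SOT is the strong operator topology; strongly closed means SOT-closed. The space $L_{\mathrm{sa}}$ is monotone complete (every increasing net that is bounded above has a supremum). The positive cone of a partially ordered vector space is proper but need not be generating. The definitions below are applied with $F=L_{\mathrm{sa}}$. Extended space. For a partially ordered vector space $F$: $\overline{F}=F\cup\{\infty\}$ (disjoint union), ordered by the order of $F$ and $x\le\infty$ for all $x\in\overline F$; $\overline{F^+}=F^+\cup\{\infty\}$; $\infty+x=x+\infty=\infty$; $r\cdot\infty=\infty$ for real $r>0$, $0\cdot\infty=0$. Elements of $F$ are called finite. Measures. A positive $\overline F$-valued measure on $\mathscr{B}$ is a map $\mu:\mathscr{B}\to\overline{F^+}$ with $\mu(\emptyset)=0$ and $\mu(\bigcup_n\Delta_n)=\bigvee_{N=1}^\infty\sum_{n=1}^N\mu(\Delta_n)$ in $\overline F$ for pairwise disjoint sequences $(\Delta_n)$ in $\mathscr{B}$. It is finite if $\mu(X)\in F^+$. Order integral. For a measurable $\varphi=\sum_{i=1}^n r_i\chi_{\Delta_i}\ge 0$ taking finitely many finite values ($r_i\in\mathbb{R}^+$, $\Delta_i\in\mathscr{B}$), $\int_X^{\mathrm o}\varphi\,\mathrm d\mu=\sum_i r_i\mu(\Delta_i)\in\overline{F^+}$. For measurable $f:X\to[0,\infty]$, $\int_X^{\mathrm o}f\,\mathrm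 d\mu=\bigvee_n\int_X^{\mathrm o}\varphi_n\,\mathrm d\mu$ in $\overline{F}$, for any sequence of such elementary functions $\varphi_n\uparrow f$ pointwise (independent of the choice). $\mathcal{L}^1(X,\mathscr{B},\mu;\mathbb{R})$ is the set of measurable $f:X\to\mathbb{R}$ with $\int_X^{\mathrm o}|f|\,\mathrm d\mu$ finite; for such $f$, $\int_X^{\mathrm o}f\,\mathrm d\mu=\int_X^{\mathrm o}f^+\,\mathrm d\mu-\int_X^{\mathrm o}f^-\,\mathrm d\mu$. $\mathcal{B}(X,\mathscr{B};\mathbb{R})$ is the space of bounded Borel measurable functions $X\to\mathbb{R}$; it is contained in $\mathcal{L}^1(X,\mathscr{B},\mu;\mathbb{R})$ if $\mu$ is finite. Regularity (also used for $F=\mathbb{R}$). $\mu$ is a Borel measure if $\mu(K)\in F$ for all compact $K\subseteq X$; it is inner regular at $\Delta$ if $\mu(\Delta)=\bigvee\{\mu(K):K\text{ compact},K\subseteq\Delta\}$ in $\overline F$; outer regular at $\Delta$ if $\mu(\Delta)=\bigwedge\{\mu(V):V\text{ open},\Delta\subseteq V\}$ in $\overline F$. It is a regular Borel measure if it is a Borel measure that is inner regular at all open sets and outer regular at all Borel sets. Functions. $\mathrm{C}_{\mathrm c}(X)$ (resp. $\mathrm{C}_0(X)$) is the space of real-valued continuous functions on $X$ with compact support (resp. vanishing at infinity), with the pointwise order; a (real-linear) operator on it is positive if it maps positive functions to positive elements. For $S\subseteq X$, $f\prec S$ means $f\in\mathrm{C}_{\mathrm c}(X)$, $0\le f\le 1$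 and $\operatorname{supp}f\subseteq S$; $S\prec f$ means $f\in\mathrm{C}_{\mathrm c}(X)$, $0\le f\le 1$ and $f=1$ on $S$. *)

theory Defs
  imports "HOL-Analysis.Analysis" "HOL-Algebra.Order"
begin

hide_const (open) Order.top

section \<open>Complex Hilbert spaces and their bounded operators\<close>

text \<open>The inner product is linear in its first argument. The real scalar multiplication that
  \<^class>\<open>banach\<close> provides is the restriction of the complex one.\<close>

class complex_hilbert = banach +
  fixes scaleC :: "complex \<Rightarrow> 'a \<Rightarrow> 'a"  (infixr \<open>*\<^sub>C\<close> 75)
    and cinner :: "'a \<Rightarrow> 'a \<Rightarrow> complex"
  assumes scaleC_add_right: "c *\<^sub>C (x + y) = c *\<^sub>C x + c *\<^sub>C y"
    and scaleC_add_left: "(c + d) *\<^sub>C x = c *\<^sub>C x + d *\<^sub>C x"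
    and scaleC_scaleC: "c *\<^sub>C (d *\<^sub>C x) = (c * d) *\<^sub>C x"
    and scaleC_one: "1 *\<^sub>C x = x"
    and scaleR_eq_scaleC: "r *\<^sub>R x = complex_of_real r *\<^sub>C x"
    and cinner_commute: "cinner x y = cnj (cinner y x)"
    and cinner_add_left: "cinner (x + y) z = cinner x z + cinner y z"
    and cinner_scaleC_left: "cinner (c *\<^sub>C x) y = c * cinner x y"
    and cinner_ge_zero: "0 \<le> Re (cinner x x)"
    and cinner_eq_zero_iff: "cinner x x = 0 \<longleftrightarrow> x = 0"
    and norm_eq_sqrt_cinner: "norm x = sqrt (Re (cinner x x))"

instantiation complex :: complex_hilbert
begin

definition scaleC_complex :: "complex \<Rightarrow> complex \<Rightarrow> complex"
  where "scaleC_complex c x = c * x"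

definition cinner_complex :: "complex \<Rightarrow> complex \<Rightarrow> complex"
  where "cinner_complex x y = x * cnj y"

instance
  by standard
    (simp_all add: scaleC_complex_def cinner_complex_def distrib_left distrib_right mult.assoc
      scaleR_conv_of_real cmod_def power2_eq_square)

end

lemma norm_scaleC: "norm (c *\<^sub>C x) = cmod c * norm (x :: 'h::complex_hilbert)"
proof -
  have "cinner (c *\<^sub>C x) (c *\<^sub>C x) = c * cnj (c * cinner x x)"
    by (subst cinner_scaleC_left, subst cinner_commute, subst cinner_scaleC_left) (rule refl)
  also have "\<dots> = (c * cnj c) * cinner x x"
    using cinner_commute[of x x, symmetric] by (simp add: mult.assoc)
  finally have "Re (cinner (c *\<^sub>C x) (c *\<^sub>C x)) = (cmod c)\<^sup>2 * Re (cinner x x)"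
    by (simp add: complex_norm_square[symmetric])
  then show ?thesis
    by (simp add: norm_eq_sqrt_cinner[where 'a = 'h] real_sqrt_mult)
qed

lemma bounded_linear_scaleC: "bounded_linear (\<lambda>x :: 'h::complex_hilbert. c *\<^sub>C x)"
  by (rule bounded_linear_intro[of _ "cmod c"])
    (simp_all add: scaleC_add_right scaleR_eq_scaleC scaleC_scaleC norm_scaleC mult.commute)

text \<open>The type of bounded real-linear maps contains $\mathcal{B}(H)$ as the subset of its
  complex-linear elements.\<close>

definition bounded_ops :: "('h::complex_hilbert \<Rightarrow>\<^sub>L 'h) set"
  where "bounded_ops = {T :: 'h \<Rightarrow>\<^sub>L 'h. \<forall>c x. T (c *\<^sub>C x) = c *\<^sub>C T x}"

definition scaleC_op :: "complex \<Rightarrow> ('h::complex_hilbert \<Rightarrow>\<^sub>L 'h) \<Rightarrow> 'h \<Rightarrow>\<^sub>L 'h"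
  where "scaleC_op c T = Blinfun (\<lambda>x. c *\<^sub>C T x)"

lemma scaleC_op_apply [simp]: "scaleC_op c T x = c *\<^sub>C T x"
  unfolding scaleC_op_def
  by (simp add: bounded_linear_Blinfun_apply
      bounded_linear_compose[OF bounded_linear_scaleC blinfun.bounded_linear_right])

definition selfadjoint_ops :: "('h::complex_hilbert \<Rightarrow>\<^sub>L 'h) set"
  where "selfadjoint_ops = {T \<in> bounded_ops. \<forall>x y. cinner (T x) y = cinner x (T y)}"

text \<open>Only used for self-adjoint operators; then \<^term>\<open>cinner (T x) x\<close> is real.\<close>

definition op_nonneg :: "('h::complex_hilbert \<Rightarrow>\<^sub>L 'h) \<Rightarrow> bool"
  where "op_nonneg T \<longleftrightarrow> (\<forall>x. 0 \<le> Re (cinner (T x) x))"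

definition real_subspace :: "('h::complex_hilbert \<Rightarrow>\<^sub>L 'h) set \<Rightarrow> bool"
  where "real_subspace M \<longleftrightarrow> M \<subseteq> bounded_ops \<and> subspace M"

definition complex_subspace :: "('h::complex_hilbert \<Rightarrow>\<^sub>L 'h) set \<Rightarrow> bool"
  where "complex_subspace M \<longleftrightarrow> M \<subseteq> bounded_ops \<and> 0 \<in> M
     \<and> (\<forall>S\<in>M. \<forall>T\<in>M. S + T \<in> M) \<and> (\<forall>c. \<forall>T\<in>M. scaleC_op c T \<in> M)"

definition SOT :: "('h::complex_hilbert \<Rightarrow>\<^sub>L 'h) topology"
  where "SOT = subtopology strong_operator_topology bounded_ops"

definition sot_real_span :: "('h::complex_hilbert \<Rightarrow>\<^sub>L 'h) set \<Rightarrow> ('h \<Rightarrow>\<^sub>L 'h) set"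
  where "sot_real_span G = (\<lambda>M. real_subspace M \<and> closedin SOT M) hull G"

definition sot_complex_span :: "('h::complex_hilbert \<Rightarrow>\<^sub>L 'h) set \<Rightarrow> ('h \<Rightarrow>\<^sub>L 'h) set"
  where "sot_complex_span G = (\<lambda>M. complex_subspace M \<and> closedin SOT M) hull G"

section \<open>Partially ordered vector spaces and their extended spaces\<close>

text \<open>A partially ordered vector space is given by its underlying set, a real linear subspace of
  a type, and its order. Suprema and infima are always relative to the underlying set.\<close>

definition real_space :: "real gorder"
  where "real_space = \<lparr>carrier = UNIV, eq = (=), le = (\<le>)\<rparr>"

definition sa_space :: "('h::complex_hilbert \<Rightarrow>\<^sub>L 'h) set \<Rightarrow> ('h \<Rightarrow>\<^sub>L 'h) gorder"
  where "sa_space L =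
    \<lparr>carrier = L \<inter> selfadjoint_ops, eq = (=), le = (\<lambda>S T. op_nonneg (T - S))\<rparr>"

definition is_sup :: "'a gorder \<Rightarrow> 'a set \<Rightarrow> 'a \<Rightarrow> bool"
  where "is_sup F A s \<longleftrightarrow> least F s (Upper F A)"

definition is_inf :: "'a gorder \<Rightarrow> 'a set \<Rightarrow> 'a \<Rightarrow> bool"
  where "is_inf F A s \<longleftrightarrow> greatest F s (Lower F A)"

datatype 'a extd = Fin (the_fin: 'a) | Infty

instantiation extd :: (comm_monoid_add) comm_monoid_add
begin

definition zero_extd :: "'a extd"
  where "zero_extd = Fin 0"

fun plus_extd :: "'a extd \<Rightarrow> 'a extd \<Rightarrow> 'a extd"
  where
    "plus_extd (Fin a) (Fin b) = Fin (a + b)"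
  | "plus_extd Infty b = Infty"
  | "plus_extd a Infty = Infty"

instance
proof
  fix a b c :: "'a extd"
  show "a + b + c = a + (b + c)"
    by (cases a; cases b; cases c) (simp_all add: add.assoc)
  show "a + b = b + a"
    by (cases a; cases b) (simp_all add: add.commute)
  show "0 + a = a"
    by (cases a) (simp_all add: zero_extd_def)
qed

end

text \<open>Only used for scalars \<open>r \<ge> 0\<close>.\<close>

fun scale_extd :: "real \<Rightarrow> 'a::real_vector extd \<Rightarrow> 'a extd"
  where
    "scale_extd r (Fin a) = Fin (r *\<^sub>R a)"
  | "scale_extd r Infty = (if r = 0 then 0 else Infty)"

fun le_extd :: "('a \<Rightarrow> 'a \<Rightarrow> bool) \<Rightarrow> 'a extd \<Rightarrow> 'a extd \<Rightarrow> bool"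
  where
    "le_extd R (Fin a) (Fin b) = R a b"
  | "le_extd R Infty (Fin b) = False"
  | "le_extd R a Infty = True"

definition extended :: "'a gorder \<Rightarrow> 'a extd gorder"
  where "extended F =
    \<lparr>carrier = insert Infty (Fin ` carrier F), eq = (=), le = le_extd (le F)\<rparr>"

definition pos_cone :: "'a::real_vector gorder \<Rightarrow> 'a set"
  where "pos_cone F = {a \<in> carrier F. le F 0 a}"

definition ext_pos_cone :: "'a::real_vector gorder \<Rightarrow> 'a extd set"
  where "ext_pos_cone F = insert Infty (Fin ` pos_cone F)"

section \<open>Measures and order integrals\<close>

text \<open>Only the space and the sigma-algebra of \<open>M :: 'x measure\<close> are used here, and only the
  values of \<open>\<mu>\<close> on \<^term>\<open>sets M\<close> matter.\<close>

definition positive_measure ::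
    "'a::real_vector gorder \<Rightarrow> 'x measure \<Rightarrow> ('x set \<Rightarrow> 'a extd) \<Rightarrow> bool"
  where "positive_measure F M \<mu> \<longleftrightarrow>
    \<mu> ` sets M \<subseteq> ext_pos_cone F \<and> \<mu> {} = 0 \<and>
    (\<forall>D :: nat \<Rightarrow> 'x set. range D \<subseteq> sets M \<longrightarrow> disjoint_family D \<longrightarrow>
       is_sup (extended F) (range (\<lambda>N. \<Sum>n\<le>N. \<mu> (D n))) (\<mu> (\<Union>n. D n)))"

definition finite_positive_measure ::
    "'a::real_vector gorder \<Rightarrow> 'x measure \<Rightarrow> ('x set \<Rightarrow> 'a extd) \<Rightarrow> bool"
  where "finite_positive_measure F M \<mu> \<longleftrightarrow>
    positive_measure F M \<mu> \<and> \<mu> (space M) \<in> Fin ` pos_cone F"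

definition elementary :: "'x measure \<Rightarrow> ('x \<Rightarrow> real) \<Rightarrow> bool"
  where "elementary M \<phi> \<longleftrightarrow> simple_function M \<phi> \<and> (\<forall>x\<in>space M. 0 \<le> \<phi> x)"

text \<open>As for \<^const>\<open>simple_integral\<close>, the canonical representation of \<open>\<phi>\<close> as a linear
  combination of indicator functions is used.\<close>

definition elementary_integral ::
    "'x measure \<Rightarrow> ('x set \<Rightarrow> 'a::real_vector extd) \<Rightarrow> ('x \<Rightarrow> real) \<Rightarrow> 'a extd"
  where "elementary_integral M \<mu> \<phi> =
    (\<Sum>r\<in>\<phi> ` space M. scale_extd r (\<mu> (\<phi> -` {r} \<inter> space M)))"

text \<open>Over a monotone complete space the description is satisfied by exactly one element
  whenever \<open>f\<close> is measurable and \<open>\<mu>\<close> is a positive measure, since the supremum exists and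
  does not depend on the choice of the approximating sequence.\<close>

definition order_integral_pos ::
    "'a::real_vector gorder \<Rightarrow> 'x measure \<Rightarrow> ('x set \<Rightarrow> 'a extd) \<Rightarrow> ('x \<Rightarrow> ennreal) \<Rightarrow> 'a extd"
  where "order_integral_pos F M \<mu> f =
    (THE a. \<exists>\<phi> :: nat \<Rightarrow> 'x \<Rightarrow> real.
       (\<forall>n. elementary M (\<phi> n)) \<and>
       (\<forall>x\<in>space M. incseq (\<lambda>n. \<phi> n x) \<and> (\<lambda>n. ennreal (\<phi> n x)) \<longlonglongrightarrow> f x) \<and>
       is_sup (extended F) (range (\<lambda>n. elementary_integral M \<mu> (\<phi> n))) a)"

definition L1 ::
    "'a::real_vector gorder \<Rightarrow> 'x measure \<Rightarrow> ('x set \<Rightarrow> 'a extd) \<Rightarrow> ('x \<Rightarrow> real) set"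
  where "L1 F M \<mu> =
    {f \<in> borel_measurable M. order_integral_pos F M \<mu> (\<lambda>x. ennreal \<bar>f x\<bar>) \<in> Fin ` carrier F}"

definition order_integral ::
    "'a::real_vector gorder \<Rightarrow> 'x measure \<Rightarrow> ('x set \<Rightarrow> 'a extd) \<Rightarrow> ('x \<Rightarrow> real) \<Rightarrow> 'a"
  where "order_integral F M \<mu> f =
    the_fin (order_integral_pos F M \<mu> (\<lambda>x. ennreal (max (f x) 0))) -
    the_fin (order_integral_pos F M \<mu> (\<lambda>x. ennreal (max (- f x) 0)))"

section \<open>Borel measures and function spaces on a topological space\<close>

definition borel_of :: "'x topology \<Rightarrow> 'x measure"
  where "borel_of X = sigma (topspace X) {U. openin X U}"

definition borel_measure ::
    "'a::real_vector gorder \<Rightarrow> 'x topology \<Rightarrow> ('x set \<Rightarrow> 'a extd) \<Rightarrow> bool"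
  where "borel_measure F X \<mu> \<longleftrightarrow>
    positive_measure F (borel_of X) \<mu> \<and> (\<forall>K. compactin X K \<longrightarrow> \<mu> K \<in> Fin ` carrier F)"

definition inner_regular_at ::
    "'a::real_vector gorder \<Rightarrow> 'x topology \<Rightarrow> ('x set \<Rightarrow> 'a extd) \<Rightarrow> 'x set \<Rightarrow> bool"
  where "inner_regular_at F X \<mu> \<Delta> \<longleftrightarrow>
    is_sup (extended F) {\<mu> K | K. compactin X K \<and> K \<subseteq> \<Delta>} (\<mu> \<Delta>)"

definition outer_regular_at ::
    "'a::real_vector gorder \<Rightarrow> 'x topology \<Rightarrow> ('x set \<Rightarrow> 'a extd) \<Rightarrow> 'x set \<Rightarrow> bool"
  where "outer_regular_at F X \<mu> \<Delta> \<longleftrightarrow>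
    is_inf (extended F) {\<mu> V | V. openin X V \<and> \<Delta> \<subseteq> V} (\<mu> \<Delta>)"

definition regular_borel_measure ::
    "'a::real_vector gorder \<Rightarrow> 'x topology \<Rightarrow> ('x set \<Rightarrow> 'a extd) \<Rightarrow> bool"
  where "regular_borel_measure F X \<mu> \<longleftrightarrow>
    borel_measure F X \<mu> \<and>
    (\<forall>V. openin X V \<longrightarrow> inner_regular_at F X \<mu> V) \<and>
    (\<forall>\<Delta>\<in>sets (borel_of X). outer_regular_at F X \<mu> \<Delta>)"

text \<open>A continuous function on \<^term>\<open>topspace X\<close> is represented by its extension by zero. For
  the measurable functions in \<^const>\<open>L1\<close> and \<open>bounded_borel\<close> the values outside
  \<^term>\<open>topspace X\<close> are arbitrary and irrelevant.\<close>

definition Cc :: "'x topology \<Rightarrow> ('x \<Rightarrow> real) set"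
  where "Cc X = {f. continuous_map X euclideanreal f \<and> (\<forall>x. x \<notin> topspace X \<longrightarrow> f x = 0) \<and>
    compactin X (X closure_of {x \<in> topspace X. f x \<noteq> 0})}"

definition C0 :: "'x topology \<Rightarrow> ('x \<Rightarrow> real) set"
  where "C0 X = {f. continuous_map X euclideanreal f \<and> (\<forall>x. x \<notin> topspace X \<longrightarrow> f x = 0) \<and>
    (\<forall>e>0. compactin X {x \<in> topspace X. e \<le> \<bar>f x\<bar>})}"

definition bounded_borel :: "'x topology \<Rightarrow> ('x \<Rightarrow> real) set"
  where "bounded_borel X = {f \<in> borel_measurable (borel_of X). bounded (f ` topspace X)}"

definition subordinate :: "'x topology \<Rightarrow> ('x \<Rightarrow> real) \<Rightarrow> 'x set \<Rightarrow> bool"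
  where "subordinate X f S \<longleftrightarrow> f \<in> Cc X \<and> (\<forall>x\<in>topspace X. 0 \<le> f x \<and> f x \<le> 1) \<and>
    X closure_of {x \<in> topspace X. f x \<noteq> 0} \<subseteq> S"

definition dominates :: "'x topology \<Rightarrow> 'x set \<Rightarrow> ('x \<Rightarrow> real) \<Rightarrow> bool"
  where "dominates X S f \<longleftrightarrow> f \<in> Cc X \<and> (\<forall>x\<in>topspace X. 0 \<le> f x \<and> f x \<le> 1) \<and>
    (\<forall>x\<in>S. f x = 1)"

definition positive_operator ::
    "'x topology \<Rightarrow> ('x \<Rightarrow> real) set \<Rightarrow> 'a::real_vector gorder \<Rightarrow> (('x \<Rightarrow> real) \<Rightarrow> 'a) \<Rightarrow> bool"
  where "positive_operator X E F \<pi> \<longleftrightarrow>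
    \<pi> ` E \<subseteq> carrier F \<and>
    (\<forall>f\<in>E. \<forall>g\<in>E. \<pi> (\<lambda>x. f x + g x) = \<pi> f + \<pi> g) \<and>
    (\<forall>c. \<forall>f\<in>E. \<pi> (\<lambda>x. c * f x) = c *\<^sub>R \<pi> f) \<and>
    (\<forall>f\<in>E. (\<forall>x\<in>topspace X. 0 \<le> f x) \<longrightarrow> \<pi> f \<in> pos_cone F)"

text \<open>The set function $\mu_x(\Delta) = \langle\mu(\Delta)x, x\rangle$ for a measure \<open>\<mu>\<close> whose
  values are finite self-adjoint operators, and the measure in the sense of the library that
  it determines.\<close>

definition scalar_measure ::
    "('x set \<Rightarrow> ('h::complex_hilbert \<Rightarrow>\<^sub>L 'h) extd) \<Rightarrow> 'h \<Rightarrow> 'x set \<Rightarrow> real"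
  where "scalar_measure \<mu> x \<Delta> = Re (cinner (the_fin (\<mu> \<Delta>) x) x)"

definition lebesgue_of :: "'x measure \<Rightarrow> ('x set \<Rightarrow> real) \<Rightarrow> 'x measure"
  where "lebesgue_of M m = measure_of (space M) (sets M) (\<lambda>\<Delta>. ennreal (m \<Delta>))"

end

theory Submission
  imports Defs
begin

text \<open>For \<open>x\<close> in \<open>H\<close> the functional $f \mapsto \langle\pi(f)x, x\rangle$ is positive and bounded, so that
  the Riesz--Markov theorem yields a finite regular measure $\mu_x$. For open \<open>V\<close>, the increasing net
  of all $\pi(f)$ with $f \prec V$ converges strongly to an operator with quadratic form
  $x \mapsto \mu_x(V)$, and the Borel sets with such an operator in a given strongly closed subspace
  form a Dynkin system. This gives \<open>\<mu>\<close> and also the equality of the seven subspaces. All order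
  statements reduce to the measures $\mu_x$, because the supremum of a bounded increasing
  sequence in $L_{\mathrm{sa}}$ is its strong limit. For uniqueness, a regular measure \<open>\<nu>\<close> that
  represents \<open>\<pi>\<close> becomes finite when restricted to a compact set; hence
  $\nu(K) \le \pi(f) \le \nu(V)$ for $K \prec f \prec V$, and \<open>\<nu>\<close> is determined on open sets.\<close>

section \<open>Continuous functions with compact support\<close>

text \<open>Boundedness of the functionals is forced by positivity: if \<open>\<pi>\<close> were
  unbounded on the functions with values in [0, 1], a geometric series of witnesses would be one
  function in \<open>C0 X\<close> whose image has norm above every bound. The bound takes the form
  \<open>C * (norm x)\<^sup>2\<close>, so a single operator, \<open>C\<close> times the identity,
  dominates all nets that occur and supplies their strong limits. Two facts make quadratic forms
  sufficient. Over complex scalars polarization recovers an operator from its form, and the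
  inequality |T x|^2 \<le> |T| <T x, x> for positive \<open>T\<close> recovers norm convergence from
  convergence of forms. Hence order and convergence may be tested one vector at a time, and
  approximating sets may depend on the vector. The equality of the subspaces is carried along with
  the construction: every limit is shown to stay in an arbitrary strongly closed subspace that
  contains its ingredients.\<close>

definition carried :: "'x topology \<Rightarrow> ('x \<Rightarrow> real) \<Rightarrow> 'x set \<Rightarrow> bool"
  where "carried X f K \<longleftrightarrow> compactin X K \<and> (\<forall>x\<in>topspace X. f x \<noteq> 0 \<longrightarrow> x \<in> K)"

lemma Cc_continuous: "f \<in> Cc X \<Longrightarrow> continuous_map X euclideanreal f"
  and Cc_outside: "f \<in> Cc X \<Longrightarrow> x \<notin> topspace X \<Longrightarrow> f x = 0"
  by (auto simp: Cc_def)

abbreviation supp :: "'x topology \<Rightarrow> ('x \<Rightarrow> real) \<Rightarrow> 'x set"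
  where "supp X f \<equiv> X closure_of {x \<in> topspace X. f x \<noteq> 0}"

lemma supp_subset:
  assumes "Hausdorff_space X" "carried X f K"
  shows "supp X f \<subseteq> K"
  using assms unfolding carried_def
  by (intro closure_of_minimal) (auto intro: compactin_imp_closedin)

text \<open>Any compact carrier will do: in a Hausdorff space it is closed, hence contains the
  support, and a closed subset of a compact set is compact. Supports thus need not be computed for
  sums, products and truncations.\<close>

lemma CcI:
  assumes "Hausdorff_space X" "continuous_map X euclideanreal f"
    and "\<And>x. x \<notin> topspace X \<Longrightarrow> f x = 0" "carried X f K"
  shows "f \<in> Cc X"
  using assms supp_subset[OF assms(1,4)] unfolding Cc_def
  by (auto intro: closed_compactin simp: carried_def)

lemma carried_supp: "f \<in> Cc X \<Longrightarrow> carried X f (supp X f)"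
  unfolding carried_def Cc_def using closure_of_subset[of "{x \<in> topspace X. f x \<noteq> 0}" X] by auto

lemma supp_nonzero: "x \<in> topspace X \<Longrightarrow> f x \<noteq> 0 \<Longrightarrow> x \<in> supp X f"
  using closure_of_subset[of "{x \<in> topspace X. f x \<noteq> 0}" X] by auto

lemma compactin_supp: "f \<in> Cc X \<Longrightarrow> compactin X (supp X f)"
  by (simp add: Cc_def)

lemma carried_mono:
  assumes "carried X f K" "\<And>x. x \<in> topspace X \<Longrightarrow> f x = 0 \<Longrightarrow> g x = 0"
  shows "carried X g K"
  using assms unfolding carried_def by blast

lemma Cc_mult_left:
  assumes "Hausdorff_space X" "f \<in> Cc X" "continuous_map X euclideanreal g"
  shows "(\<lambda>x. g x * f x) \<in> Cc X"
  using assms carried_supp[OF assms(2)]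
  by (intro CcI[where K = "supp X f"])
    (auto intro!: continuous_map_real_mult simp: Cc_continuous Cc_outside elim: carried_mono)

lemma Cc_cmult: "Hausdorff_space X \<Longrightarrow> f \<in> Cc X \<Longrightarrow> (\<lambda>x. c * f x) \<in> Cc X"
  by (rule Cc_mult_left) auto

lemma Cc_binop:
  assumes "Hausdorff_space X" "f \<in> Cc X" "g \<in> Cc X"
    and "continuous_map X euclideanreal (\<lambda>x. h (f x) (g x))" "h 0 0 = 0"
  shows "(\<lambda>x. h (f x) (g x)) \<in> Cc X"
proof (rule CcI[where K = "supp X f \<union> supp X g"])
  have "h (f x) (g x) = 0" if "f x = 0" "g x = 0" for x
    using that assms(5) by simp
  then show "carried X (\<lambda>x. h (f x) (g x)) (supp X f \<union> supp X g)"
    using carried_supp[OF assms(2)] carried_supp[OF assms(3)]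
    unfolding carried_def by (blast intro: compactin_Un)
qed (use assms in \<open>auto simp: Cc_outside\<close>)

lemma Cc_add:
  assumes "Hausdorff_space X" "f \<in> Cc X" "g \<in> Cc X" shows "(\<lambda>x. f x + g x) \<in> Cc X"
  using assms by (intro Cc_binop[where h = "(+)"]) (auto intro!: continuous_map_add simp: Cc_continuous)

lemma Cc_diff:
  assumes "Hausdorff_space X" "f \<in> Cc X" "g \<in> Cc X" shows "(\<lambda>x. f x - g x) \<in> Cc X"
  using assms by (intro Cc_binop[where h = "(-)"]) (auto intro!: continuous_map_diff simp: Cc_continuous)

lemma Cc_max:
  assumes "Hausdorff_space X" "f \<in> Cc X" "g \<in> Cc X" shows "(\<lambda>x. max (f x) (g x)) \<in> Cc X"
  using assms by (intro Cc_binop[where h = max]) (auto intro!: continuous_map_real_max simp: Cc_continuous)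

lemma Cc_compose:
  assumes "Hausdorff_space X" "f \<in> Cc X" "continuous_on UNIV h" "h 0 = 0"
  shows "(\<lambda>x. h (f x)) \<in> Cc X"
proof -
  have "continuous_map X euclideanreal (h \<circ> f)"
    using assms by (intro continuous_map_compose[OF Cc_continuous]) auto
  then show ?thesis
    using assms by (intro Cc_binop[where h = "\<lambda>a b. h a" and g = f]) (auto simp: o_def)
qed

lemma Cc_zero: "Hausdorff_space X \<Longrightarrow> (\<lambda>x. 0) \<in> Cc X"
  by (rule CcI[where K = "{}"]) (auto simp: carried_def)

lemma C0_of_Cc:
  assumes f: "f \<in> Cc X"
  shows "f \<in> C0 X"
proof -
  have "compactin X {x \<in> topspace X. e \<le> \<bar>f x\<bar>}" if "e > 0" for e
  proof (rule closed_compactin[OF compactin_supp[OF f]])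
    show "{x \<in> topspace X. e \<le> \<bar>f x\<bar>} \<subseteq> supp X f"
      using that by (intro subsetI supp_nonzero) auto
    have "closedin X {x \<in> topspace X. \<bar>f x\<bar> \<in> {e..}}"
      using Cc_continuous[OF f]
      by (intro closedin_continuous_map_preimage[where Y = euclideanreal] continuous_map_real_abs) auto
    then show "closedin X {x \<in> topspace X. e \<le> \<bar>f x\<bar>}" by simp
  qed
  then show ?thesis using f by (auto simp: C0_def Cc_def)
qed

lemma closedin_ge:
  assumes "continuous_map X euclideanreal f"
  shows "closedin X {x \<in> topspace X. (c::real) \<le> f x}"
proof -
  have "closedin X {x \<in> topspace X. f x \<in> {c..}}"
    using assms by (intro closedin_continuous_map_preimage[where Y = euclideanreal]) auto
  then show ?thesis by simp
qed

lemma closedin_le: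
  assumes "continuous_map X euclideanreal f"
  shows "closedin X {x \<in> topspace X. f x \<le> (c::real)}"
proof -
  have "closedin X {x \<in> topspace X. f x \<in> {..c}}"
    using assms by (intro closedin_continuous_map_preimage[where Y = euclideanreal]) auto
  then show ?thesis by simp
qed

lemma compactin_ge:
  assumes "f \<in> Cc X" "(c::real) > 0"
  shows "compactin X {x \<in> topspace X. c \<le> f x}"
proof (rule closed_compactin[OF compactin_supp[OF assms(1)]])
  show "{x \<in> topspace X. c \<le> f x} \<subseteq> supp X f"
    using assms(2) by (intro subsetI supp_nonzero) auto
qed (use assms in \<open>auto intro: closedin_ge Cc_continuous\<close>)

lemma Cc_bounded:
  assumes "f \<in> Cc X"
  obtains C where "C \<ge> 0" "\<And>x. \<bar>f x\<bar> \<le> C"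
proof -
  have "compactin euclideanreal (f ` supp X f)"
    using assms by (intro image_compactin[OF compactin_supp Cc_continuous])
  then have "bounded (f ` supp X f)" by (simp add: compact_imp_bounded)
  then obtain C where C: "\<And>x. x \<in> supp X f \<Longrightarrow> \<bar>f x\<bar> \<le> C"
    unfolding bounded_iff by auto
  have "\<bar>f x\<bar> \<le> max C 0" for x
    using C[of x] supp_nonzero[of x X f] Cc_outside[OF assms, of x] by (cases "f x = 0") force+
  then show ?thesis by (intro that[of "max C 0"]) auto
qed

lemma Cc_Urysohn:
  assumes X: "locally_compact_space X" "Hausdorff_space X"
    and K: "compactin X K" and V: "openin X V" and "K \<subseteq> V"
  obtains f where "dominates X K f" "subordinate X f V"
proof -
  obtain U L where UL: "openin X U" "compactin X L" "closedin X L" "K \<subseteq> U" "U \<subseteq> L"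
    using K X locally_compact_space_compact_closed_compact[of X] by metis
  have "completely_regular_space X"
    using X locally_compact_Hausdorff_imp_regular_space
      locally_compact_regular_imp_completely_regular_space by blast
  moreover have "closedin X (topspace X - (U \<inter> V))"
    using UL V by auto
  moreover have "disjnt K (topspace X - (U \<inter> V))"
    using UL \<open>K \<subseteq> V\<close> by (auto simp: disjnt_def)
  ultimately obtain f where f: "continuous_map X (subtopology euclidean {0..1::real}) f"
      "f ` (topspace X - (U \<inter> V)) \<subseteq> {0}" "f ` K \<subseteq> {1}"
    using K Urysohn_completely_regular_compact_closed[of 0 1 X K] by auto
  have cf: "continuous_map X euclideanreal f" and f01: "\<And>x. x \<in> topspace X \<Longrightarrow> 0 \<le> f x \<and> f x \<le> 1"
    using f(1) by (auto simp: continuous_map_in_subtopology)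
  \<comment> \<open>\<open>f\<close> vanishes off \<open>U \<inter> V\<close>, but its support may
    leave that set. Cutting at height 1/2 moves the support into the closed set where
    \<open>f\<close> is at least 1/2, which lies in \<open>U \<inter> V\<close> and so in the
    compact set \<open>L\<close>.\<close>
  define g where "g x = (if x \<in> topspace X then max 0 (2 * f x - 1) else 0)" for x
  have "continuous_map X euclideanreal (\<lambda>x. max 0 (2 * f x - 1))"
    by (intro continuous_map_real_max continuous_map_diff continuous_map_real_mult_left cf) auto
  then have cg: "continuous_map X euclideanreal g"
    by (rule continuous_map_eq) (auto simp: g_def)
  let ?S = "{x \<in> topspace X. 1/2 \<le> f x}"
  have SUV: "?S \<subseteq> U \<inter> V" using f(2) by force
  have "compactin X ?S"
    using SUV UL by (intro closed_compactin[OF UL(2) _ closedin_ge[OF cf]]) auto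
  then have car: "carried X g ?S" by (auto simp: carried_def g_def)
  have "g \<in> Cc X" by (rule CcI[OF X(2) cg _ car]) (auto simp: g_def)
  moreover have "supp X g \<subseteq> V" using supp_subset[OF X(2) car] SUV by auto
  moreover have "K \<subseteq> topspace X" using K by (rule compactin_subset_topspace)
  ultimately show ?thesis
    using that[of g] f01 f(3) unfolding dominates_def subordinate_def
    by (force simp: g_def)
qed

text \<open>A partition of unity for two open sets, multiplied by \<open>f\<close>; it yields finite
  subadditivity of the Riesz content.\<close>

lemma subordinate_split:
  assumes X: "locally_compact_space X" "Hausdorff_space X"
    and V: "openin X V1" "openin X V2" and f: "subordinate X f (V1 \<union> V2)"
  obtains f1 f2 where "subordinate X f1 V1" "subordinate X f2 V2" "\<And>x. f x = f1 x + f2 x"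
proof -
  let ?K = "supp X f"
  have fC: "f \<in> Cc X" and f01: "\<And>x. x \<in> topspace X \<Longrightarrow> 0 \<le> f x \<and> f x \<le> 1" and fs: "?K \<subseteq> V1 \<union> V2"
    using f by (auto simp: subordinate_def)
  have K: "compactin X ?K" by (rule compactin_supp[OF fC])
  have "compactin X (?K - V2)"
    by (rule closed_compactin[OF K]) (auto intro: closedin_diff V)
  moreover have "?K - V2 \<subseteq> V1" using fs by auto
  ultimately obtain h where h: "dominates X (?K - V2) h" "subordinate X h V1"
    by (rule Cc_Urysohn[OF X _ V(1)])
  \<comment> \<open>The factor 2 leaves a margin: where \<open>1 - g\<close> is nonzero,
    \<open>h\<close> is below 1/2, and the closed set where \<open>h\<close> is at most 1/2 misses
    the part of the support outside \<open>V2\<close>, on which \<open>h\<close> is 1. With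
    \<open>h\<close> in place of \<open>g\<close> the support of the second summand could leave
    \<open>V2\<close>.\<close>
  define g where "g x = min 1 (2 * h x)" for x
  have hC: "h \<in> Cc X" and h01: "\<And>x. x \<in> topspace X \<Longrightarrow> 0 \<le> h x \<and> h x \<le> 1"
    and hs: "supp X h \<subseteq> V1"
    using h by (auto simp: subordinate_def)
  have cg: "continuous_map X euclideanreal g"
    unfolding g_def
    by (intro continuous_map_real_min continuous_map_real_mult_left Cc_continuous[OF hC]) auto
  let ?S = "?K \<inter> {x \<in> topspace X. h x \<le> 1/2}"
  have "compactin X ?S"
    by (intro compact_Int_closedin K closedin_le Cc_continuous hC)
  have "carried X (\<lambda>x. g x * f x) (supp X h)"
    using carried_supp[OF hC] by (rule carried_mono) (auto simp: g_def)
  then have s1: "supp X (\<lambda>x. g x * f x) \<subseteq> V1"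
    using supp_subset[OF X(2)] hs by blast
  have "carried X (\<lambda>x. (1 - g x) * f x) ?S"
    unfolding carried_def using \<open>compactin X ?S\<close> by (auto simp: g_def min_def supp_nonzero split: if_splits)
  then have "supp X (\<lambda>x. (1 - g x) * f x) \<subseteq> ?S"
    by (rule supp_subset[OF X(2)])
  also have "?S \<subseteq> V2"
    using h(1) by (force simp: dominates_def)
  finally have s2: "supp X (\<lambda>x. (1 - g x) * f x) \<subseteq> V2" .
  have g01: "0 \<le> g x \<and> g x \<le> 1" if "x \<in> topspace X" for x
    using h01[OF that] by (auto simp: g_def)
  show ?thesis
  proof
    show "subordinate X (\<lambda>x. g x * f x) V1"
      unfolding subordinate_def using s1 g01 f01 Cc_mult_left[OF X(2) fC cg]
      by (auto intro!: mult_le_one)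
    have "(\<lambda>x. (1 - g x) * f x) \<in> Cc X"
      by (rule Cc_mult_left[OF X(2) fC]) (intro continuous_map_diff cg continuous_map_const[THEN iffD2], simp)
    then show "subordinate X (\<lambda>x. (1 - g x) * f x) V2"
      unfolding subordinate_def using s2 g01 f01 by (auto intro!: mult_le_one)
  qed (auto simp: algebra_simps)
qed

section \<open>The Riesz--Markov theorem for bounded positive functionals\<close>

lemma space_borel_of [simp]: "space (borel_of X) = topspace X"
  and sets_borel_of: "sets (borel_of X) = sigma_sets (topspace X) {U. openin X U}"
proof -
  have "{U. openin X U} \<subseteq> Pow (topspace X)" by (auto dest: openin_subset)
  then show "space (borel_of X) = topspace X" "sets (borel_of X) = sigma_sets (topspace X) {U. openin X U}"
    by (auto simp: borel_of_def)
qed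

lemma borel_of_open: "openin X U \<Longrightarrow> U \<in> sets (borel_of X)"
  by (auto simp: sets_borel_of)

lemma borel_of_closed:
  assumes "closedin X U" shows "U \<in> sets (borel_of X)"
proof -
  have "topspace X - (topspace X - U) \<in> sets (borel_of X)"
    using assms sets.compl_sets[OF borel_of_open[of X "topspace X - U"]] by (simp add: openin_diff)
  moreover have "topspace X - (topspace X - U) = U" using closedin_subset[OF assms] by auto
  ultimately show ?thesis by simp
qed

lemma borel_of_compact: "Hausdorff_space X \<Longrightarrow> compactin X K \<Longrightarrow> K \<in> sets (borel_of X)"
  by (simp add: borel_of_closed compactin_imp_closedin)

lemma continuous_map_measurable:
  assumes "continuous_map X euclideanreal f"
  shows "f \<in> borel_measurable (borel_of X)"
proof (rule borel_measurableI)
  fix S :: "real set" assume "open S"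
  then have "openin X {x \<in> topspace X. f x \<in> S}"
    using assms by (intro openin_continuous_map_preimage[where Y = euclideanreal]) auto
  then show "f -` S \<inter> space (borel_of X) \<in> sets (borel_of X)"
    by (auto intro!: borel_of_open simp: vimage_def Int_def conj_commute)
qed

lemma Cc_measurable: "f \<in> Cc X \<Longrightarrow> f \<in> borel_measurable (borel_of X)"
  by (rule continuous_map_measurable[OF Cc_continuous])

definition regular_finite_measure :: "'x topology \<Rightarrow> 'x measure \<Rightarrow> bool"
  where "regular_finite_measure X N \<longleftrightarrow> sets N = sets (borel_of X) \<and> finite_measure N \<and>
    (\<forall>D\<in>sets N. \<forall>e>0. \<exists>V. openin X V \<and> D \<subseteq> V \<and> measure N V < measure N D + e) \<and>
    (\<forall>V. openin X V \<longrightarrow> (\<forall>e>0. \<exists>K. compactin X K \<and> K \<subseteq> V \<and> measure N V < measure N K + e))"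

text \<open>Boundedness is asked only on functions with values in [0, 1]; \<open>C\<close> then
  bounds the total mass of the representing measure, which is therefore finite.\<close>

locale bounded_positive_functional =
  fixes X :: "'x topology" and \<Lambda> :: "('x \<Rightarrow> real) \<Rightarrow> real" and C :: real
  assumes lc: "locally_compact_space X" and hd: "Hausdorff_space X"
    and \<Lambda>_add: "\<And>f g. f \<in> Cc X \<Longrightarrow> g \<in> Cc X \<Longrightarrow> \<Lambda> (\<lambda>x. f x + g x) = \<Lambda> f + \<Lambda> g"
    and \<Lambda>_cmult: "\<And>c f. f \<in> Cc X \<Longrightarrow> \<Lambda> (\<lambda>x. c * f x) = c * \<Lambda> f"
    and \<Lambda>_pos: "\<And>f. f \<in> Cc X \<Longrightarrow> (\<And>x. x \<in> topspace X \<Longrightarrow> 0 \<le> f x) \<Longrightarrow> 0 \<le> \<Lambda> f"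
    and \<Lambda>_bound: "\<And>f. f \<in> Cc X \<Longrightarrow> (\<And>x. x \<in> topspace X \<Longrightarrow> 0 \<le> f x \<and> f x \<le> 1) \<Longrightarrow> \<Lambda> f \<le> C"
begin

lemma \<Lambda>_diff:
  assumes "f \<in> Cc X" "g \<in> Cc X"
  shows "\<Lambda> (\<lambda>x. f x - g x) = \<Lambda> f - \<Lambda> g"
  using \<Lambda>_add[OF Cc_diff[OF hd assms] assms(2)] by simp

lemma \<Lambda>_mono:
  assumes "f \<in> Cc X" "g \<in> Cc X" "\<And>x. x \<in> topspace X \<Longrightarrow> f x \<le> g x"
  shows "\<Lambda> f \<le> \<Lambda> g"
  using \<Lambda>_pos[OF Cc_diff[OF hd assms(2,1)]] \<Lambda>_diff[OF assms(2,1)] assms(3) by simp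

lemma \<Lambda>_zero: "\<Lambda> (\<lambda>x. 0) = 0"
  using \<Lambda>_cmult[OF Cc_zero[OF hd], of 0] by simp

lemma C_nonneg: "0 \<le> C"
  using \<Lambda>_bound[OF Cc_zero[OF hd]] by (simp add: \<Lambda>_zero)

section \<open>The Riesz content of open sets and its outer measure\<close>

definition lam :: "'x set \<Rightarrow> ennreal"
  where "lam V = (SUP f\<in>{f. subordinate X f V}. ennreal (\<Lambda> f))"

definition om :: "'x set \<Rightarrow> ennreal"
  where "om E = (INF V\<in>{V. openin X V \<and> E \<subseteq> V}. lam V)"

lemma subordinate_zero: "subordinate X (\<lambda>x. 0) V"
  by (simp add: subordinate_def Cc_zero[OF hd])

lemma subordinate_CcD: "subordinate X f V \<Longrightarrow> f \<in> Cc X"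
  by (simp add: subordinate_def)

lemma subordinate_mono: "subordinate X f V \<Longrightarrow> V \<subseteq> W \<Longrightarrow> subordinate X f W"
  by (auto simp: subordinate_def)

lemma subordinate_nonneg: "subordinate X f V \<Longrightarrow> 0 \<le> \<Lambda> f"
  by (intro \<Lambda>_pos) (auto simp: subordinate_def)

lemma lam_upper: "subordinate X f V \<Longrightarrow> ennreal (\<Lambda> f) \<le> lam V"
  unfolding lam_def by (intro SUP_upper) auto

lemma lam_mono: "V \<subseteq> W \<Longrightarrow> lam V \<le> lam W"
  unfolding lam_def by (rule SUP_subset_mono) (auto intro: subordinate_mono)

lemma lam_le_C: "lam V \<le> ennreal C"
  unfolding lam_def by (intro SUP_least ennreal_leI \<Lambda>_bound) (auto simp: subordinate_def)

lemma lam_empty: "lam {} = 0"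
proof -
  have "\<Lambda> f = 0" if "subordinate X f {}" for f
  proof -
    have "f x = 0" for x
      using that supp_nonzero[of x X f] Cc_outside[OF subordinate_CcD[OF that], of x]
      by (cases "x \<in> topspace X") (auto simp: subordinate_def)
    then have "f = (\<lambda>x. 0)" by auto
    then show ?thesis by (simp add: \<Lambda>_zero)
  qed
  then have "lam {} \<le> 0" unfolding lam_def by (intro SUP_least) auto
  then show ?thesis by simp
qed

lemma om_open: "openin X V \<Longrightarrow> om V = lam V"
  unfolding om_def by (intro antisym INF_lower INF_greatest) (auto intro: lam_mono)

lemma om_mono: "D \<subseteq> E \<Longrightarrow> om D \<le> om E"
  unfolding om_def by (intro INF_superset_mono) auto

lemma om_le: "openin X V \<Longrightarrow> D \<subseteq> V \<Longrightarrow> om D \<le> lam V"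
  unfolding om_def by (intro INF_lower) auto

lemma om_le_C: "E \<subseteq> topspace X \<Longrightarrow> om E \<le> ennreal C"
  using om_le[of "topspace X" E] lam_le_C[of "topspace X"] by auto

lemma om_finite: "E \<subseteq> topspace X \<Longrightarrow> om E < top"
  using om_le_C[of E] ennreal_less_top[of C] by (meson order_le_less_trans)

lemma lam_Un:
  assumes "openin X V" "openin X W"
  shows "lam (V \<union> W) \<le> lam V + lam W"
  unfolding lam_def[of "V \<union> W"]
proof (rule SUP_least, clarify)
  fix f assume "subordinate X f (V \<union> W)"
  then obtain f1 f2 where f: "subordinate X f1 V" "subordinate X f2 W" "\<And>x. f x = f1 x + f2 x"
    using subordinate_split[OF lc hd assms] by blast
  then have "f = (\<lambda>x. f1 x + f2 x)" by auto
  then have "ennreal (\<Lambda> f) = ennreal (\<Lambda> f1) + ennreal (\<Lambda> f2)"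
    using f by (simp add: \<Lambda>_add subordinate_CcD subordinate_nonneg)
  then show "ennreal (\<Lambda> f) \<le> lam V + lam W"
    using f by (simp add: add_mono lam_upper)
qed

lemma lam_UN_finite:
  fixes V :: "nat \<Rightarrow> 'x set"
  assumes "\<And>i. openin X (V i)"
  shows "lam (\<Union>i<n. V i) \<le> (\<Sum>i<n. lam (V i))"
proof (induction n)
  case (Suc n)
  have "lam (\<Union>i<Suc n. V i) \<le> lam (V n) + lam (\<Union>i<n. V i)"
    using lam_Un[of "V n" "\<Union>i<n. V i"] assms by (auto simp: lessThan_Suc)
  also have "\<dots> \<le> lam (V n) + (\<Sum>i<n. lam (V i))"
    using Suc by (intro add_left_mono)
  finally show ?case by (simp add: add.commute)
qed (simp add: lam_empty)

text \<open>A single subordinate function has compact support and so meets a countable cover only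
  through finitely many members; countable subadditivity thus reduces to the finite case.\<close>

lemma lam_UN:
  fixes V :: "nat \<Rightarrow> 'x set"
  assumes V: "\<And>i. openin X (V i)"
  shows "lam (\<Union>i. V i) \<le> (\<Sum>i. lam (V i))"
  unfolding lam_def[of "\<Union>i. V i"]
proof (rule SUP_least, clarify)
  fix f assume f: "subordinate X f (\<Union>i. V i)"
  have "compactin X (supp X f)" "supp X f \<subseteq> \<Union> (range V)"
    using f by (auto simp: subordinate_def compactin_supp)
  then obtain \<F> where \<F>: "finite \<F>" "\<F> \<subseteq> range V" "supp X f \<subseteq> \<Union>\<F>"
    using V unfolding compactin_def by (metis (no_types, lifting) imageE)
  obtain I where I: "finite I" "\<F> = V ` I" using finite_subset_image[OF \<F>(1,2)] by auto
  obtain n where "I \<subseteq> {..<n}" using finite_nat_iff_bounded[of I] I(1) by auto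
  then have "subordinate X f (\<Union>i<n. V i)"
    using f \<F>(3) I(2) by (fastforce simp: subordinate_def)
  then have "ennreal (\<Lambda> f) \<le> (\<Sum>i<n. lam (V i))"
    using lam_upper lam_UN_finite[of V n] V by (meson order_trans)
  also have "\<dots> \<le> (\<Sum>i. lam (V i))" by (rule sum_le_suminf) auto
  finally show "ennreal (\<Lambda> f) \<le> (\<Sum>i. lam (V i))" .
qed

lemma om_approx:
  assumes "E \<subseteq> topspace X" "e > 0"
  obtains V where "openin X V" "E \<subseteq> V" "lam V < om E + ennreal e"
proof -
  have "om E < om E + ennreal e"
    using om_finite[OF assms(1)] assms(2) ennreal_add_left_cancel_less[of "om E" 0 "ennreal e"] by simp
  then show ?thesis
    using that unfolding om_def[of E] by (auto simp: INF_less_iff)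
qed

lemma om_countably_subadditive: "countably_subadditive (Pow (topspace X)) om"
  unfolding countably_subadditive_def
proof safe
  fix A :: "nat \<Rightarrow> 'x set" assume A: "range A \<subseteq> Pow (topspace X)"
  show "om (\<Union>i. A i) \<le> (\<Sum>i. om (A i))"
  proof (rule ennreal_le_epsilon)
    fix e :: real assume e: "0 < e"
    have "\<exists>V. openin X V \<and> A i \<subseteq> V \<and> lam V < om (A i) + ennreal (e * (1/2) ^ Suc i)" for i
      using A e om_approx[of "A i" "e * (1/2) ^ Suc i"] by (metis PowD UNIV_I image_subset_iff zero_less_power mult_pos_pos half_gt_zero_iff zero_less_one)
    then obtain V where V: "\<And>i. openin X (V i)" "\<And>i. A i \<subseteq> V i"
      "\<And>i. lam (V i) < om (A i) + ennreal (e * (1/2) ^ Suc i)" by metis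
    have "(\<lambda>i. e * (1/2) ^ Suc i) sums (e * 1)"
      by (intro sums_mult power_half_series)
    then have se: "(\<Sum>i. ennreal (e * (1/2) ^ Suc i)) = ennreal e"
      using e by (intro suminf_eq_SUP[THEN trans] sums_unique[symmetric])
        (auto intro!: sums_ennreal[THEN iffD2])
    have "om (\<Union>i. A i) \<le> lam (\<Union>i. V i)"
      using V by (intro om_le) auto
    also have "\<dots> \<le> (\<Sum>i. lam (V i))" by (rule lam_UN[OF V(1)])
    also have "\<dots> \<le> (\<Sum>i. om (A i) + ennreal (e * (1/2) ^ Suc i))"
      using V(3) by (intro suminf_le less_imp_le) auto
    also have "\<dots> = (\<Sum>i. om (A i)) + (\<Sum>i. ennreal (e * (1/2) ^ Suc i))"
      by (intro suminf_add[symmetric]) auto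
    finally show "om (\<Union>i. A i) \<le> (\<Sum>i. om (A i)) + ennreal e" by (simp only: se)
  qed
qed

section \<open>Caratheodory measurability of open sets\<close>

lemma om_positive: "positive (Pow (topspace X)) om"
  using om_open[of "{}"] by (simp add: positive_def lam_empty)

lemma outer_measure_om: "outer_measure_space (Pow (topspace X)) om"
  unfolding outer_measure_space_def
  by (auto simp: om_positive om_countably_subadditive increasing_def intro: om_mono)

text \<open>If \<open>f\<close> is subordinate to \<open>W \<inter> V\<close> and \<open>g\<close>
  to \<open>W\<close> minus the support of \<open>f\<close>, the two are never nonzero at the same
  point, so \<open>f + g\<close> is again bounded by 1 and subordinate to \<open>W\<close>. Since
  the support of \<open>f\<close> lies in \<open>V\<close>, the open set available to
  \<open>g\<close> contains \<open>W - V\<close>.\<close>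

lemma lam_split:
  assumes V: "openin X V" and W: "openin X W"
  shows "lam (W \<inter> V) + om (W - V) \<le> lam W"
proof -
  have "om (W - V) < top" using openin_subset[OF W] by (intro om_finite) auto
  then have eq: "lam (W \<inter> V) + om (W - V) =
      (SUP f\<in>{f. subordinate X f (W \<inter> V)}. ennreal (\<Lambda> f) + om (W - V))"
    unfolding lam_def by (intro ennreal_SUP_add_left[symmetric]) (auto intro: subordinate_zero)
  show ?thesis unfolding eq
  proof (rule SUP_least, clarify)
    fix f assume f: "subordinate X f (W \<inter> V)"
    let ?U = "W - supp X f"
    have U: "openin X ?U" using W by (intro openin_diff) auto
    have "ennreal (\<Lambda> f) + om (W - V) \<le> ennreal (\<Lambda> f) + lam ?U"
      using f by (intro add_left_mono om_le U) (auto simp: subordinate_def)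
    also have "\<dots> = (SUP g\<in>{g. subordinate X g ?U}. ennreal (\<Lambda> f) + ennreal (\<Lambda> g))"
      unfolding lam_def by (subst ennreal_SUP_add_right) (auto intro: subordinate_zero)
    also have "\<dots> \<le> lam W"
    proof (rule SUP_least, clarify)
      fix g assume g: "subordinate X g ?U"
      have sup: "carried X (\<lambda>x. f x + g x) (supp X f \<union> supp X g)"
        using carried_supp[OF subordinate_CcD[OF f]] carried_supp[OF subordinate_CcD[OF g]]
        unfolding carried_def by (auto intro: compactin_Un)
      have "0 \<le> f x + g x \<and> f x + g x \<le> 1" if x: "x \<in> topspace X" for x
      proof -
        have "f x = 0 \<or> g x = 0"
          using g supp_nonzero[OF x, of f] supp_nonzero[OF x, of g] by (auto simp: subordinate_def)
        then show ?thesis using f g x by (auto simp: subordinate_def)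
      qed
      moreover have "supp X (\<lambda>x. f x + g x) \<subseteq> W"
        using supp_subset[OF hd sup] f g by (auto simp: subordinate_def)
      ultimately have "subordinate X (\<lambda>x. f x + g x) W"
        using f g by (simp add: subordinate_def Cc_add hd)
      from lam_upper[OF this] show "ennreal (\<Lambda> f) + ennreal (\<Lambda> g) \<le> lam W"
        using f g by (simp add: \<Lambda>_add subordinate_CcD subordinate_nonneg)
    qed
    finally show "ennreal (\<Lambda> f) + om (W - V) \<le> lam W" .
  qed
qed

text \<open>For an open test set Caratheodory's condition is \<open>lam_split\<close>; an arbitrary
  test set \<open>E\<close> is reached through its open supersets, over which \<open>om E\<close> is
  the infimum.\<close>

lemma open_in_lambda_system:
  assumes V: "openin X V"
  shows "V \<in> lambda_system (topspace X) (Pow (topspace X)) om"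
  unfolding lambda_system_def
proof safe
  fix x assume "x \<in> V" then show "x \<in> topspace X" using openin_subset[OF V] by auto
next
  interpret sigma_algebra "topspace X" "Pow (topspace X)" by (rule sigma_algebra_Pow)
  fix E assume E: "E \<subseteq> topspace X"
  let ?E1 = "V \<inter> E" and ?E2 = "(topspace X - V) \<inter> E"
  show "om ?E1 + om ?E2 = om E"
  proof (rule antisym)
    show "om ?E1 + om ?E2 \<le> om E"
      unfolding om_def[of E]
    proof (rule INF_greatest, clarify)
      fix W assume W: "openin X W" "E \<subseteq> W"
      have "om ?E1 + om ?E2 \<le> lam (W \<inter> V) + om (W - V)"
        using W V by (intro add_mono om_le om_mono) auto
      then show "om ?E1 + om ?E2 \<le> lam W" using lam_split[OF V W(1)] by (rule order_trans)
    qed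
    have "subadditive (Pow (topspace X)) om"
      using countably_subadditive_subadditive[OF om_positive om_countably_subadditive] .
    from subadditiveD[OF this, of ?E1 ?E2] show "om E \<le> om ?E1 + om ?E2"
    proof -
      have "?E1 \<union> ?E2 = E" using E by auto
      then show ?thesis
        using E \<open>\<lbrakk>?E1 \<inter> ?E2 = {}; ?E1 \<in> Pow (topspace X); ?E2 \<in> Pow (topspace X)\<rbrakk>
          \<Longrightarrow> om (?E1 \<union> ?E2) \<le> om ?E1 + om ?E2\<close> by (simp add: Int_Diff) blast
    qed
  qed
qed

section \<open>The Riesz measure and its integrals\<close>

definition N :: "'x measure"
  where "N = measure_of (topspace X) {U. openin X U} om"

lemma sets_N: "sets N = sets (borel_of X)" and space_N: "space N = topspace X"
proof -
  have "{U. openin X U} \<subseteq> Pow (topspace X)" by (auto dest: openin_subset)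
  then show "sets N = sets (borel_of X)" "space N = topspace X"
    by (auto simp: N_def sets_borel_of)
qed

text \<open>The Caratheodory sets form a sigma-algebra that contains the open sets, hence all Borel
  sets, and \<open>om\<close> is countably additive on it.\<close>

lemma emeasure_N:
  assumes "D \<in> sets (borel_of X)"
  shows "emeasure N D = om D"
proof -
  interpret P: sigma_algebra "topspace X" "Pow (topspace X)" by (rule sigma_algebra_Pow)
  let ?L = "lambda_system (topspace X) (Pow (topspace X)) om"
  have ms: "measure_space (topspace X) ?L om"
    by (rule P.caratheodory_lemma[OF outer_measure_om])
  then interpret L: sigma_algebra "topspace X" ?L by (simp add: measure_space_def)
  have sub: "sets N \<subseteq> ?L"
    unfolding sets_N sets_borel_of by (rule L.sigma_sets_subset) (auto intro: open_in_lambda_system)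
  show ?thesis
  proof (rule emeasure_measure_of[OF N_def])
    show "{U. openin X U} \<subseteq> Pow (topspace X)" by (auto dest: openin_subset)
    show "positive (sets N) om" using om_positive by (simp add: positive_def)
    show "countably_additive (sets N) om"
      using ms sub unfolding measure_space_def countably_additive_def by (meson order_trans subsetD)
  qed (use assms sets_N in auto)
qed

sublocale N: finite_measure N
  by standard (use emeasure_N[of "topspace X"] om_finite[of "topspace X"] in \<open>auto simp: space_N borel_of_open\<close>)

lemma measure_N_le: "measure N D \<le> C"
proof -
  have "emeasure N D \<le> emeasure N (topspace X)"
    using emeasure_space[of N D] by (simp add: space_N)
  also have "\<dots> \<le> ennreal C" by (simp add: emeasure_N borel_of_open om_le_C)
  finally show ?thesis
    using C_nonneg by (simp add: N.emeasure_eq_measure)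
qed

text \<open>Every open superset of \<open>K\<close> has \<open>f\<close> among its subordinate
  functions, so \<open>\<Lambda> f\<close> lies below every member of the infimum that defines
  \<open>om K\<close>.\<close>

lemma \<Lambda>_le_measure:
  assumes f: "f \<in> Cc X" "\<And>x. x \<in> topspace X \<Longrightarrow> 0 \<le> f x \<and> f x \<le> 1" and K: "carried X f K"
  shows "\<Lambda> f \<le> measure N K"
proof -
  have "compactin X K" using K by (simp add: carried_def)
  then have "ennreal (measure N K) = om K"
    by (simp add: N.emeasure_eq_measure[symmetric] emeasure_N borel_of_compact hd)
  moreover have "ennreal (\<Lambda> f) \<le> om K"
    unfolding om_def
  proof (rule INF_greatest, clarify)
    fix V assume "openin X V" "K \<subseteq> V"
    then have "subordinate X f V" using f supp_subset[OF hd K] by (auto simp: subordinate_def)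
    then show "ennreal (\<Lambda> f) \<le> lam V" by (rule lam_upper)
  qed
  ultimately show ?thesis by (metis ennreal_le_iff measure_nonneg)
qed

lemma integrable_Cc:
  assumes "f \<in> Cc X"
  shows "integrable N f"
proof -
  obtain B where "\<And>x. \<bar>f x\<bar> \<le> B" using Cc_bounded[OF assms] by auto
  moreover have "f \<in> borel_measurable N"
    using Cc_measurable[OF assms] measurable_cong_sets[OF sets_N refl] by auto
  ultimately show ?thesis by (intro N.integrable_const_bound[where B = B]) auto
qed

text \<open>The layer between the truncations at \<open>k * d\<close> and \<open>(k + 1) * d\<close> is carried by \<open>{f \<ge> k * d}\<close>, where
  the preceding layer is constantly \<open>d\<close>. Only the lowest layer, of mass at most \<open>C * d\<close>, is left over.\<close>

lemma \<Lambda>_step: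
  assumes f: "f \<in> Cc X" "\<And>x. x \<in> topspace X \<Longrightarrow> 0 \<le> f x" and d: "d > 0"
  shows "\<Lambda> (\<lambda>x. min (f x) (real (Suc k) * d)) \<le> C * d + (\<integral>x. min (f x) (real k * d) \<partial>N)"
proof (induction k)
  have Cm: "(\<lambda>x. min (f x) (real k * d)) \<in> Cc X" for k
    using d by (intro Cc_compose[OF hd f(1), where h = "\<lambda>t. min t (real k * d)"])
      (auto intro!: continuous_intros)
  {
    case 0
    have "(1/d) * \<Lambda> (\<lambda>x. min (f x) (real 1 * d)) \<le> C"
      unfolding \<Lambda>_cmult[OF Cm, symmetric]
      by (rule \<Lambda>_bound[OF Cc_cmult[OF hd Cm]]) (use f(2) d in \<open>auto simp: field_simps min_def\<close>)
    then have "\<Lambda> (\<lambda>x. min (f x) (real 1 * d)) \<le> C * d"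
      using d by (simp add: field_simps)
    moreover have "(\<integral>x. min (f x) (real 0 * d) \<partial>N) = (\<integral>x. 0 \<partial>N)"
      using f(2) by (intro Bochner_Integration.integral_cong) (auto simp: space_N min_def intro: antisym)
    ultimately show ?case by simp
  next
    case (Suc k)
    let ?m = "\<lambda>k x. min (f x) (real k * d)"
    let ?g = "\<lambda>x. ?m (Suc (Suc k)) x - ?m (Suc k) x"
    let ?K = "{x \<in> topspace X. real (Suc k) * d \<le> f x}"
    have K: "compactin X ?K" using d by (intro compactin_ge[OF f(1)]) auto
    then have Ks: "?K \<in> sets N" by (simp add: sets_N borel_of_compact hd)
    have gC: "?g \<in> Cc X" by (rule Cc_diff[OF hd Cm Cm])
    have "(1/d) * \<Lambda> ?g \<le> measure N ?K"
      unfolding \<Lambda>_cmult[OF gC, symmetric]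
    proof (rule \<Lambda>_le_measure[OF Cc_cmult[OF hd gC]])
      show "carried X (\<lambda>x. 1 / d * ?g x) ?K"
        unfolding carried_def using K d by (auto simp: min_def algebra_simps split: if_splits)
      show "0 \<le> 1 / d * ?g x \<and> 1 / d * ?g x \<le> 1" if "x \<in> topspace X" for x
        using d by (auto simp: field_simps min_def)
    qed
    then have "\<Lambda> ?g \<le> d * measure N ?K" using d by (simp add: field_simps)
    also have "\<dots> = (\<integral>x. d * indicator ?K x \<partial>N)" using Ks by simp
    also have "\<dots> \<le> (\<integral>x. ?m (Suc k) x - ?m k x \<partial>N)"
    proof (rule integral_mono[OF _ integrable_Cc[OF Cc_diff[OF hd Cm Cm]]])
      show "integrable N (\<lambda>x. d * indicator ?K x)"
        using Ks by (intro integrable_mult_right integrable_real_indicator) (auto simp: less_top[symmetric])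
    qed (use d in \<open>auto simp: indicator_def min_def algebra_simps\<close>)
    also have "\<dots> = (\<integral>x. ?m (Suc k) x \<partial>N) - (\<integral>x. ?m k x \<partial>N)"
      by (intro Bochner_Integration.integral_diff integrable_Cc Cm)
    finally show ?case using Suc \<Lambda>_diff[OF Cm Cm, of "Suc (Suc k)" "Suc k"] by linarith
  }
qed

lemma \<Lambda>_le_integral:
  assumes f: "f \<in> Cc X" "\<And>x. x \<in> topspace X \<Longrightarrow> 0 \<le> f x \<and> f x \<le> 1"
  shows "\<Lambda> f \<le> (\<integral>x. f x \<partial>N)"
proof -
  have *: "\<Lambda> f \<le> C * inverse (real (Suc n)) + (\<integral>x. f x \<partial>N)" for n
  proof -
    \<comment> \<open>With \<open>k = n\<close> in \<open>\<Lambda>_step\<close> the highest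
      truncation level \<open>(k + 1) * ?d\<close> is exactly 1, where truncation returns
      \<open>f\<close> itself; the error is then \<open>C / (n + 1)\<close>.\<close>
    let ?d = "inverse (real (Suc n))"
    have f1: "(\<lambda>x. min (f x) (real (Suc n) * ?d)) = f"
      using f(2) Cc_outside[OF f(1)] by (force simp: min_def)
    have "(\<integral>x. min (f x) (real n * ?d) \<partial>N) \<le> (\<integral>x. f x \<partial>N)"
      by (intro integral_mono integrable_Cc f Cc_compose[OF hd f(1), where h = "\<lambda>t. min t (real n * ?d)"])
        (auto intro!: continuous_intros)
    moreover have "\<Lambda> f \<le> C * ?d + (\<integral>x. min (f x) (real n * ?d) \<partial>N)"
      using \<Lambda>_step[OF f(1), of ?d n] f(2) unfolding f1 by simp
    ultimately show ?thesis by linarith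
  qed
  have "(\<lambda>n. C * inverse (real (Suc n)) + (\<integral>x. f x \<partial>N)) \<longlonglongrightarrow> C * 0 + (\<integral>x. f x \<partial>N)"
    by (intro tendsto_intros LIMSEQ_inverse_real_of_nat)
  then show ?thesis using * by (intro LIMSEQ_le_const) auto
qed

lemma measure_open_approx:
  assumes V: "openin X V" and e: "e > 0"
  obtains f where "subordinate X f V" "measure N V < \<Lambda> f + e"
\<comment> \<open>\<open>ennreal\<close> sends negative reals to 0, so the case of a negative
  \<open>measure N V - e\<close> is treated apart, by the zero function.\<close>
proof (cases "measure N V < e")
  case True
  then show ?thesis using that[OF subordinate_zero] by (simp add: \<Lambda>_zero)
next
  case False
  have "ennreal (measure N V - e) < ennreal (measure N V)"
    using e False by (simp add: ennreal_less_iff)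
  also have "\<dots> = lam V"
    by (simp add: N.emeasure_eq_measure[symmetric] emeasure_N borel_of_open om_open V)
  finally obtain f where f: "subordinate X f V" "ennreal (measure N V - e) < ennreal (\<Lambda> f)"
    unfolding lam_def by (auto simp: less_SUP_iff)
  then show ?thesis using that[OF f(1)] False by (simp add: ennreal_less_iff)
qed

text \<open>Equality on all of \<^term>\<open>Cc X\<close> is forced by the inequality for \<open>h - f\<close>, where \<open>h\<close> is chosen
  such that \<open>\<Lambda> h\<close> nearly exhausts the total mass.\<close>

lemma integral_le_\<Lambda>:
  assumes f: "f \<in> Cc X" "\<And>x. x \<in> topspace X \<Longrightarrow> 0 \<le> f x \<and> f x \<le> 1"
  shows "(\<integral>x. f x \<partial>N) \<le> \<Lambda> f"
proof (rule field_le_epsilon)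
  fix e :: real assume e: "0 < e"
  let ?T = "topspace X"
  obtain h0 where h0: "subordinate X h0 ?T" "measure N ?T < \<Lambda> h0 + e"
    using measure_open_approx[OF _ e, of ?T] by auto
  \<comment> \<open>\<open>h0\<close> alone need not dominate \<open>f\<close>. On the support of
    \<open>f\<close> the function \<open>h1\<close> is 1, which secures
    \<open>f \<le> h\<close>.\<close>
  obtain h1 where h1: "dominates X (supp X f) h1"
    using Cc_Urysohn[OF lc hd compactin_supp[OF f(1)], of ?T] by (auto simp: closure_of_subset_topspace)
  define h where "h x = max (h0 x) (h1 x)" for x
  have hC: "h \<in> Cc X"
    unfolding h_def using h0 h1 by (intro Cc_max hd) (auto simp: subordinate_def dominates_def)
  have h01: "h x \<le> 1" "f x \<le> h x" if x: "x \<in> ?T" for x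
    using h0 h1 f(2)[OF x] x supp_nonzero[OF x, of f]
    by (auto simp: h_def subordinate_def dominates_def le_max_iff_disj)
  have "(\<integral>x. h x \<partial>N) \<le> (\<integral>x. 1 \<partial>N)"
    using h01 by (intro integral_mono integrable_Cc[OF hC]) (auto simp: space_N)
  also have "\<dots> = measure N ?T" by (simp add: space_N)
  also have "\<dots> < \<Lambda> h0 + e" by fact
  also have "\<Lambda> h0 \<le> \<Lambda> h"
    using h0 by (intro \<Lambda>_mono hC) (auto simp: h_def subordinate_def)
  finally have 1: "(\<integral>x. h x \<partial>N) < \<Lambda> h + e" by simp
  have "\<Lambda> (\<lambda>x. h x - f x) \<le> (\<integral>x. h x - f x \<partial>N)"
    using h01 f(2) by (intro \<Lambda>_le_integral Cc_diff hd hC f) (fastforce simp: algebra_simps intro: order_trans add_increasing2)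
  then have "\<Lambda> h - \<Lambda> f \<le> (\<integral>x. h x \<partial>N) - (\<integral>x. f x \<partial>N)"
    by (simp add: \<Lambda>_diff hC f integrable_Cc)
  with 1 show "(\<integral>x. f x \<partial>N) \<le> \<Lambda> f + e" by simp
qed

lemma \<Lambda>_eq_integral_nonneg:
  assumes f: "f \<in> Cc X" "\<And>x. x \<in> topspace X \<Longrightarrow> 0 \<le> f x"
  shows "\<Lambda> f = (\<integral>x. f x \<partial>N)"
proof -
  obtain B where B: "B \<ge> 0" "\<And>x. \<bar>f x\<bar> \<le> B" using Cc_bounded[OF f(1)] by auto
  let ?c = "1 / (B + 1)"
  have gC: "(\<lambda>x. ?c * f x) \<in> Cc X" by (rule Cc_cmult[OF hd f(1)])
  have g01: "0 \<le> ?c * f x \<and> ?c * f x \<le> 1" if "x \<in> topspace X" for x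
    using B f(2)[OF that] B(2)[of x] by (auto simp: field_simps)
  have "\<Lambda> (\<lambda>x. ?c * f x) = (\<integral>x. ?c * f x \<partial>N)"
    using \<Lambda>_le_integral[OF gC g01] integral_le_\<Lambda>[OF gC g01] by simp
  then have "?c * \<Lambda> f = ?c * (\<integral>x. f x \<partial>N)" unfolding \<Lambda>_cmult[OF f(1)] by simp
  then show ?thesis using B(1) by (subst (asm) mult_cancel_left) auto
qed

lemma \<Lambda>_eq_integral:
  assumes f: "f \<in> Cc X"
  shows "\<Lambda> f = (\<integral>x. f x \<partial>N)"
proof -
  have p: "(\<lambda>x. max (f x) 0) \<in> Cc X" and n: "(\<lambda>x. max (- f x) 0) \<in> Cc X"
    by (rule Cc_compose[OF hd f, where h = "\<lambda>t. max t 0"] Cc_compose[OF hd f, where h = "\<lambda>t. max (- t) 0"],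
        auto intro!: continuous_intros)+
  have f_eq: "f = (\<lambda>x. max (f x) 0 - max (- f x) 0)" by (auto simp: max_def)
  have "\<Lambda> f = \<Lambda> (\<lambda>x. max (f x) 0) - \<Lambda> (\<lambda>x. max (- f x) 0)"
    by (subst f_eq) (rule \<Lambda>_diff[OF p n])
  also have "\<dots> = (\<integral>x. max (f x) 0 - max (- f x) 0 \<partial>N)"
    by (simp add: \<Lambda>_eq_integral_nonneg[OF p] \<Lambda>_eq_integral_nonneg[OF n] integrable_Cc[OF p] integrable_Cc[OF n])
  finally show ?thesis using f_eq by simp
qed

section \<open>Regularity of the Riesz measure\<close>

lemma N_outer:
  assumes D: "D \<in> sets N" and e: "e > 0"
  obtains V where "openin X V" "D \<subseteq> V" "measure N V < measure N D + e"
proof -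
  have "D \<subseteq> topspace X" using sets.sets_into_space[OF D] by (simp add: space_N)
  then obtain V where V: "openin X V" "D \<subseteq> V" "lam V < om D + ennreal e" by (rule om_approx[OF _ e])
  then have "emeasure N V < emeasure N D + ennreal e"
    using D by (simp add: emeasure_N om_open borel_of_open sets_N)
  then have "measure N V < measure N D + e"
    using e by (simp add: N.emeasure_eq_measure ennreal_plus[symmetric] ennreal_less_iff del: ennreal_plus)
  with V show ?thesis using that by auto
qed

text \<open>The support of a nearly optimal subordinate function is the required compact set,
  because \<open>\<Lambda> f\<close> is at most the measure of the support.\<close>

lemma N_inner:
  assumes V: "openin X V" and e: "e > 0"
  obtains K where "compactin X K" "K \<subseteq> V" "measure N V < measure N K + e"
proof -
  obtain f where f: "subordinate X f V" "measure N V < \<Lambda> f + e"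
    by (rule measure_open_approx[OF V e])
  moreover have "\<Lambda> f \<le> measure N (supp X f)"
    using f by (intro \<Lambda>_le_measure carried_supp) (auto simp: subordinate_def)
  ultimately show ?thesis
    using that[of "supp X f"] by (auto simp: subordinate_def compactin_supp)
qed

lemma regular_N: "regular_finite_measure X N"
  unfolding regular_finite_measure_def using N_outer N_inner
  by (metis N.finite_measure_axioms sets_N)

end

section \<open>Quadratic forms of operators\<close>

lemma scaleC_zero_right [simp]: "c *\<^sub>C (0::'h::complex_hilbert) = 0"
  using scaleC_add_right[of c 0 "0::'h"] by simp

lemma scaleC_minus_left: "(- c) *\<^sub>C x = - (c *\<^sub>C (x::'h::complex_hilbert))"
  using scaleC_add_left[of "-c" c x] scaleC_add_left[of 0 0 x] by (simp add: eq_neg_iff_add_eq_0)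

lemma cinner_add_right: "cinner x (y + z) = cinner x y + cinner x (z::'h::complex_hilbert)"
  by (subst (1 2 3) cinner_commute) (simp add: cinner_add_left)

lemma cinner_scaleC_right: "cinner x (c *\<^sub>C y) = cnj c * cinner x (y::'h::complex_hilbert)"
  by (subst (1 2) cinner_commute) (simp add: cinner_scaleC_left)

lemma cinner_minus_left: "cinner (- x) y = - cinner x (y::'h::complex_hilbert)"
  using cinner_scaleC_left[of "-1" x y] by (simp add: scaleC_minus_left scaleC_one)

lemma cinner_diff_left: "cinner (x - y) z = cinner x z - cinner y (z::'h::complex_hilbert)"
  using cinner_add_left[of x "-y" z] by (simp add: cinner_minus_left)

lemma cinner_minus_right: "cinner x (- y) = - cinner x (y::'h::complex_hilbert)"
  using cinner_scaleC_right[of x "-1" y] by (simp add: scaleC_minus_left scaleC_one)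

lemma cinner_diff_right: "cinner x (y - z) = cinner x y - cinner x (z::'h::complex_hilbert)"
  using cinner_add_right[of x y "-z"] by (simp add: cinner_minus_right)

lemma cinner_scaleR_left: "cinner (r *\<^sub>R x) y = of_real r * cinner x (y::'h::complex_hilbert)"
  by (simp add: scaleR_eq_scaleC cinner_scaleC_left)

lemma cinner_zero_left [simp]: "cinner 0 (x::'h::complex_hilbert) = 0"
  using cinner_diff_left[of x x x] by simp

lemma norm_sq_cinner: "(norm x)\<^sup>2 = Re (cinner x (x::'h::complex_hilbert))"
  by (simp add: norm_eq_sqrt_cinner[where 'a='h] cinner_ge_zero)

text \<open>The form may be degenerate: besides the inner product itself, it is applied to
  \<open>cinner (T x) y\<close> for a positive operator \<open>T\<close>, which can have a
  kernel.\<close>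

lemma positive_form_Cauchy_Schwarz:
  fixes B :: "'h::complex_hilbert \<Rightarrow> 'h \<Rightarrow> complex"
  assumes add: "\<And>x y z. B (x + y) z = B x z + B y z"
    and scale: "\<And>c x y. B (c *\<^sub>C x) y = c * B x y"
    and sym: "\<And>x y. B x y = cnj (B y x)"
    and pos: "\<And>x. 0 \<le> Re (B x x)"
  shows "(cmod (B x y))\<^sup>2 \<le> Re (B x x) * Re (B y y)"
proof -
  have add': "B z (x + y) = B z x + B z y" for x y z
    by (subst (1 2 3) sym) (simp add: add)
  have scale': "B x (c *\<^sub>C y) = cnj c * B x y" for c x y
    by (subst (1 2) sym) (simp add: scale)
  have key: "0 \<le> Re (B x x) - 2 * t * (cmod (B x y))\<^sup>2 + t\<^sup>2 * (cmod (B x y))\<^sup>2 * Re (B y y)" for t :: real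
  proof -
    \<comment> \<open>The factor \<open>B x y\<close> aligns the phases, so that both cross terms
      equal \<open>- t\<close> times the squared modulus. What remains is a real quadratic
      polynomial in \<open>t\<close>, to be evaluated at \<open>1 / Re (B y y)\<close>.\<close>
    let ?c = "- of_real t * B x y"
    have yx: "B y x = cnj (B x y)" by (rule sym)
    have "B (x + ?c *\<^sub>C y) (x + ?c *\<^sub>C y) =
      B x x - 2 * of_real t * (B x y * cnj (B x y)) + of_real (t\<^sup>2) * (B x y * cnj (B x y)) * B y y"
      by (simp add: add add' scale scale' yx algebra_simps power2_eq_square)
    also have "B x y * cnj (B x y) = of_real ((cmod (B x y))\<^sup>2)"
      by (rule complex_norm_square[symmetric])
    finally have "Re (B (x + ?c *\<^sub>C y) (x + ?c *\<^sub>C y)) =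
      Re (B x x) - 2 * t * (cmod (B x y))\<^sup>2 + t\<^sup>2 * (cmod (B x y))\<^sup>2 * Re (B y y)"
      by (simp del: of_real_power add: of_real_mult[symmetric] mult.assoc del: of_real_mult)
    then show ?thesis using pos by metis
  qed
  show ?thesis
  proof (cases "Re (B y y) = 0")
    case True
    let ?b = "(cmod (B x y))\<^sup>2"
    have "?b \<le> 0"
    proof (rule ccontr)
      assume b: "\<not> ?b \<le> 0"
      \<comment> \<open>When \<open>B y y\<close> vanishes the polynomial is affine in
        \<open>t\<close>; this \<open>t\<close> brings its value down to
        \<open>- Re (B x x) - 2\<close>, which is negative.\<close>
      have "0 \<le> Re (B x x) - 2 * ((Re (B x x) + 1) / ?b) * ?b"
        using key[of "(Re (B x x) + 1) / ?b"] True by simp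
      then have "0 \<le> Re (B x x) - 2 * (Re (B x x) + 1)" using b by simp
      then show False using pos[of x] by simp
    qed
    then show ?thesis using True by simp
  next
    case False
    then have p: "Re (B y y) > 0" using pos[of y] by simp
    have "0 \<le> Re (B x x) - (cmod (B x y))\<^sup>2 / Re (B y y)"
      using key[of "1 / Re (B y y)"] False by (simp add: power2_eq_square)
    then show ?thesis using p by (simp add: field_simps)
  qed
qed

lemma cinner_Cauchy_Schwarz: "cmod (cinner x y) \<le> norm x * norm (y::'h::complex_hilbert)"
proof -
  have "(cmod (cinner x y))\<^sup>2 \<le> Re (cinner x x) * Re (cinner y y)"
    by (rule positive_form_Cauchy_Schwarz)
      (simp_all add: cinner_add_left cinner_scaleC_left cinner_ge_zero cinner_commute[symmetric])
  also have "\<dots> = (norm x * norm y)\<^sup>2" by (simp add: norm_sq_cinner power_mult_distrib)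
  finally show ?thesis by (rule power2_le_imp_le) simp
qed

lemma tendsto_cinner_left:
  fixes f :: "'i \<Rightarrow> 'h::complex_hilbert"
  assumes "(f \<longlongrightarrow> a) F"
  shows "((\<lambda>i. cinner (f i) y) \<longlongrightarrow> cinner a y) F"
proof -
  have "bounded_linear (\<lambda>x. cinner x y)"
    by (rule bounded_linear_intro[of _ "norm y"])
      (simp_all add: cinner_add_left cinner_scaleR_left scaleR_conv_of_real cinner_Cauchy_Schwarz)
  from bounded_linear.tendsto[OF this assms] show ?thesis .
qed

lemma tendsto_cinner_right:
  fixes f :: "'i \<Rightarrow> 'h::complex_hilbert"
  assumes "(f \<longlongrightarrow> a) F"
  shows "((\<lambda>i. cinner y (f i)) \<longlongrightarrow> cinner y a) F"
  using tendsto_cnj[OF tendsto_cinner_left[OF assms, of y]] by (simp add: cinner_commute[symmetric])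

definition qform :: "('h::complex_hilbert \<Rightarrow>\<^sub>L 'h) \<Rightarrow> 'h \<Rightarrow> real"
  where "qform T x = Re (cinner (T x) x)"

lemma qform_add [simp]: "qform (S + T) x = qform S x + qform T x"
  and qform_diff [simp]: "qform (S - T) x = qform S x - qform T x"
  and qform_scaleR [simp]: "qform (r *\<^sub>R T) x = r * qform T x"
  and qform_zero [simp]: "qform 0 x = 0"
  by (simp_all add: qform_def blinfun.bilinear_simps cinner_add_left cinner_diff_left cinner_scaleR_left)

lemma qform_sum: "qform (\<Sum>i\<in>I. T i) x = (\<Sum>i\<in>I. qform (T i) x)"
  by (induction I rule: infinite_finite_induct) auto

lemma qform_le_norm: "qform T x \<le> norm T * (norm x)\<^sup>2"
proof -
  have "qform T x \<le> norm (T x) * norm x"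
    unfolding qform_def using cinner_Cauchy_Schwarz complex_Re_le_cmod order_trans by blast
  also have "\<dots> \<le> (norm T * norm x) * norm x"
    by (intro mult_right_mono norm_blinfun) auto
  finally show ?thesis by (simp add: power2_eq_square mult.assoc)
qed

lemma subspace_bounded_ops: "subspace bounded_ops"
  unfolding subspace_def bounded_ops_def
  by (auto simp: blinfun.bilinear_simps scaleC_add_right scaleR_eq_scaleC scaleC_scaleC mult.commute)

lemma subspace_selfadjoint_ops: "subspace (selfadjoint_ops :: ('h::complex_hilbert \<Rightarrow>\<^sub>L 'h) set)"
proof -
  have "cinner x (r *\<^sub>R y) = of_real r * cinner x y" for r and x y :: 'h
    by (simp add: scaleR_eq_scaleC cinner_scaleC_right)
  moreover have "cinner x 0 = 0" for x :: 'h
    using cinner_diff_right[of x 0 0] by simp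
  ultimately show ?thesis
    using subspace_bounded_ops unfolding subspace_def selfadjoint_ops_def
    by (auto simp: blinfun.bilinear_simps cinner_add_left cinner_add_right cinner_scaleR_left)
qed

lemma selfadjoint_ops_bounded: "T \<in> selfadjoint_ops \<Longrightarrow> T \<in> bounded_ops"
  by (simp add: selfadjoint_ops_def)

lemma cinner_selfadjoint: "T \<in> selfadjoint_ops \<Longrightarrow> cinner (T x) x = of_real (qform T x)"
proof -
  assume "T \<in> selfadjoint_ops"
  then have "cinner (T x) x = cnj (cinner (T x) x)"
    using cinner_commute[of x "T x"] by (simp add: selfadjoint_ops_def)
  then have "Im (cinner (T x) x) = 0" by (metis cnj.sel(2) equal_neg_zero)
  then show ?thesis by (simp add: qform_def complex_eq_iff)
qed

text \<open>Polarization: the form of \<open>S - T\<close> vanishes on \<open>x + y\<close>, so its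
  two cross terms cancel, and replacing \<open>y\<close> by \<open>\<i> *\<^sub>C y\<close> turns
  their sum into a difference. This is where complex scalars matter; on a real plane a rotation by a
  right angle has zero form. Self-adjointness is not assumed, which gives uniqueness within all of
  \<open>bounded_ops\<close>.\<close>

lemma bounded_ops_eqI:
  fixes S T :: "'h::complex_hilbert \<Rightarrow>\<^sub>L 'h"
  assumes "S \<in> bounded_ops" "T \<in> bounded_ops" and eq: "\<And>x. cinner (S x) x = cinner (T x) x"
  shows "S = T"
proof -
  let ?D = "S - T"
  have lin: "?D (c *\<^sub>C x) = c *\<^sub>C ?D x" for c x
    using subspace_diff[OF subspace_bounded_ops assms(1,2)] by (simp add: bounded_ops_def)
  have z: "cinner (?D x) x = 0" for x
    using eq by (simp add: blinfun.bilinear_simps cinner_diff_left)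
  have s: "cinner (?D x) y + cinner (?D y) x = 0" for x y
    using z[of "x + y"] z[of x] z[of y]
    by (simp add: blinfun.add_right cinner_add_left cinner_add_right add.commute[of "cinner (?D x) y"])
  have "cinner (?D x) y = 0" for x y
  proof -
    have "\<i> * (cinner (?D y) x - cinner (?D x) y) = 0"
      using s[of x "\<i> *\<^sub>C y"] by (simp add: lin cinner_scaleC_left cinner_scaleC_right algebra_simps)
    then show ?thesis using s[of x y] by simp
  qed
  then have "?D x = 0" for x using cinner_eq_zero_iff by blast
  then have "?D = 0" by (intro blinfun_eqI) simp
  then show ?thesis by simp
qed

lemma selfadjoint_ops_eqI:
  assumes "S \<in> selfadjoint_ops" "T \<in> selfadjoint_ops" "\<And>x. qform S x = qform T x"
  shows "S = T"
  using assms by (intro bounded_ops_eqI) (simp_all add: selfadjoint_ops_bounded cinner_selfadjoint)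

text \<open>Cauchy--Schwarz for the positive form \<open>cinner (T x) y\<close>, applied to the pair
  \<open>x\<close>, \<open>T x\<close>, after which one factor |T x|^2 cancels. Through this
  inequality convergence of quadratic forms becomes convergence in norm at each vector.\<close>

lemma norm_apply_sq_le:
  fixes T :: "'h::complex_hilbert \<Rightarrow>\<^sub>L 'h"
  assumes T: "T \<in> selfadjoint_ops" and pos: "\<And>x. 0 \<le> qform T x"
  shows "(norm (T x))\<^sup>2 \<le> norm T * qform T x"
proof (cases "T x = 0")
  case True
  then show ?thesis using pos[of x] by simp
next
  case False
  have lin: "T (c *\<^sub>C x) = c *\<^sub>C T x" and sa: "cinner (T x) y = cinner x (T y)" for c x y
    using T by (auto simp: selfadjoint_ops_def bounded_ops_def)
  have "(cmod (cinner (T x) (T x)))\<^sup>2 \<le> Re (cinner (T x) x) * Re (cinner (T (T x)) (T x))"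
  proof (rule positive_form_Cauchy_Schwarz[where B = "\<lambda>x y. cinner (T x) y"])
    show "cinner (T x) y = cnj (cinner (T y) x)" for x y
      using sa[of x y] cinner_commute[of x "T y"] by simp
    show "0 \<le> Re (cinner (T x) x)" for x using pos by (simp add: qform_def)
  qed (simp_all add: blinfun.add_right cinner_add_left lin cinner_scaleC_left)
  also have "\<dots> \<le> qform T x * (norm T * (norm (T x))\<^sup>2)"
    unfolding qform_def[symmetric] by (intro mult_left_mono qform_le_norm pos)
  finally have "((cmod (cinner (T x) (T x)))\<^sup>2) \<le> (norm T * qform T x) * (norm (T x))\<^sup>2"
    by (simp add: ac_simps)
  moreover have "(norm (T x))\<^sup>2 \<le> cmod (cinner (T x) (T x))"
    unfolding norm_sq_cinner by (rule complex_Re_le_cmod)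
  then have "((norm (T x))\<^sup>2)\<^sup>2 \<le> (cmod (cinner (T x) (T x)))\<^sup>2"
    by (intro power_mono) auto
  ultimately have "(norm (T x))\<^sup>2 * (norm (T x))\<^sup>2 \<le> (norm T * qform T x) * (norm (T x))\<^sup>2"
    by (simp add: power2_eq_square[of "(norm (T x))\<^sup>2"])
  then show ?thesis by (rule mult_right_le_imp_le) (use False in simp)
qed

text \<open>\<open>norm_apply_sq_le\<close> for \<open>S\<close>, followed by the comparison of
  forms, gives |S|^2 \<le> |S| |T|.\<close>

lemma norm_mono_selfadjoint:
  assumes S: "S \<in> selfadjoint_ops" "\<And>x. 0 \<le> qform S x" and T: "\<And>x. qform S x \<le> qform T x"
  shows "norm S \<le> norm T"
proof (cases "norm S = 0")
  case False
  have "norm (S x) \<le> sqrt (norm S * norm T) * norm x" for x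
  proof -
    have "(norm (S x))\<^sup>2 \<le> norm S * qform S x" by (rule norm_apply_sq_le[OF S])
    also have "\<dots> \<le> norm S * (norm T * (norm x)\<^sup>2)"
      using T[of x] qform_le_norm[of T x] by (intro mult_left_mono) auto
    also have "\<dots> = (sqrt (norm S * norm T) * norm x)\<^sup>2" by (simp add: power_mult_distrib)
    finally show ?thesis by (rule power2_le_imp_le) simp
  qed
  then have "norm S \<le> sqrt (norm S * norm T)" by (intro norm_blinfun_bound) auto
  then have "(norm S)\<^sup>2 \<le> norm S * norm T"
    by (metis norm_ge_zero mult_nonneg_nonneg power_mono real_sqrt_pow2)
  then show ?thesis using False by (simp add: power2_eq_square)
qed simp

section \<open>Monotone limits in the strong operator topology\<close>

text \<open>Stated for filters, since limits along directed sets of operators occur. The strong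
  topology is pulled back from the product topology on functions, so pointwise convergence would
  eventually force \<open>f i\<close> into the open complement of \<open>M\<close>.\<close>

lemma closedin_SOT_limit:
  fixes S :: "'h::complex_hilbert \<Rightarrow>\<^sub>L 'h"
  assumes M: "closedin SOT M" and F: "F \<noteq> bot" and ev: "eventually (\<lambda>i. f i \<in> M) F"
    and lim: "\<And>x. ((\<lambda>i. f i x) \<longlongrightarrow> S x) F" and S: "S \<in> bounded_ops"
  shows "S \<in> M"
proof (rule ccontr)
  assume "S \<notin> M"
  obtain C where C: "closedin strong_operator_topology C" "M = C \<inter> bounded_ops"
    using M unfolding SOT_def closedin_subtopology by blast
  then have "openin strong_operator_topology (- C)"
    by (auto simp: closedin_def strong_operator_topology_topspace Compl_eq_Diff_UNIV)
  then obtain U :: "('h \<Rightarrow> 'h) set" where U: "open U" "- C = blinfun_apply -` U"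
    unfolding strong_operator_topology_def openin_pullback_topology by auto
  have "blinfun_apply S \<in> U" using \<open>S \<notin> M\<close> C(2) S U(2) by auto
  moreover have "((\<lambda>i. blinfun_apply (f i)) \<longlongrightarrow> blinfun_apply S) F"
    using lim unfolding limitin_canonical_iff[symmetric] euclidean_product_topology[symmetric]
    by (simp add: limitin_componentwise)
  ultimately have "eventually (\<lambda>i. blinfun_apply (f i) \<in> U) F"
    using U(1) by (auto dest: topological_tendstoD)
  with ev have "eventually (\<lambda>i. False) F"
    by eventually_elim (use C(2) U(2) in auto)
  then show False using F by (simp add: eventually_False)
qed

definition op_le :: "('h::complex_hilbert \<Rightarrow>\<^sub>L 'h) \<Rightarrow> ('h \<Rightarrow>\<^sub>L 'h) \<Rightarrow> bool"
  where "op_le S T \<longleftrightarrow> (\<forall>x. qform S x \<le> qform T x)"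

lemma op_leD: "op_le S T \<Longrightarrow> qform S x \<le> qform T x"
  by (simp add: op_le_def)

lemma op_le_refl [simp]: "op_le S S" by (simp add: op_le_def)

lemma op_le_trans: "op_le S T \<Longrightarrow> op_le T U \<Longrightarrow> op_le S U"
  unfolding op_le_def by (meson order_trans)

text \<open>Vigier's theorem. For \<open>T \<ge> S\<close> far out in \<open>D\<close> one has
  $\|(T - S)x\|^2 \le \|T - S\| \langle (T - S)x, x\rangle$, so that \<open>T x\<close> is a Cauchy net.\<close>

theorem directed_strong_limit:
  fixes D :: "('h::complex_hilbert \<Rightarrow>\<^sub>L 'h) set"
  assumes D: "D \<subseteq> selfadjoint_ops" "D \<noteq> {}"
    and dir: "\<And>S T. S \<in> D \<Longrightarrow> T \<in> D \<Longrightarrow> \<exists>U\<in>D. op_le S U \<and> op_le T U"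
    and bound: "B \<in> selfadjoint_ops" "\<And>S. S \<in> D \<Longrightarrow> op_le S B"
  obtains T where "T \<in> selfadjoint_ops" "\<And>S. S \<in> D \<Longrightarrow> op_le S T"
    "\<And>x c. (\<And>S. S \<in> D \<Longrightarrow> qform S x \<le> c) \<Longrightarrow> qform T x \<le> c"
    "\<And>M. closedin SOT M \<Longrightarrow> D \<subseteq> M \<Longrightarrow> T \<in> M"
proof -
  obtain S0 where S0: "S0 \<in> D" using D(2) by auto
  \<comment> \<open>\<open>D\<close> serves as a net indexed by itself: \<open>F\<close> is the
    filter generated by its tails, and directedness makes the tails a filter base.\<close>
  define F where "F = (INF S\<in>D. principal {T \<in> D. op_le S T})"
  have ev: "eventually P F \<longleftrightarrow> (\<exists>S\<in>D. \<forall>T\<in>D. op_le S T \<longrightarrow> P T)" for P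
  proof -
    have "\<exists>x\<in>D. principal {T \<in> D. op_le x T} \<le> inf (principal {T \<in> D. op_le a T}) (principal {T \<in> D. op_le b T})"
      if "a \<in> D" "b \<in> D" for a b
      using dir[OF that] by (auto intro: op_le_trans)
    then have "eventually P F \<longleftrightarrow> (\<exists>S\<in>D. eventually P (principal {T \<in> D. op_le S T}))"
      unfolding F_def using D(2) by (intro eventually_INF_base) auto
    then show ?thesis by (auto simp: eventually_principal)
  qed
  have F: "F \<noteq> bot"
    unfolding eventually_False[symmetric] ev by (metis op_le_refl)
  \<comment> \<open>For \<open>S0 \<le> S \<le> T\<close> in \<open>D\<close> the difference
    \<open>T - S\<close> lies between 0 and \<open>B - S0\<close>, so this one constant bounds all
    the norms |T - S|.\<close>
  define c where "c = norm (B - S0)"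
  have ndiff: "(norm ((T - S) x))\<^sup>2 \<le> c * (qform T x - qform S x)" and ndiff0: "norm (T - S) \<le> c"
    if ST: "S \<in> D" "T \<in> D" "op_le S0 S" "op_le S T" for S T x
  proof -
    have sa: "T - S \<in> selfadjoint_ops"
      using ST D(1) by (intro subspace_diff[OF subspace_selfadjoint_ops]) auto
    have pos: "0 \<le> qform (T - S) x" for x using ST(4) by (simp add: op_leD)
    have le: "qform (T - S) x \<le> qform (B - S0) x" for x
      using op_leD[OF bound(2)[OF ST(2)], of x] op_leD[OF ST(3), of x] by simp
    show "norm (T - S) \<le> c" unfolding c_def by (rule norm_mono_selfadjoint[OF sa pos le])
    then show "(norm ((T - S) x))\<^sup>2 \<le> c * (qform T x - qform S x)"
      using order_trans[OF norm_apply_sq_le[OF sa pos] mult_right_mono[OF _ pos[of x]]] by simp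
  qed
  have "\<exists>l. ((\<lambda>T. blinfun_apply T x) \<longlongrightarrow> l) F" for x
  proof -
    let ?s = "SUP S\<in>D. qform S x"
    have bdd: "bdd_above ((\<lambda>S. qform S x) ` D)"
      using bound(2) by (auto simp: op_le_def bdd_above_def)
    have "cauchy_filter (filtermap (\<lambda>T. blinfun_apply T x) F)"
      unfolding cauchy_filter_metric_filtermap
    proof (intro allI impI)
      fix e :: real assume e: "0 < e"
      \<comment> \<open>Chosen so that \<open>c * d\<close> is less than
        \<open>(e/2)\<^sup>2\<close>; the summand 1 covers \<open>c = 0\<close>. The index
        \<open>S1\<close> is taken within \<open>d\<close> of the supremum of the forms at
        \<open>x\<close>.\<close>
      define d where "d = (e/2)\<^sup>2 / (c + 1)"
      have cpos: "c \<ge> 0" by (simp add: c_def)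
      have d: "d > 0" using e cpos by (simp add: d_def)
      then obtain S1 where S1: "S1 \<in> D" "?s - d < qform S1 x"
        using less_cSUP_iff[OF D(2) bdd, of "?s - d"] by auto
      obtain S where S: "S \<in> D" "op_le S0 S" "op_le S1 S" using dir[OF S0 S1(1)] by auto
      have close: "dist (T x) (S x) < e / 2" if T: "T \<in> D" "op_le S T" for T
      proof -
        have "qform T x \<le> ?s" using bdd T(1) by (intro cSUP_upper) auto
        then have dd: "qform T x - qform S x < d" using S1(2) op_leD[OF S(3), of x] by simp
        have "(norm (T x - S x))\<^sup>2 \<le> c * (qform T x - qform S x)"
          using ndiff[OF S(1) T(1) S(2) T(2), of x] by (simp add: blinfun.diff_left)
        also have "\<dots> \<le> c * d" using dd cpos by (intro mult_left_mono) auto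
        also have "\<dots> < (c + 1) * d" using d by (simp add: algebra_simps)
        also have "\<dots> = (e/2)\<^sup>2" using cpos by (simp add: d_def)
        finally show ?thesis
          unfolding dist_norm by (rule power2_less_imp_less) (use e in simp)
      qed
      have "dist (T x) (U x) < e" if "T \<in> D \<and> op_le S T" "U \<in> D \<and> op_le S U" for T U
        using close[of T] close[of U] that dist_triangle2[of "T x" "U x" "S x"] by auto
      moreover have "eventually (\<lambda>T. T \<in> D \<and> op_le S T) F" unfolding ev using S(1) by auto
      ultimately show "\<exists>P. eventually P F \<and> (\<forall>T U. P T \<and> P U \<longrightarrow> dist (T x) (U x) < e)" by blast
    qed
    then have "\<exists>l. filtermap (\<lambda>T. blinfun_apply T x) F \<le> nhds l"
      using complete_UNIV[where 'a='h] F
      by (auto simp: complete_uniform filtermap_bot_iff)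
    then show ?thesis by (simp add: filterlim_def)
  qed
  then obtain l where l: "\<And>x. ((\<lambda>T. blinfun_apply T x) \<longlongrightarrow> l x) F" by metis
  have evD: "eventually (\<lambda>T. T \<in> D \<and> op_le S T) F" if "S \<in> D" for S
    unfolding ev using that by auto
  define C where "C = c + norm S0"
  have "bounded_linear l"
  proof (rule bounded_linear_intro[of _ C])
    fix x y and r :: real
    show "l (x + y) = l x + l y"
      using tendsto_add[OF l[of x] l[of y]] l[of "x + y"]
      by (intro tendsto_unique[OF F]) (simp_all add: blinfun.add_right)
    show "l (r *\<^sub>R x) = r *\<^sub>R l x"
      using tendsto_scaleR[OF tendsto_const l[of x], of r] l[of "r *\<^sub>R x"]
      by (intro tendsto_unique[OF F]) (simp_all add: blinfun.scaleR_right)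
    have "eventually (\<lambda>T. norm (blinfun_apply T x) \<le> norm x * C) F"
      using evD[OF S0]
    proof eventually_elim
      case (elim T)
      have "norm T \<le> norm (T - S0) + norm S0" using norm_triangle_ineq[of "T - S0" S0] by simp
      also have "\<dots> \<le> C" using ndiff0[OF S0 _ op_le_refl, of T] elim by (simp add: C_def)
      finally show ?case
        using order_trans[OF norm_blinfun[of T x] mult_right_mono[OF _ norm_ge_zero]] by (simp add: mult.commute)
    qed
    then show "norm (l x) \<le> norm x * C" by (intro tendsto_upperbound[OF tendsto_norm[OF l] _ F])
  qed
  then have app: "blinfun_apply (Blinfun l) = l" by (rule bounded_linear_Blinfun_apply)
  define T where "T = Blinfun l"
  have lim: "((\<lambda>S. blinfun_apply S x) \<longlongrightarrow> T x) F" for x using l by (simp add: T_def app)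
  have evsa: "eventually (\<lambda>S. S \<in> selfadjoint_ops) F" using evD[OF S0] D(1) by (auto elim!: eventually_mono)
  have Tb: "T \<in> bounded_ops"
    unfolding bounded_ops_def
  proof safe
    fix a x
    have "((\<lambda>S. blinfun_apply S (a *\<^sub>C x)) \<longlongrightarrow> a *\<^sub>C T x) F"
    proof (rule Lim_transform_eventually)
      show "((\<lambda>S. a *\<^sub>C blinfun_apply S x) \<longlongrightarrow> a *\<^sub>C T x) F"
        by (rule bounded_linear.tendsto[OF bounded_linear_scaleC lim])
      show "eventually (\<lambda>S. a *\<^sub>C blinfun_apply S x = blinfun_apply S (a *\<^sub>C x)) F"
        using evsa by eventually_elim (simp add: selfadjoint_ops_def bounded_ops_def)
    qed
    then show "T (a *\<^sub>C x) = a *\<^sub>C T x" by (rule tendsto_unique[OF F lim])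
  qed
  have Tsa: "T \<in> selfadjoint_ops"
    unfolding selfadjoint_ops_def
  proof (safe intro!: Tb)
    fix x y
    have "((\<lambda>S. cinner (blinfun_apply S x) y) \<longlongrightarrow> cinner x (T y)) F"
    proof (rule Lim_transform_eventually)
      show "((\<lambda>S. cinner x (blinfun_apply S y)) \<longlongrightarrow> cinner x (T y)) F"
        by (rule tendsto_cinner_right[OF lim])
      show "eventually (\<lambda>S. cinner x (blinfun_apply S y) = cinner (blinfun_apply S x) y) F"
        using evsa by eventually_elim (simp add: selfadjoint_ops_def)
    qed
    then show "cinner (T x) y = cinner x (T y)"
      by (rule tendsto_unique[OF F tendsto_cinner_left[OF lim]])
  qed
  have qlim: "((\<lambda>S. qform S x) \<longlongrightarrow> qform T x) F" for x
    unfolding qform_def by (intro tendsto_Re tendsto_cinner_left lim)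
  show ?thesis
  proof
    show "T \<in> selfadjoint_ops" by fact
    show "op_le S T" if "S \<in> D" for S
      unfolding op_le_def
    proof
      fix x
      have "eventually (\<lambda>U. qform S x \<le> qform U x) F"
        using evD[OF that] by (auto elim!: eventually_mono simp: op_leD)
      then show "qform S x \<le> qform T x" by (rule tendsto_lowerbound[OF qlim _ F])
    qed
    show "qform T x \<le> a" if "\<And>S. S \<in> D \<Longrightarrow> qform S x \<le> a" for x a
    proof -
      have "eventually (\<lambda>U. qform U x \<le> a) F"
        using evD[OF S0] that by (auto elim!: eventually_mono)
      then show ?thesis by (rule tendsto_upperbound[OF qlim _ F])
    qed
    show "T \<in> M" if "closedin SOT M" "D \<subseteq> M" for M
      using evD[OF S0] that(2)
      by (intro closedin_SOT_limit[OF that(1) F _ lim Tb]) (auto elim!: eventually_mono)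
  qed
qed

section \<open>Suprema in extended spaces\<close>

lemma is_sup_iff: "is_sup F A s \<longleftrightarrow> s \<in> carrier F \<and> (\<forall>a\<in>A \<inter> carrier F. le F a s) \<and>
    (\<forall>u\<in>carrier F. (\<forall>a\<in>A \<inter> carrier F. le F a u) \<longrightarrow> le F s u)"
  unfolding is_sup_def least_def Upper_def by auto

lemma is_inf_iff: "is_inf F A s \<longleftrightarrow> s \<in> carrier F \<and> (\<forall>a\<in>A \<inter> carrier F. le F s a) \<and>
    (\<forall>u\<in>carrier F. (\<forall>a\<in>A \<inter> carrier F. le F u a) \<longrightarrow> le F u s)"
  unfolding is_inf_def greatest_def Lower_def by auto

lemma extended_simps [simp]:
  "carrier (extended F) = insert Infty (Fin ` carrier F)" "le (extended F) = le_extd (le F)"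
  by (simp_all add: extended_def)

lemma le_extd_Infty [simp]: "le_extd R a Infty" by (cases a) auto

lemma is_sup_Fin:
  assumes "A \<subseteq> carrier F"
  shows "is_sup (extended F) (Fin ` A) (Fin s) \<longleftrightarrow> is_sup F A s"
    and "is_sup (extended F) (Fin ` A) Infty \<longleftrightarrow> \<not> (\<exists>u\<in>carrier F. \<forall>a\<in>A. le F a u)"
proof -
  have "Fin ` A \<inter> carrier (extended F) = Fin ` A" "A \<inter> carrier F = A" using assms by auto
  then show "is_sup (extended F) (Fin ` A) (Fin s) \<longleftrightarrow> is_sup F A s"
    and "is_sup (extended F) (Fin ` A) Infty \<longleftrightarrow> \<not> (\<exists>u\<in>carrier F. \<forall>a\<in>A. le F a u)"
    unfolding is_sup_iff by auto
qed

text \<open>In the extended space the infimum of the empty set is \<open>Infty\<close>, hence the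
  condition \<open>A \<noteq> {}\<close>.\<close>

lemma is_inf_Fin:
  assumes "A \<subseteq> carrier F" "A \<noteq> {}"
  shows "is_inf (extended F) (Fin ` A) (Fin s) \<longleftrightarrow> is_inf F A s"
proof -
  have "Fin ` A \<inter> carrier (extended F) = Fin ` A" "A \<inter> carrier F = A" using assms by auto
  then show ?thesis using assms(2) unfolding is_inf_iff by auto
qed

lemma is_sup_unique:
  assumes "is_sup F A s" "is_sup F A t"
    and "\<And>x y. x \<in> carrier F \<Longrightarrow> y \<in> carrier F \<Longrightarrow> le F x y \<Longrightarrow> le F y x \<Longrightarrow> x = y"
  shows "s = t"
  using assms unfolding is_sup_iff by blast

lemma is_inf_unique:
  assumes "is_inf F A s" "is_inf F A t"
    and "\<And>x y. x \<in> carrier F \<Longrightarrow> y \<in> carrier F \<Longrightarrow> le F x y \<Longrightarrow> le F y x \<Longrightarrow> x = y"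
  shows "s = t"
  using assms unfolding is_inf_iff by blast

lemma carrier_sa_space [simp]: "carrier (sa_space L) = L \<inter> selfadjoint_ops"
  and le_sa_space [simp]: "le (sa_space L) = op_le"
  by (auto simp: sa_space_def op_nonneg_def op_le_def qform_def[symmetric] fun_eq_iff)

lemma pos_cone_sa_space: "pos_cone (sa_space L) = {T \<in> L \<inter> selfadjoint_ops. \<forall>x. 0 \<le> qform T x}"
  by (auto simp: pos_cone_def op_le_def)

lemma op_le_antisym: "S \<in> selfadjoint_ops \<Longrightarrow> T \<in> selfadjoint_ops \<Longrightarrow> op_le S T \<Longrightarrow> op_le T S \<Longrightarrow> S = T"
  by (rule selfadjoint_ops_eqI) (auto simp: op_le_def intro: antisym)

lemma is_sup_sa_unique: "is_sup (sa_space L) A s \<Longrightarrow> is_sup (sa_space L) A t \<Longrightarrow> s = t"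
  by (rule is_sup_unique) (auto intro: op_le_antisym)

lemma extended_sa_antisym:
  assumes "x \<in> carrier (extended (sa_space L))" "y \<in> carrier (extended (sa_space L))"
    "le (extended (sa_space L)) x y" "le (extended (sa_space L)) y x"
  shows "x = y"
  using assms by (cases x; cases y) (auto intro: op_le_antisym)

lemma sum_Fin: "(\<Sum>i\<in>I. Fin (f i)) = Fin (\<Sum>i\<in>I. f i)"
  by (induction I rule: infinite_finite_induct) (auto simp: zero_extd_def)

text \<open>Subspaces are taken over the reals because the same notion serves for \<open>L\<close>
  and for the test subspaces from which both kinds of closed span are formed; a complex subspace is
  in particular a real one.\<close>

definition sot_subspace :: "('h::complex_hilbert \<Rightarrow>\<^sub>L 'h) set \<Rightarrow> bool"
  where "sot_subspace M \<longleftrightarrow> real_subspace M \<and> closedin SOT M"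

lemma sot_subspaceD:
  assumes "sot_subspace M" shows "closedin SOT M" "subspace M" "M \<subseteq> bounded_ops"
  using assms by (auto simp: sot_subspace_def real_subspace_def)

text \<open>The strong limit is the supremum, as order is tested on forms. The last conclusion,
  membership in every strongly closed set containing \<open>D\<close>, is what later compares the
  spans.\<close>

lemma sot_directed_sup:
  fixes D :: "('h::complex_hilbert \<Rightarrow>\<^sub>L 'h) set"
  assumes L: "sot_subspace L" and D: "D \<subseteq> L \<inter> selfadjoint_ops" "D \<noteq> {}"
    and dir: "\<And>S T. S \<in> D \<Longrightarrow> T \<in> D \<Longrightarrow> \<exists>U\<in>D. op_le S U \<and> op_le T U"
    and bound: "B \<in> selfadjoint_ops" "\<And>S. S \<in> D \<Longrightarrow> op_le S B"
  obtains T where "is_sup (sa_space L) D T"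
    "\<forall>x c. (\<forall>S\<in>D. qform S x \<le> c) \<longrightarrow> qform T x \<le> c"
    "\<forall>M. closedin SOT M \<longrightarrow> D \<subseteq> M \<longrightarrow> T \<in> M"
proof -
  have "D \<subseteq> selfadjoint_ops" using D by auto
  from directed_strong_limit[OF this D(2) dir bound] obtain T where T: "T \<in> selfadjoint_ops" "\<And>S. S \<in> D \<Longrightarrow> op_le S T"
    "\<And>x c. (\<And>S. S \<in> D \<Longrightarrow> qform S x \<le> c) \<Longrightarrow> qform T x \<le> c"
    "\<And>M. closedin SOT M \<Longrightarrow> D \<subseteq> M \<Longrightarrow> T \<in> M" by metis
  have "T \<in> L" using T(4)[OF sot_subspaceD(1)[OF L]] D by auto
  moreover have "op_le T u" if "\<forall>a\<in>D \<inter> (L \<inter> selfadjoint_ops). op_le a u" for u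
    unfolding op_le_def using that D by (intro allI T(3)) (auto simp: op_le_def)
  ultimately have "is_sup (sa_space L) D T"
    unfolding is_sup_iff using T(1,2) by simp
  then show ?thesis using that T(3,4) by blast
qed

lemma sot_incseq_sup:
  fixes S :: "nat \<Rightarrow> 'h::complex_hilbert \<Rightarrow>\<^sub>L 'h"
  assumes L: "sot_subspace L" and S: "\<And>n. S n \<in> L \<inter> selfadjoint_ops" "\<And>x. incseq (\<lambda>n. qform (S n) x)"
    and bound: "B \<in> selfadjoint_ops" "\<And>n. op_le (S n) B"
  obtains T where "is_sup (sa_space L) (range S) T" "\<forall>x. (\<lambda>n. qform (S n) x) \<longlonglongrightarrow> qform T x"
    "\<forall>M. closedin SOT M \<longrightarrow> range S \<subseteq> M \<longrightarrow> T \<in> M"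
proof -
  have mono: "op_le (S m) (S n)" if "m \<le> n" for m n
    using S(2) that by (auto simp: op_le_def incseq_def)
  obtain T where T: "is_sup (sa_space L) (range S) T"
    "\<forall>x c. (\<forall>U\<in>range S. qform U x \<le> c) \<longrightarrow> qform T x \<le> c"
    "\<forall>M. closedin SOT M \<longrightarrow> range S \<subseteq> M \<longrightarrow> T \<in> M"
  proof (rule sot_directed_sup[OF L _ _ _ bound(1)])
    fix U V assume "U \<in> range S" "V \<in> range S"
    then obtain m n where "U = S m" "V = S n" by auto
    then show "\<exists>W\<in>range S. op_le U W \<and> op_le V W"
      by (intro bexI[of _ "S (max m n)"]) (auto intro: mono)
  qed (use S bound in auto)
  have "(\<lambda>n. qform (S n) x) \<longlonglongrightarrow> qform T x" for x
  proof -
    have up: "qform (S n) x \<le> qform T x" for n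
      using T(1) S(1)[of n] unfolding is_sup_iff by (auto simp: op_le_def)
    then have bdd: "bdd_above (range (\<lambda>n. qform (S n) x))" by (auto simp: bdd_above_def)
    have "qform T x = (SUP n. qform (S n) x)"
      using up bdd by (intro antisym T(2)[rule_format] cSUP_least) (auto intro: cSUP_upper)
    then show ?thesis using LIMSEQ_incseq_SUP[OF bdd S(2)] by simp
  qed
  with T show ?thesis using that by blast
qed

text \<open>The dictionary between the order of the operator space and scalar analysis: countable
  additivity and suprema of elementary integrals become convergence of real sequences, one for each
  vector. From left to right, the supremum must be the strong limit, since suprema are
  unique.\<close>

lemma sot_incseq_sup_iff:
  assumes L: "sot_subspace L" and S: "\<And>n. S n \<in> L \<inter> selfadjoint_ops" "\<And>x. incseq (\<lambda>n. qform (S n) x)"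
  shows "is_sup (sa_space L) (range S) T \<longleftrightarrow>
    T \<in> L \<inter> selfadjoint_ops \<and> (\<forall>x. (\<lambda>n. qform (S n) x) \<longlonglongrightarrow> qform T x)"
proof
  assume T: "is_sup (sa_space L) (range S) T"
  then have B: "T \<in> L \<inter> selfadjoint_ops" "\<And>n. op_le (S n) T"
    using S(1) unfolding is_sup_iff by auto
  have Tsa: "T \<in> selfadjoint_ops" using B(1) by simp
  obtain T' where "is_sup (sa_space L) (range S) T'" "\<forall>x. (\<lambda>n. qform (S n) x) \<longlonglongrightarrow> qform T' x"
      "\<forall>M. closedin SOT M \<longrightarrow> range S \<subseteq> M \<longrightarrow> T' \<in> M"
    by (rule sot_incseq_sup[OF L S Tsa B(2)])
  then show "T \<in> L \<inter> selfadjoint_ops \<and> (\<forall>x. (\<lambda>n. qform (S n) x) \<longlonglongrightarrow> qform T x)"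
    using B is_sup_sa_unique[OF T] by blast
next
  assume T: "T \<in> L \<inter> selfadjoint_ops \<and> (\<forall>x. (\<lambda>n. qform (S n) x) \<longlonglongrightarrow> qform T x)"
  then have "qform (S n) x \<le> qform T x" for n x
    using S(2) incseq_le by blast
  moreover have "qform T x \<le> qform u x" if "\<And>n. op_le (S n) u" for u x
    using T that by (intro LIMSEQ_le_const2[of "\<lambda>n. qform (S n) x"]) (auto simp: op_le_def)
  ultimately show "is_sup (sa_space L) (range S) T"
    using T S(1) unfolding is_sup_iff by (auto simp: op_le_def)
qed

section \<open>The order integral for a finite operator-valued measure\<close>

text \<open>Restricted to finite measures. The instances are the constructed measure and, for
  uniqueness, the restrictions of a competing measure to compact sets.\<close>

locale operator_measure =
  fixes L :: "('h::complex_hilbert \<Rightarrow>\<^sub>L 'h) set" and M :: "'x measure"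
    and \<mu> :: "'x set \<Rightarrow> ('h \<Rightarrow>\<^sub>L 'h) extd"
  assumes L: "sot_subspace L" and \<mu>: "finite_positive_measure (sa_space L) M \<mu>"
begin

abbreviation "F \<equiv> sa_space L"
abbreviation "Lsa \<equiv> L \<inter> selfadjoint_ops"

definition m :: "'x set \<Rightarrow> 'h \<Rightarrow>\<^sub>L 'h"
  where "m D = the_fin (\<mu> D)"

definition N :: "'h \<Rightarrow> 'x measure"
  where "N x = lebesgue_of M (scalar_measure \<mu> x)"

lemma subspace_Lsa: "subspace Lsa"
  by (rule subspace_inter[OF sot_subspaceD(2)[OF L] subspace_selfadjoint_ops])

lemma \<mu>_sup:
  fixes D :: "nat \<Rightarrow> 'x set"
  assumes "range D \<subseteq> sets M" "disjoint_family D"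
  shows "is_sup (extended F) (range (\<lambda>N. \<Sum>n\<le>N. \<mu> (D n))) (\<mu> (\<Union>n. D n))"
  using \<mu> assms unfolding finite_positive_measure_def positive_measure_def by blast

lemma \<mu>_cone: "D \<in> sets M \<Longrightarrow> \<mu> D \<in> ext_pos_cone F"
  using \<mu> unfolding finite_positive_measure_def positive_measure_def by blast

lemma \<mu>_empty: "\<mu> {} = Fin 0"
  using \<mu> unfolding finite_positive_measure_def positive_measure_def by (simp add: zero_extd_def)

lemma \<mu>_fin_pos:
  assumes D: "D \<in> sets M"
  shows "\<exists>T\<in>pos_cone F. \<mu> D = Fin T"
proof -
  \<comment> \<open>\<open>D\<close> comes first, so that already the partial sum with
    \<open>N = 0\<close> is \<open>\<mu> D\<close>; it lies below the supremum
    \<open>\<mu> (space M)\<close>, which is finite.\<close>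
  let ?E = "\<lambda>n::nat. if n = 0 then D else if n = 1 then space M - D else {}"
  have "is_sup (extended F) (range (\<lambda>N. \<Sum>n\<le>N. \<mu> (?E n))) (\<mu> (\<Union>n. ?E n))"
    using D by (intro \<mu>_sup) (auto simp: disjoint_family_on_def)
  moreover have "(\<Union>n. ?E n) = space M"
  proof (intro equalityI subsetI)
    fix t assume "t \<in> space M"
    then show "t \<in> (\<Union>n. ?E n)"
      by (cases "t \<in> D") (auto intro: UN_I[of 0] UN_I[of 1])
  qed (use sets.sets_into_space[OF D] in \<open>auto split: if_splits\<close>)
  ultimately have s: "is_sup (extended F) (range (\<lambda>N. \<Sum>n\<le>N. \<mu> (?E n))) (\<mu> (space M))" by simp
  have "\<mu> D \<in> range (\<lambda>N. \<Sum>n\<le>N. \<mu> (?E n))" by (rule range_eqI[of _ _ 0]) simp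
  moreover have "\<mu> D \<in> carrier (extended F)"
    using \<mu>_cone[OF D] by (auto simp: ext_pos_cone_def pos_cone_sa_space)
  ultimately have "le_extd op_le (\<mu> D) (\<mu> (space M))"
    using s unfolding is_sup_iff by auto
  moreover have "\<mu> (space M) \<in> Fin ` pos_cone F"
    using \<mu> by (simp add: finite_positive_measure_def)
  ultimately have "\<mu> D \<noteq> Infty" by auto
  then show ?thesis using \<mu>_cone[OF D] by (auto simp: ext_pos_cone_def)
qed

lemma \<mu>_eq: "D \<in> sets M \<Longrightarrow> \<mu> D = Fin (m D)"
  and m_Lsa: "D \<in> sets M \<Longrightarrow> m D \<in> Lsa"
  and m_nonneg: "D \<in> sets M \<Longrightarrow> 0 \<le> qform (m D) x"
  using \<mu>_fin_pos[of D] by (auto simp: m_def pos_cone_sa_space)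

lemma m_empty [simp]: "m {} = 0"
  by (simp add: m_def \<mu>_empty)

lemma m_sums:
  fixes D :: "nat \<Rightarrow> 'x set"
  assumes D: "range D \<subseteq> sets M" "disjoint_family D"
  shows "(\<lambda>n. qform (m (D n)) x) sums qform (m (\<Union>n. D n)) x"
proof -
  let ?S = "\<lambda>k. \<Sum>n\<le>k. m (D n)"
  have Ds: "D n \<in> sets M" for n using D(1) by auto
  have "\<mu> (D n) = Fin (m (D n))" for n by (rule \<mu>_eq[OF Ds])
  then have eq: "(\<lambda>N. \<Sum>n\<le>N. \<mu> (D n)) = (\<lambda>N. Fin (?S N))" by (simp add: sum_Fin)
  have r: "range (\<lambda>N. \<Sum>n\<le>N. \<mu> (D n)) = Fin ` range ?S"
    unfolding image_image by (rule arg_cong[where f = range, OF eq])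
  have SL: "?S k \<in> Lsa" for k by (intro subspace_sum[OF subspace_Lsa] m_Lsa Ds)
  have "is_sup F (range ?S) (m (\<Union>n. D n))"
    using \<mu>_sup[OF D] SL \<mu>_eq[of "\<Union>n. D n"] Ds unfolding r
    by (subst is_sup_Fin(1)[symmetric]) auto
  then have "(\<lambda>k. qform (?S k) x) \<longlonglongrightarrow> qform (m (\<Union>n. D n)) x"
    using sot_incseq_sup_iff[OF L, of ?S] SL m_nonneg[OF Ds]
    by (auto simp: incseq_Suc_iff)
  then show ?thesis by (simp add: qform_sum sums_def_le)
qed

lemma sets_N [simp]: "sets (N x) = sets M" and space_N [simp]: "space (N x) = space M"
  using sets.space_closed[of M] by (auto simp: N_def lebesgue_of_def)

lemma scalar_measure_eq: "scalar_measure \<mu> x D = qform (m D) x"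
  by (simp add: scalar_measure_def qform_def m_def)

lemma emeasure_N:
  assumes D: "D \<in> sets M"
  shows "emeasure (N x) D = ennreal (qform (m D) x)"
proof -
  have "emeasure (N x) D = ennreal (scalar_measure \<mu> x D)"
  proof (rule emeasure_measure_of[OF N_def[unfolded lebesgue_of_def]])
    show "sets M \<subseteq> Pow (space M)" by (rule sets.space_closed)
    show "positive (sets (N x)) (\<lambda>D. ennreal (scalar_measure \<mu> x D))"
      by (simp add: positive_def scalar_measure_eq)
    show "countably_additive (sets (N x)) (\<lambda>D. ennreal (scalar_measure \<mu> x D))"
      unfolding countably_additive_def
    proof safe
      fix D :: "nat \<Rightarrow> 'x set" assume D: "range D \<subseteq> sets (N x)" "disjoint_family D"
      then have "D n \<in> sets M" for n by auto
      then show "(\<Sum>i. ennreal (scalar_measure \<mu> x (D i))) = ennreal (scalar_measure \<mu> x (\<Union>i. D i))"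
        using m_sums[of D x] D by (intro suminf_ennreal_eq) (auto simp: scalar_measure_eq m_nonneg)
    qed
  qed (use D in simp)
  then show ?thesis by (simp add: scalar_measure_eq)
qed

lemma finite_measure_N: "finite_measure (N x)"
  by standard (simp add: emeasure_N)

lemma measure_N: "D \<in> sets M \<Longrightarrow> measure (N x) D = qform (m D) x"
  by (simp add: measure_def emeasure_N m_nonneg)

lemma m_mono:
  assumes "D \<in> sets M" "E \<in> sets M" "D \<subseteq> E"
  shows "op_le (m D) (m E)"
proof -
  have "qform (m D) x \<le> qform (m E) x" for x
    using finite_measure.finite_measure_mono[OF finite_measure_N, of D E x] assms by (simp add: measure_N)
  then show ?thesis by (simp add: op_le_def)
qed

section \<open>Elementary integrals and their suprema\<close>

definition E :: "('x \<Rightarrow> real) \<Rightarrow> 'h \<Rightarrow>\<^sub>L 'h"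
  where "E \<phi> = (\<Sum>r\<in>\<phi> ` space M. r *\<^sub>R m (\<phi> -` {r} \<inter> space M))"

lemma elementary_integral_eq:
  assumes "elementary M \<phi>"
  shows "elementary_integral M \<mu> \<phi> = Fin (E \<phi>)"
proof -
  have "scale_extd r (\<mu> (\<phi> -` {r} \<inter> space M)) = Fin (r *\<^sub>R m (\<phi> -` {r} \<inter> space M))" for r
    using assms by (simp add: \<mu>_eq elementary_def simple_functionD)
  then show ?thesis by (simp add: elementary_integral_def E_def sum_Fin)
qed

lemma E_in:
  assumes "elementary M \<phi>" "subspace P" "\<And>D. D \<in> sets M \<Longrightarrow> m D \<in> P"
  shows "E \<phi> \<in> P"
  using assms unfolding E_def
  by (intro subspace_sum subspace_scale) (auto simp: elementary_def simple_functionD)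

lemma qform_E:
  assumes \<phi>: "elementary M \<phi>"
  shows "0 \<le> qform (E \<phi>) x" "ennreal (qform (E \<phi>) x) = (\<integral>\<^sup>+t. ennreal (\<phi> t) \<partial>N x)"
proof -
  let ?D = "\<lambda>r. \<phi> -` {r} \<inter> space M"
  have fin: "finite (\<phi> ` space M)" and Ds: "?D r \<in> sets M" and nn: "r \<in> \<phi> ` space M \<Longrightarrow> 0 \<le> r" for r
    using \<phi> by (auto simp: elementary_def simple_functionD)
  have q: "qform (E \<phi>) x = (\<Sum>r\<in>\<phi> ` space M. r * qform (m (?D r)) x)"
    by (simp add: E_def qform_sum)
  have nn': "0 \<le> r * qform (m (?D r)) x" if "r \<in> \<phi> ` space M" for r
    using nn[OF that] m_nonneg[OF Ds] by simp
  show "0 \<le> qform (E \<phi>) x" unfolding q by (rule sum_nonneg[OF nn'])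
  have "(\<integral>\<^sup>+t. ennreal (\<phi> t) \<partial>N x) = (\<integral>\<^sup>+t. (\<Sum>r\<in>\<phi> ` space M. ennreal r * indicator (?D r) t) \<partial>N x)"
  proof (rule nn_integral_cong)
    fix t assume "t \<in> space (N x)"
    then have t: "t \<in> space M" by simp
    have "(\<Sum>r\<in>\<phi> ` space M. ennreal r * indicator (?D r) t) = (\<Sum>r\<in>\<phi> ` space M. if r = \<phi> t then ennreal r else 0)"
      using t by (intro sum.cong) (auto simp: indicator_def)
    also have "\<dots> = ennreal (\<phi> t)" using fin t by simp
    finally show "ennreal (\<phi> t) = (\<Sum>r\<in>\<phi> ` space M. ennreal r * indicator (?D r) t)" by simp
  qed
  also have "\<dots> = (\<Sum>r\<in>\<phi> ` space M. \<integral>\<^sup>+t. ennreal r * indicator (?D r) t \<partial>N x)"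
    using Ds by (intro nn_integral_sum borel_measurable_times_ennreal borel_measurable_const borel_measurable_indicator) auto
  also have "\<dots> = (\<Sum>r\<in>\<phi> ` space M. ennreal (r * qform (m (?D r)) x))"
  proof (rule sum.cong)
    fix r assume "r \<in> \<phi> ` space M"
    then show "(\<integral>\<^sup>+t. ennreal r * indicator (?D r) t \<partial>N x) = ennreal (r * qform (m (?D r)) x)"
      using Ds[of r] nn[of r] m_nonneg[OF Ds, of r x]
      by (simp add: nn_integral_cmult_indicator emeasure_N ennreal_mult)
  qed simp
  also have "\<dots> = ennreal (qform (E \<phi>) x)"
    unfolding q using nn' by (intro sum_ennreal) auto
  finally show "ennreal (qform (E \<phi>) x) = (\<integral>\<^sup>+t. ennreal (\<phi> t) \<partial>N x)" by simp
qed

definition approximates :: "(nat \<Rightarrow> 'x \<Rightarrow> real) \<Rightarrow> ('x \<Rightarrow> ennreal) \<Rightarrow> bool"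
  where "approximates \<phi> f \<longleftrightarrow> (\<forall>n. elementary M (\<phi> n)) \<and>
    (\<forall>x\<in>space M. incseq (\<lambda>n. \<phi> n x) \<and> (\<lambda>n. ennreal (\<phi> n x)) \<longlonglongrightarrow> f x)"

lemma approximates_exists:
  assumes "f \<in> borel_measurable M"
  obtains \<phi> where "approximates \<phi> f"
proof -
  obtain u where u: "\<And>i. simple_function M (u i)" "incseq u" "\<And>i x. u i x < top" "\<And>x. (SUP i. u i x) = f x"
    using borel_measurable_implies_simple_function_sequence'[OF assms] by metis
  define \<phi> where "\<phi> i x = enn2real (u i x)" for i x
  have eq: "ennreal (\<phi> i x) = u i x" for i x using u(3) by (simp add: \<phi>_def)
  have inc: "incseq (\<lambda>i. u i x)" for x using u(2) by (auto simp: incseq_def le_fun_def)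
  have "simple_function M (\<phi> i)" for i
    using simple_function_compose[OF u(1), where g = enn2real] by (simp add: \<phi>_def[abs_def] o_def)
  moreover have "incseq (\<lambda>i. \<phi> i x)" for x
    using inc[of x] u(3) unfolding incseq_def \<phi>_def by (auto intro: enn2real_mono)
  moreover have "(\<lambda>i. ennreal (\<phi> i x)) \<longlonglongrightarrow> f x" for x
    unfolding eq using LIMSEQ_SUP[OF inc, of x] u(4) by simp
  ultimately have "approximates \<phi> f"
    by (auto simp: approximates_def elementary_def \<phi>_def)
  then show ?thesis using that by blast
qed

text \<open>Monotone convergence for each scalar measure \<open>N x\<close>. The limit may be
  infinite, hence the formulation in \<open>ennreal\<close>.\<close>

lemma approximates_E:
  assumes a: "approximates \<phi> f"
  shows "incseq (\<lambda>n. qform (E (\<phi> n)) x)"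
    "(\<lambda>n. ennreal (qform (E (\<phi> n)) x)) \<longlonglongrightarrow> (\<integral>\<^sup>+t. f t \<partial>N x)"
proof -
  have el: "elementary M (\<phi> n)" for n using a by (simp add: approximates_def)
  have inc: "ennreal (\<phi> n t) \<le> ennreal (\<phi> k t)" if "t \<in> space M" "n \<le> k" for n k t
    using a that by (intro ennreal_leI) (auto simp: approximates_def incseq_def)
  have "ennreal (qform (E (\<phi> n)) x) \<le> ennreal (qform (E (\<phi> k)) x)" if "n \<le> k" for n k
    unfolding qform_E(2)[OF el] using inc that by (intro nn_integral_mono) auto
  then show i: "incseq (\<lambda>n. qform (E (\<phi> n)) x)"
    unfolding incseq_def ennreal_le_iff[OF qform_E(1)[OF el]] by blast
  have m: "(\<lambda>t. ennreal (\<phi> n t)) \<in> borel_measurable (N x)" for n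
    using borel_measurable_simple_function[of M "\<phi> n"] el measurable_cong_sets[OF sets_N refl, of x]
    by (auto simp: elementary_def intro!: measurable_compose[OF _ measurable_ennreal])
  have "(\<integral>\<^sup>+t. f t \<partial>N x) = (\<integral>\<^sup>+t. (SUP n. ennreal (\<phi> n t)) \<partial>N x)"
  proof (rule nn_integral_cong)
    fix t assume "t \<in> space (N x)"
    then have "(\<lambda>n. ennreal (\<phi> n t)) \<longlonglongrightarrow> f t" "incseq (\<lambda>n. ennreal (\<phi> n t))"
      using a inc by (auto simp: approximates_def incseq_def)
    then show "f t = (SUP n. ennreal (\<phi> n t))" by (metis LIMSEQ_SUP LIMSEQ_unique)
  qed
  also have "\<dots> = (SUP n. \<integral>\<^sup>+t. ennreal (\<phi> n t) \<partial>N x)"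
    using inc by (intro nn_integral_monotone_convergence_SUP_AE m) (auto intro!: AE_I2)
  also have "\<dots> = (SUP n. ennreal (qform (E (\<phi> n)) x))" by (simp add: qform_E(2)[OF el])
  finally show "(\<lambda>n. ennreal (qform (E (\<phi> n)) x)) \<longlonglongrightarrow> (\<integral>\<^sup>+t. f t \<partial>N x)"
    using i by (auto intro!: LIMSEQ_SUP simp: incseq_def ennreal_leI)
qed

text \<open>A description of the integral of \<open>f\<close> free of approximating sequences.
  Nonnegativity is demanded separately because \<open>ennreal\<close> identifies all negative
  numbers with 0.\<close>

definition is_value :: "('x \<Rightarrow> ennreal) \<Rightarrow> ('h \<Rightarrow>\<^sub>L 'h) \<Rightarrow> bool"
  where "is_value f T \<longleftrightarrow> T \<in> Lsa \<and> (\<forall>x. 0 \<le> qform T x \<and> ennreal (qform T x) = (\<integral>\<^sup>+t. f t \<partial>N x))"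

lemma is_value_unique: "is_value f S \<Longrightarrow> is_value f T \<Longrightarrow> S = T"
  unfolding is_value_def by (intro selfadjoint_ops_eqI) (auto simp: ennreal_inj[symmetric])

text \<open>The right-hand side does not mention \<open>\<phi>\<close>; this is the independence of
  the order integral from the approximating sequence.\<close>

lemma approximates_sup_Fin:
  assumes a: "approximates \<phi> f"
  shows "is_sup F (range (\<lambda>n. E (\<phi> n))) T \<longleftrightarrow> is_value f T"
proof -
  have el: "elementary M (\<phi> n)" for n using a by (simp add: approximates_def)
  have EL: "E (\<phi> n) \<in> Lsa" for n by (rule E_in[OF el subspace_Lsa m_Lsa])
  have "(\<lambda>n. qform (E (\<phi> n)) x) \<longlonglongrightarrow> qform T x \<longleftrightarrow>
      0 \<le> qform T x \<and> ennreal (qform T x) = (\<integral>\<^sup>+t. f t \<partial>N x)" for x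
  proof
    assume l: "(\<lambda>n. qform (E (\<phi> n)) x) \<longlonglongrightarrow> qform T x"
    then have "0 \<le> qform T x" by (rule LIMSEQ_le_const) (auto simp: qform_E(1)[OF el])
    moreover have "(\<lambda>n. ennreal (qform (E (\<phi> n)) x)) \<longlonglongrightarrow> ennreal (qform T x)"
      using l by (rule tendsto_ennrealI)
    ultimately show "0 \<le> qform T x \<and> ennreal (qform T x) = (\<integral>\<^sup>+t. f t \<partial>N x)"
      using approximates_E(2)[OF a] LIMSEQ_unique by blast
  next
    assume v: "0 \<le> qform T x \<and> ennreal (qform T x) = (\<integral>\<^sup>+t. f t \<partial>N x)"
    then have "(\<lambda>n. ennreal (qform (E (\<phi> n)) x)) \<longlonglongrightarrow> ennreal (qform T x)"
      using approximates_E(2)[OF a, of x] by simp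
    then show "(\<lambda>n. qform (E (\<phi> n)) x) \<longlonglongrightarrow> qform T x"
      using v qform_E(1)[OF el] by (subst (asm) tendsto_ennreal_iff) auto
  qed
  then show ?thesis
    unfolding sot_incseq_sup_iff[OF L EL approximates_E(1)[OF a]] is_value_def by blast
qed

text \<open>The domination of forms by \<open>B\<close> bounds the increasing sequence of elementary
  integrals, whose strong limit is the value. Each member is a linear combination of values
  \<open>m D\<close>, so the limit stays in every strongly closed subspace containing these.\<close>

lemma is_value_exists:
  assumes f: "f \<in> borel_measurable M" and B: "B \<in> selfadjoint_ops" "\<And>x. 0 \<le> qform B x"
    and le: "\<And>x. (\<integral>\<^sup>+t. f t \<partial>N x) \<le> ennreal (qform B x)"
  obtains T where "is_value f T" "\<forall>P. sot_subspace P \<longrightarrow> (\<forall>D\<in>sets M. m D \<in> P) \<longrightarrow> T \<in> P"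
proof -
  obtain \<phi> where a: "approximates \<phi> f" by (rule approximates_exists[OF f])
  have el: "elementary M (\<phi> n)" for n using a by (simp add: approximates_def)
  have EL: "E (\<phi> n) \<in> Lsa" for n by (rule E_in[OF el subspace_Lsa m_Lsa])
  have EB: "op_le (E (\<phi> n)) B" for n
    unfolding op_le_def
  proof
    fix x
    have inc: "incseq (\<lambda>n. ennreal (qform (E (\<phi> n)) x))"
      using approximates_E(1)[OF a, of x] by (auto simp: incseq_def ennreal_leI)
    have "ennreal (qform (E (\<phi> n)) x) \<le> ennreal (qform B x)"
      using incseq_le[OF inc approximates_E(2)[OF a], of n] le[of x] by (rule order_trans)
    then show "qform (E (\<phi> n)) x \<le> qform B x" using B(2) by (simp add: ennreal_le_iff)
  qed
  obtain T where T: "is_sup F (range (\<lambda>n. E (\<phi> n))) T" "\<forall>x. (\<lambda>n. qform (E (\<phi> n)) x) \<longlonglongrightarrow> qform T x"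
    "\<forall>P. closedin SOT P \<longrightarrow> range (\<lambda>n. E (\<phi> n)) \<subseteq> P \<longrightarrow> T \<in> P"
    by (rule sot_incseq_sup[OF L EL approximates_E(1)[OF a] B(1) EB])
  have "T \<in> P" if "sot_subspace P" "\<forall>D\<in>sets M. m D \<in> P" for P
  proof -
    have "E (\<phi> n) \<in> P" for n using that(2) by (intro E_in[OF el sot_subspaceD(2)[OF that(1)]]) auto
    then show ?thesis using T(3) sot_subspaceD(1)[OF that(1)] by blast
  qed
  then show ?thesis using that T(1) approximates_sup_Fin[OF a] by blast
qed

lemma approximates_sup:
  assumes a: "approximates \<phi> f"
  shows "is_sup (extended F) (range (\<lambda>n. elementary_integral M \<mu> (\<phi> n))) v \<longleftrightarrow>
    (case v of Fin T \<Rightarrow> is_value f T | Infty \<Rightarrow> \<not> (\<exists>T. is_value f T))"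
proof -
  have el: "elementary M (\<phi> n)" for n using a by (simp add: approximates_def)
  have EL: "E (\<phi> n) \<in> Lsa" for n by (rule E_in[OF el subspace_Lsa m_Lsa])
  have r: "range (\<lambda>n. elementary_integral M \<mu> (\<phi> n)) = Fin ` range (\<lambda>n. E (\<phi> n))"
    by (simp add: elementary_integral_eq[OF el] image_image)
  have sub: "range (\<lambda>n. E (\<phi> n)) \<subseteq> carrier F" using EL by auto
  show ?thesis
  proof (cases v)
    case (Fin T)
    then show ?thesis by (simp add: r is_sup_Fin(1)[OF sub] approximates_sup_Fin[OF a])
  next
    case Infty
    have "(\<exists>u\<in>carrier F. \<forall>e\<in>range (\<lambda>n. E (\<phi> n)). le F e u) \<longleftrightarrow> (\<exists>T. is_value f T)"
    proof
      assume "\<exists>u\<in>carrier F. \<forall>e\<in>range (\<lambda>n. E (\<phi> n)). le F e u"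
      then obtain u where u: "u \<in> selfadjoint_ops" "\<And>n. op_le (E (\<phi> n)) u" by auto
      obtain T where "is_sup F (range (\<lambda>n. E (\<phi> n))) T" "\<forall>x. (\<lambda>n. qform (E (\<phi> n)) x) \<longlonglongrightarrow> qform T x"
        "\<forall>P. closedin SOT P \<longrightarrow> range (\<lambda>n. E (\<phi> n)) \<subseteq> P \<longrightarrow> T \<in> P"
        by (rule sot_incseq_sup[OF L EL approximates_E(1)[OF a] u])
      then show "\<exists>T. is_value f T" using approximates_sup_Fin[OF a] by blast
    next
      assume "\<exists>T. is_value f T"
      then obtain T where "is_sup F (range (\<lambda>n. E (\<phi> n))) T" using approximates_sup_Fin[OF a] by blast
      then show "\<exists>u\<in>carrier F. \<forall>e\<in>range (\<lambda>n. E (\<phi> n)). le F e u"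
        using sub unfolding is_sup_iff by blast
    qed
    then show ?thesis unfolding r using Infty is_sup_Fin(2)[OF sub] by simp
  qed
qed

text \<open>The description under \<open>THE\<close> has exactly one solution in either case: the
  value if there is one, and \<open>Infty\<close> otherwise. The implication from left to right
  depends on the infinite case as well, since an undetermined \<open>THE\<close> could equal
  anything.\<close>

lemma order_integral_pos_Fin_iff:
  assumes f: "f \<in> borel_measurable M"
  shows "order_integral_pos F M \<mu> f = Fin T \<longleftrightarrow> is_value f T"
proof -
  let ?P = "\<lambda>v. \<exists>\<phi>. approximates \<phi> f \<and>
    is_sup (extended F) (range (\<lambda>n. elementary_integral M \<mu> (\<phi> n))) v"
  have oip: "order_integral_pos F M \<mu> f = (THE v. ?P v)"
    unfolding order_integral_pos_def approximates_def by (simp add: conj_assoc)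
  have P: "?P v \<longleftrightarrow> (case v of Fin T \<Rightarrow> is_value f T | Infty \<Rightarrow> \<not> (\<exists>T. is_value f T))" for v
    using approximates_sup approximates_exists[OF f] by metis
  show ?thesis
  proof
    assume "is_value f T"
    then show "order_integral_pos F M \<mu> f = Fin T"
      unfolding oip P by (intro the_equality) (auto split: extd.splits intro: is_value_unique)
  next
    assume T: "order_integral_pos F M \<mu> f = Fin T"
    show "is_value f T"
    proof (rule ccontr)
      assume "\<not> is_value f T"
      show False
      proof (cases "\<exists>S. is_value f S")
        case True
        then obtain S where S: "is_value f S" by auto
        then have "order_integral_pos F M \<mu> f = Fin S"
          unfolding oip P by (intro the_equality) (auto split: extd.splits intro: is_value_unique)
        then show False using T S \<open>\<not> is_value f T\<close> by simp
      next
        case False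
        then have "order_integral_pos F M \<mu> f = Infty"
          unfolding oip P by (intro the_equality) (auto split: extd.splits)
        then show False using T by simp
      qed
    qed
  qed
qed

section \<open>Integrable functions and strong countable additivity\<close>

lemma L1_iff:
  "f \<in> L1 F M \<mu> \<longleftrightarrow> f \<in> borel_measurable M \<and> (\<exists>T. is_value (\<lambda>t. ennreal \<bar>f t\<bar>) T)"
proof -
  have "order_integral_pos F M \<mu> (\<lambda>t. ennreal \<bar>f t\<bar>) = Fin T \<longleftrightarrow> is_value (\<lambda>t. ennreal \<bar>f t\<bar>) T"
    if "f \<in> borel_measurable M" for T
    using that by (intro order_integral_pos_Fin_iff) simp
  moreover have "is_value (\<lambda>t. ennreal \<bar>f t\<bar>) T \<Longrightarrow> T \<in> carrier F" for T
    by (simp add: is_value_def)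
  ultimately show ?thesis unfolding L1_def image_iff by blast
qed

lemma L1_dominated:
  assumes f: "f \<in> borel_measurable M" and B: "B \<in> selfadjoint_ops" "\<And>x. 0 \<le> qform B x"
    and le: "\<And>x. (\<integral>\<^sup>+t. ennreal \<bar>f t\<bar> \<partial>N x) \<le> ennreal (qform B x)"
  shows "f \<in> L1 F M \<mu>"
proof -
  have fm: "(\<lambda>t. ennreal \<bar>f t\<bar>) \<in> borel_measurable M" using f by simp
  obtain T where "is_value (\<lambda>t. ennreal \<bar>f t\<bar>) T"
    "\<forall>P. sot_subspace P \<longrightarrow> (\<forall>D\<in>sets M. m D \<in> P) \<longrightarrow> T \<in> P"
    by (rule is_value_exists[OF fm B le])
  then show ?thesis using f unfolding L1_iff by blast
qed

lemma L1_bounded: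
  assumes f: "f \<in> borel_measurable M" and c: "\<And>t. t \<in> space M \<Longrightarrow> \<bar>f t\<bar> \<le> c"
  shows "f \<in> L1 F M \<mu>"
\<comment> \<open>The maximum with 0 is taken because \<open>c\<close> may be negative when the
  space is empty.\<close>
proof (rule L1_dominated[OF f, of "max c 0 *\<^sub>R m (space M)"])
  show "max c 0 *\<^sub>R m (space M) \<in> selfadjoint_ops"
    using m_Lsa[of "space M"] by (intro subspace_scale[OF subspace_selfadjoint_ops]) auto
  show "0 \<le> qform (max c 0 *\<^sub>R m (space M)) x" for x by (simp add: m_nonneg)
  fix x
  have "(\<integral>\<^sup>+t. ennreal \<bar>f t\<bar> \<partial>N x) \<le> (\<integral>\<^sup>+t. ennreal (max c 0) \<partial>N x)"
    using c by (intro nn_integral_mono ennreal_leI) (force simp: le_max_iff_disj)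
  also have "\<dots> = ennreal (qform (max c 0 *\<^sub>R m (space M)) x)"
    by (simp add: emeasure_N ennreal_mult m_nonneg)
  finally show "(\<integral>\<^sup>+t. ennreal \<bar>f t\<bar> \<partial>N x) \<le> ennreal (qform (max c 0 *\<^sub>R m (space M)) x)" .
qed

lemma L1_order_integral:
  assumes f: "f \<in> L1 F M \<mu>"
  shows "order_integral F M \<mu> f \<in> Lsa" (is ?A)
    and "integrable (N x) f" (is ?B)
    and "qform (order_integral F M \<mu> f) x = (\<integral>t. f t \<partial>N x)" (is ?C)
    and "sot_subspace P \<Longrightarrow> (\<And>D. D \<in> sets M \<Longrightarrow> m D \<in> P) \<Longrightarrow> order_integral F M \<mu> f \<in> P"
proof -
  have fm: "f \<in> borel_measurable M" using f L1_iff by auto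
  then have fN: "f \<in> borel_measurable (N x)" for x
    using measurable_cong_sets[OF sets_N refl] by blast
  obtain B where B: "is_value (\<lambda>t. ennreal \<bar>f t\<bar>) B" using f L1_iff by auto
  have Bsa: "B \<in> selfadjoint_ops" "0 \<le> qform B x" for x using B by (auto simp: is_value_def)
  \<comment> \<open>Positive and negative part both lie below |f|, so the value \<open>B\<close> of
    |f| dominates their integrals and both values are finite.\<close>
  have half: "\<exists>T. order_integral_pos F M \<mu> (\<lambda>t. ennreal (g t)) = Fin T \<and> is_value (\<lambda>t. ennreal (g t)) T \<and>
      (\<forall>P. sot_subspace P \<longrightarrow> (\<forall>D\<in>sets M. m D \<in> P) \<longrightarrow> T \<in> P)"
    if g: "g \<in> borel_measurable M" "\<And>t. g t \<le> \<bar>f t\<bar>" for g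
  proof -
    have gm: "(\<lambda>t. ennreal (g t)) \<in> borel_measurable M" using g(1) by simp
    have le: "(\<integral>\<^sup>+t. ennreal (g t) \<partial>N x) \<le> ennreal (qform B x)" for x
      using B g(2) unfolding is_value_def by (auto intro!: nn_integral_mono ennreal_leI)
    obtain T where "is_value (\<lambda>t. ennreal (g t)) T"
      "\<forall>P. sot_subspace P \<longrightarrow> (\<forall>D\<in>sets M. m D \<in> P) \<longrightarrow> T \<in> P"
      by (rule is_value_exists[OF gm Bsa le])
    then show ?thesis using order_integral_pos_Fin_iff[OF gm] by blast
  qed
  obtain T1 where T1: "order_integral_pos F M \<mu> (\<lambda>t. ennreal (max (f t) 0)) = Fin T1"
      "is_value (\<lambda>t. ennreal (max (f t) 0)) T1" "\<And>P. sot_subspace P \<Longrightarrow> \<forall>D\<in>sets M. m D \<in> P \<Longrightarrow> T1 \<in> P"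
  proof -
    have "(\<lambda>t. max (f t) 0) \<in> borel_measurable M" "max (f t) 0 \<le> \<bar>f t\<bar>" for t using fm by auto
    from half[OF this] show ?thesis using that by blast
  qed
  obtain T2 where T2: "order_integral_pos F M \<mu> (\<lambda>t. ennreal (max (- f t) 0)) = Fin T2"
      "is_value (\<lambda>t. ennreal (max (- f t) 0)) T2" "\<And>P. sot_subspace P \<Longrightarrow> \<forall>D\<in>sets M. m D \<in> P \<Longrightarrow> T2 \<in> P"
  proof -
    have "(\<lambda>t. max (- f t) 0) \<in> borel_measurable M" "max (- f t) 0 \<le> \<bar>f t\<bar>" for t using fm by auto
    from half[OF this] show ?thesis using that by blast
  qed
  have oi: "order_integral F M \<mu> f = T1 - T2" by (simp add: order_integral_def T1(1) T2(1))
  show ?A unfolding oi using T1(2) T2(2) by (intro subspace_diff[OF subspace_Lsa]) (auto simp: is_value_def)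
  show "order_integral F M \<mu> f \<in> P" if "sot_subspace P" "\<And>D. D \<in> sets M \<Longrightarrow> m D \<in> P"
    unfolding oi using that(2) by (intro subspace_diff[OF sot_subspaceD(2)[OF that(1)]] T1(3)[OF that(1)] T2(3)[OF that(1)]) blast+
  have "(\<integral>\<^sup>+t. ennreal (norm (f t)) \<partial>N x) = ennreal (qform B x)" for x
    using B by (simp add: is_value_def)
  then show int: "integrable (N x) f" for x
    by (intro integrableI_bounded fN) (simp add: less_top[symmetric])
  have q: "qform T x = (\<integral>t. g t \<partial>N x)"
    if v: "is_value (\<lambda>t. ennreal (g t)) T" and g: "\<And>t. 0 \<le> g t" "g \<in> borel_measurable (N x)" for g T
  proof -
    have "(\<integral>\<^sup>+t. ennreal (g t) \<partial>N x) = ennreal (qform T x)" "0 \<le> qform T x"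
      using v by (auto simp: is_value_def)
    then show ?thesis using g by (simp add: integral_eq_nn_integral)
  qed
  have p: "qform T1 x = (\<integral>t. max (f t) 0 \<partial>N x)" "qform T2 x = (\<integral>t. max (- f t) 0 \<partial>N x)"
    using fN[of x] by (auto intro!: q T1(2) T2(2))
  have "qform (T1 - T2) x = (\<integral>t. max (f t) 0 - max (- f t) 0 \<partial>N x)"
    unfolding qform_diff p using int[of x]
    by (intro Bochner_Integration.integral_diff[symmetric] integrable_max) auto
  also have "\<dots> = (\<integral>t. f t \<partial>N x)" by (intro Bochner_Integration.integral_cong) auto
  finally show ?C unfolding oi .
qed

lemma L1_order_integral_unique:
  assumes f: "f \<in> L1 F M \<mu>" and T: "T \<in> bounded_ops"
  shows "(\<forall>x. cinner (T x) x = complex_of_real (\<integral>t. f t \<partial>N x)) \<longleftrightarrow> T = order_integral F M \<mu> f"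
proof -
  have sa: "order_integral F M \<mu> f \<in> selfadjoint_ops" using L1_order_integral(1)[OF f] by simp
  have eq: "cinner (order_integral F M \<mu> f x) x = complex_of_real (\<integral>t. f t \<partial>N x)" for x
    using cinner_selfadjoint[OF sa] by (simp add: L1_order_integral(3)[OF f])
  then show ?thesis
    using bounded_ops_eqI[OF T selfadjoint_ops_bounded[OF sa]] by auto
qed

lemma order_integral_eqI:
  assumes f: "f \<in> L1 F M \<mu>" and T: "T \<in> selfadjoint_ops" and eq: "\<And>x. qform T x = (\<integral>t. f t \<partial>N x)"
  shows "order_integral F M \<mu> f = T"
  using L1_order_integral(1)[OF f] T eq by (intro selfadjoint_ops_eqI) (auto simp: L1_order_integral(3)[OF f])

text \<open>The remainders \<open>m ?U - ?S k\<close> are positive with norm at most that of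
  \<open>m ?U\<close>, and their forms tend to 0; \<open>norm_apply_sq_le\<close> converts this into
  norm convergence at each vector.\<close>

lemma m_sums_strong:
  fixes D :: "nat \<Rightarrow> 'x set"
  assumes D: "range D \<subseteq> sets M" "disjoint_family D"
  shows "(\<lambda>n. m (D n) x) sums m (\<Union>n. D n) x"
proof -
  let ?U = "\<Union>n. D n"
  let ?S = "\<lambda>k. \<Sum>n<k. m (D n)"
  have Ds: "D n \<in> sets M" for n using D(1) by auto
  have Us: "?U \<in> sets M" using Ds by auto
  have R: "m ?U - ?S k \<in> Lsa" for k
    by (intro subspace_diff[OF subspace_Lsa] subspace_sum[OF subspace_Lsa] m_Lsa Ds Us)
  have R0: "0 \<le> qform (m ?U - ?S k) y" for k y
    using sum_le_suminf[OF sums_summable[OF m_sums[OF D, of y]], of "{..<k}"] sums_unique[OF m_sums[OF D, of y]]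
    by (simp add: qform_sum m_nonneg[OF Ds])
  have R1: "norm (m ?U - ?S k) \<le> norm (m ?U)" for k
  proof (rule norm_mono_selfadjoint)
    show "qform (m ?U - ?S k) y \<le> qform (m ?U) y" for y
      by (simp add: qform_sum sum_nonneg m_nonneg[OF Ds])
  qed (use R R0 in auto)
  have le: "(norm (m ?U x - (\<Sum>n<k. m (D n) x)))\<^sup>2 \<le> norm (m ?U) * (qform (m ?U) x - (\<Sum>n<k. qform (m (D n)) x))" for k
  proof -
    have "(norm ((m ?U - ?S k) x))\<^sup>2 \<le> norm (m ?U - ?S k) * qform (m ?U - ?S k) x"
      using R R0 by (intro norm_apply_sq_le) auto
    also have "\<dots> \<le> norm (m ?U) * qform (m ?U - ?S k) x"
      by (intro mult_right_mono R1 R0)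
    finally show ?thesis by (simp add: blinfun.diff_left blinfun.sum_left qform_sum)
  qed
  have lim: "(\<lambda>k. norm (m ?U) * (qform (m ?U) x - (\<Sum>n<k. qform (m (D n)) x))) \<longlonglongrightarrow>
      norm (m ?U) * (qform (m ?U) x - qform (m ?U) x)"
    using m_sums[OF D, of x] unfolding sums_def by (intro tendsto_intros)
  have "(\<lambda>k. (norm (m ?U x - (\<Sum>n<k. m (D n) x)))\<^sup>2) \<longlonglongrightarrow> 0"
  proof (rule tendsto_sandwich[OF _ _ tendsto_const])
    show "(\<lambda>k. norm (m ?U) * (qform (m ?U) x - (\<Sum>n<k. qform (m (D n)) x))) \<longlonglongrightarrow> 0"
      using lim by simp
  qed (simp_all add: le)
  then have "(\<lambda>k. sqrt ((norm (m ?U x - (\<Sum>n<k. m (D n) x)))\<^sup>2)) \<longlonglongrightarrow> sqrt 0"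
    by (rule tendsto_real_sqrt)
  then have "(\<lambda>k. m ?U x - (\<Sum>n<k. m (D n) x)) \<longlonglongrightarrow> 0"
    by (simp add: tendsto_norm_zero_iff)
  from tendsto_diff[OF tendsto_const[of "m ?U x"] this] show ?thesis by (simp add: sums_def)
qed

end

section \<open>Positive operators on functions vanishing at infinity\<close>

lemma C0_continuous: "f \<in> C0 X \<Longrightarrow> continuous_map X euclideanreal f"
  and C0_outside: "f \<in> C0 X \<Longrightarrow> x \<notin> topspace X \<Longrightarrow> f x = 0"
  and C0_compact: "f \<in> C0 X \<Longrightarrow> e > 0 \<Longrightarrow> compactin X {x \<in> topspace X. e \<le> \<bar>f x\<bar>}"
  by (auto simp: C0_def)

lemma C0I:
  assumes "continuous_map X euclideanreal f" "\<And>x. x \<notin> topspace X \<Longrightarrow> f x = 0"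
    and "\<And>e. e > 0 \<Longrightarrow> \<exists>K. compactin X K \<and> {x \<in> topspace X. e \<le> \<bar>f x\<bar>} \<subseteq> K"
  shows "f \<in> C0 X"
proof -
  have "compactin X {x \<in> topspace X. e \<le> \<bar>f x\<bar>}" if "e > 0" for e
  proof -
    obtain K where K: "compactin X K" "{x \<in> topspace X. e \<le> \<bar>f x\<bar>} \<subseteq> K" using assms(3)[OF \<open>e > 0\<close>] by auto
    then show ?thesis
      by (intro closed_compactin[OF K] closedin_ge continuous_map_real_abs assms(1))
  qed
  then show ?thesis using assms by (auto simp: C0_def)
qed

lemma C0_add:
  assumes f: "f \<in> C0 X" and g: "g \<in> C0 X"
  shows "(\<lambda>x. f x + g x) \<in> C0 X"
proof (rule C0I)
  show "continuous_map X euclideanreal (\<lambda>x. f x + g x)"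
    using f g by (intro continuous_map_add C0_continuous)
  fix e :: real assume e: "e > 0"
  let ?K = "{x \<in> topspace X. e/2 \<le> \<bar>f x\<bar>} \<union> {x \<in> topspace X. e/2 \<le> \<bar>g x\<bar>}"
  have "compactin X ?K" using e by (intro compactin_Un C0_compact f g) auto
  then show "\<exists>K. compactin X K \<and> {x \<in> topspace X. e \<le> \<bar>f x + g x\<bar>} \<subseteq> K"
    by (intro exI[of _ ?K]) auto
qed (use f g in \<open>simp add: C0_outside\<close>)

lemma C0_compose:
  assumes f: "f \<in> C0 X" and h: "continuous_on UNIV h" "h 0 = 0"
  shows "(\<lambda>x. h (f x)) \<in> C0 X"
proof (rule C0I)
  have "continuous_map X euclideanreal (h \<circ> f)"
    using f h by (intro continuous_map_compose[OF C0_continuous]) auto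
  then show "continuous_map X euclideanreal (\<lambda>x. h (f x))" by (simp add: o_def)
  fix e :: real assume e: "e > 0"
  have "isCont h 0" using h(1) by (simp add: continuous_on_eq_continuous_at)
  then obtain d where d: "d > 0" "\<And>t. \<bar>t\<bar> < d \<Longrightarrow> \<bar>h t\<bar> < e"
    using e h(2) unfolding continuous_at_eps_delta by (auto simp: dist_real_def)
  then show "\<exists>K. compactin X K \<and> {x \<in> topspace X. e \<le> \<bar>h (f x)\<bar>} \<subseteq> K"
    by (intro exI[of _ "{x \<in> topspace X. d \<le> \<bar>f x\<bar>}"] conjI C0_compact f) (auto simp: not_less[symmetric])
qed (use f h in \<open>simp add: C0_outside\<close>)

lemma C0_cmult: "f \<in> C0 X \<Longrightarrow> (\<lambda>x. c * f x) \<in> C0 X"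
  by (rule C0_compose[where h = "\<lambda>t. c * t"]) (auto intro!: continuous_intros)

lemma C0_diff:
  assumes "f \<in> C0 X" "g \<in> C0 X" shows "(\<lambda>x. f x - g x) \<in> C0 X"
  using C0_add[OF assms(1) C0_cmult[OF assms(2), of "-1"]] by simp

text \<open>Vanishing at infinity survives because an approximation \<open>g\<close> within
  \<open>e/2\<close> puts the set where |f| is at least \<open>e\<close> into the compact set where
  |g| is at least \<open>e/2\<close>.\<close>

lemma C0_uniform_limit:
  assumes out: "\<And>x. x \<notin> topspace X \<Longrightarrow> f x = 0"
    and approx: "\<And>e. e > 0 \<Longrightarrow> \<exists>g\<in>C0 X. \<forall>x\<in>topspace X. \<bar>f x - g x\<bar> < e"
  shows "f \<in> C0 X"
proof (rule C0I[OF _ out])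
  have "continuous_map X Met_TC.mtopology f"
    unfolding Met_TC.continuous_map_to_metric
  proof (intro ballI allI impI)
    fix x and e :: real assume x: "x \<in> topspace X" and e: "e > 0"
    obtain g where g: "g \<in> C0 X" "\<And>y. y \<in> topspace X \<Longrightarrow> \<bar>f y - g y\<bar> < e/3"
      using approx[of "e/3"] e by auto
    let ?U = "{y \<in> topspace X. g y \<in> ball (g x) (e/3)}"
    have "openin X ?U"
      by (rule openin_continuous_map_preimage[OF C0_continuous[OF g(1)]]) simp
    moreover have "\<bar>f x - f y\<bar> < e" if "y \<in> ?U" for y
    proof -
      have "\<bar>f x - g x\<bar> < e/3" "\<bar>f y - g y\<bar> < e/3" "\<bar>g x - g y\<bar> < e/3"
        using g(2)[OF x] g(2)[of y] that by (auto simp: dist_real_def)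
      then show ?thesis by linarith
    qed
    ultimately show "\<exists>U. openin X U \<and> x \<in> U \<and> (\<forall>y\<in>U. f y \<in> Met_TC.mball (f x) e)"
      using x e by (intro exI[of _ ?U]) (auto simp: dist_real_def)
  qed
  then show "continuous_map X euclideanreal f" by simp
next
  fix e :: real assume e: "e > 0"
  obtain g where g: "g \<in> C0 X" "\<And>y. y \<in> topspace X \<Longrightarrow> \<bar>f y - g y\<bar> < e/2"
    using approx[of "e/2"] e by auto
  then show "\<exists>K. compactin X K \<and> {x \<in> topspace X. e \<le> \<bar>f x\<bar>} \<subseteq> K"
    using C0_compact[OF g(1), of "e/2"] e
    by (intro exI[of _ "{x \<in> topspace X. e/2 \<le> \<bar>g x\<bar>}"]) (fastforce simp: abs_if split: if_splits)
qed

lemma C0_sum: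
  assumes "\<And>i. f i \<in> C0 X"
  shows "(\<lambda>x. \<Sum>i<n::nat. f i x) \<in> C0 X"
proof (induction n)
  case 0
  show ?case by (rule C0I) auto
next
  case (Suc n)
  then show ?case using C0_add[OF Suc assms[of n]] by simp
qed

text \<open>Produces one function that dominates a multiple of every member of a sequence; on it an
  unbounded positive operator could take no value.\<close>

lemma C0_geometric_series:
  fixes f :: "nat \<Rightarrow> 'x \<Rightarrow> real"
  assumes f: "\<And>n. f n \<in> C0 X" and f01: "\<And>n x. x \<in> topspace X \<Longrightarrow> 0 \<le> f n x \<and> f n x \<le> 1"
  shows "(\<lambda>x. \<Sum>n. (1/2)^n * f n x) \<in> C0 X"
    and "x \<in> topspace X \<Longrightarrow> (1/2)^k * f k x \<le> (\<Sum>n. (1/2)^n * f n x)"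
proof -
  have geo: "summable (\<lambda>n. (1/2::real)^n)" by (rule summable_geometric) simp
  have sm: "summable (\<lambda>n. (1/2)^n * f n x)" if "x \<in> topspace X" for x
    using f01[OF that] by (intro summable_comparison_test[OF _ geo]) (auto simp: mult_left_le abs_mult)
  show "(\<lambda>x. \<Sum>n. (1/2)^n * f n x) \<in> C0 X"
  proof (rule C0_uniform_limit)
    fix e :: real assume "e > 0"
    then obtain n where n: "\<bar>(\<Sum>i. (1/2::real) ^ (i + n))\<bar> < e"
      using suminf_exist_split[OF _ geo, of e] by (auto simp: real_norm_def)
    have "\<bar>(\<Sum>i. (1/2)^i * f i x) - (\<Sum>i<n. (1/2)^i * f i x)\<bar> < e" if x: "x \<in> topspace X" for x
    proof -
      have s1: "summable (\<lambda>i. (1/2)^(i+n) * f (i+n) x)" using sm[OF x] by (subst summable_iff_shift)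
      have s2: "summable (\<lambda>i. (1/2::real)^(i+n))" using geo by (subst summable_iff_shift)
      have "(\<Sum>i. (1/2)^i * f i x) - (\<Sum>i<n. (1/2)^i * f i x) = (\<Sum>i. (1/2)^(i+n) * f (i+n) x)"
        by (rule suminf_minus_initial_segment[symmetric, OF sm[OF x]])
      moreover have "0 \<le> (\<Sum>i. (1/2)^(i+n) * f (i+n) x)"
        using f01[OF x] by (intro suminf_nonneg s1) auto
      moreover have "(\<Sum>i. (1/2)^(i+n) * f (i+n) x) \<le> (\<Sum>i. (1/2)^(i+n))"
        using f01[OF x] by (intro suminf_le s1 s2) (auto simp: mult_left_le)
      ultimately show ?thesis using n by simp
    qed
    moreover have "(\<lambda>x. \<Sum>i<n. (1/2)^i * f i x) \<in> C0 X"
      using f by (intro C0_sum C0_cmult)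
    ultimately show "\<exists>g\<in>C0 X. \<forall>x\<in>topspace X. \<bar>(\<Sum>i. (1/2)^i * f i x) - g x\<bar> < e"
      by (intro bexI) auto
  qed (simp add: C0_outside[OF f])
  show "(1/2)^k * f k x \<le> (\<Sum>n. (1/2)^n * f n x)" if "x \<in> topspace X"
    using sum_le_suminf[OF sm[OF that], of "{k}"] f01[OF that] by simp
qed

lemma id_selfadjoint: "id_blinfun \<in> selfadjoint_ops"
  by (simp add: selfadjoint_ops_def bounded_ops_def)

lemma qform_id: "qform id_blinfun x = (norm x)\<^sup>2"
  by (simp add: qform_def norm_sq_cinner)

locale positive_C0_operator =
  fixes X :: "'x topology" and \<pi> :: "('x \<Rightarrow> real) \<Rightarrow> ('h::complex_hilbert \<Rightarrow>\<^sub>L 'h)"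
    and L :: "('h \<Rightarrow>\<^sub>L 'h) set"
  assumes lc: "locally_compact_space X" and hd: "Hausdorff_space X"
    and \<pi>: "positive_operator X (C0 X) (sa_space bounded_ops) \<pi>"
    and L: "sot_subspace L" and \<pi>_L: "\<pi> ` C0 X \<subseteq> L"
begin

lemma \<pi>_sa: "f \<in> C0 X \<Longrightarrow> \<pi> f \<in> selfadjoint_ops"
  using \<pi> by (auto simp: positive_operator_def)

lemma \<pi>_Lsa: "f \<in> C0 X \<Longrightarrow> \<pi> f \<in> L \<inter> selfadjoint_ops"
  using \<pi>_sa \<pi>_L by auto

lemma \<pi>_add: "f \<in> C0 X \<Longrightarrow> g \<in> C0 X \<Longrightarrow> \<pi> (\<lambda>x. f x + g x) = \<pi> f + \<pi> g"
  and \<pi>_cmult: "f \<in> C0 X \<Longrightarrow> \<pi> (\<lambda>x. c * f x) = c *\<^sub>R \<pi> f"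
  using \<pi> by (auto simp: positive_operator_def)

lemma \<pi>_nonneg: "f \<in> C0 X \<Longrightarrow> (\<And>t. t \<in> topspace X \<Longrightarrow> 0 \<le> f t) \<Longrightarrow> 0 \<le> qform (\<pi> f) x"
  using \<pi> by (auto simp: positive_operator_def pos_cone_sa_space)

lemma \<pi>_diff: "f \<in> C0 X \<Longrightarrow> g \<in> C0 X \<Longrightarrow> \<pi> (\<lambda>x. f x - g x) = \<pi> f - \<pi> g"
  using \<pi>_add[OF C0_diff[of f X g], of g] by simp

lemma \<pi>_mono:
  assumes "f \<in> C0 X" "g \<in> C0 X" "\<And>t. t \<in> topspace X \<Longrightarrow> f t \<le> g t"
  shows "op_le (\<pi> f) (\<pi> g)"
  unfolding op_le_def
proof
  fix x
  show "qform (\<pi> f) x \<le> qform (\<pi> g) x"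
    using \<pi>_nonneg[OF C0_diff[OF assms(2,1)], of x] assms by (simp add: \<pi>_diff)
qed

text \<open>Automatic continuity. Were |\<pi>(f n)| larger than 4^n for functions with values in
  [0, 1], the series with weights 2^-n would dominate each term, and monotonicity of the norm on
  positive operators would give its image norm at least 2^k for every \<open>k\<close>.\<close>

lemma \<pi>_bounded:
  obtains C where "C \<ge> 0" "\<And>f. f \<in> C0 X \<Longrightarrow> (\<And>t. t \<in> topspace X \<Longrightarrow> 0 \<le> f t \<and> f t \<le> 1) \<Longrightarrow> norm (\<pi> f) \<le> C"
proof -
  have "\<exists>C. \<forall>f\<in>C0 X. (\<forall>t\<in>topspace X. 0 \<le> f t \<and> f t \<le> 1) \<longrightarrow> norm (\<pi> f) \<le> C"
  proof (rule ccontr)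
    assume "\<not> ?thesis"
    then have "\<exists>f. f \<in> C0 X \<and> (\<forall>t\<in>topspace X. 0 \<le> f t \<and> f t \<le> 1) \<and> 4^n < norm (\<pi> f)" for n :: nat
      by (metis not_le)
    then obtain f where f: "\<And>n::nat. f n \<in> C0 X" "\<And>n t. t \<in> topspace X \<Longrightarrow> 0 \<le> f n t \<and> f n t \<le> 1"
      "\<And>n. 4^n < norm (\<pi> (f n))" by metis
    let ?g = "\<lambda>x. \<Sum>n. (1/2)^n * f n x"
    have g: "?g \<in> C0 X" by (rule C0_geometric_series(1)[of f X, OF f(1,2)])
    have gk: "(1/2)^k * f k t \<le> ?g t" if "t \<in> topspace X" for k t
      by (rule C0_geometric_series(2)[of f X, OF f(1,2) that])
    have "(2::real)^k \<le> norm (\<pi> ?g)" for k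
    proof -
      have kC: "(\<lambda>t. (1/2)^k * f k t) \<in> C0 X" by (rule C0_cmult[OF f(1)])
      have "(2::real)^k = (1/2)^k * 4^k" by (simp flip: power_mult_distrib)
      also have "\<dots> \<le> (1/2)^k * norm (\<pi> (f k))" using f(3)[of k] by (intro mult_left_mono) auto
      also have "\<dots> = norm (\<pi> (\<lambda>t. (1/2)^k * f k t))" by (simp add: \<pi>_cmult[OF f(1)])
      also have "\<dots> \<le> norm (\<pi> ?g)"
        using \<pi>_mono[OF kC g gk] f(2)
        by (intro norm_mono_selfadjoint \<pi>_sa kC \<pi>_nonneg) (auto simp: op_le_def)
      finally show ?thesis .
    qed
    moreover obtain k where "norm (\<pi> ?g) < (2::real)^k" using real_arch_pow[of 2 "norm (\<pi> ?g)"] by auto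
    ultimately show False by (meson not_le)
  qed
  then obtain C where "\<forall>f\<in>C0 X. (\<forall>t\<in>topspace X. 0 \<le> f t \<and> f t \<le> 1) \<longrightarrow> norm (\<pi> f) \<le> C" by auto
  then show ?thesis by (intro that[of "max C 0"]) (auto simp: le_max_iff_disj)
qed

definition C :: real
  where "C = (SOME C. C \<ge> 0 \<and> (\<forall>f\<in>C0 X. (\<forall>t\<in>topspace X. 0 \<le> f t \<and> f t \<le> 1) \<longrightarrow> norm (\<pi> f) \<le> C))"

lemma C_nonneg: "0 \<le> C"
  and \<pi>_le_C: "f \<in> C0 X \<Longrightarrow> (\<And>t. t \<in> topspace X \<Longrightarrow> 0 \<le> f t \<and> f t \<le> 1) \<Longrightarrow> norm (\<pi> f) \<le> C"
proof -
  have "\<exists>C. C \<ge> 0 \<and> (\<forall>f\<in>C0 X. (\<forall>t\<in>topspace X. 0 \<le> f t \<and> f t \<le> 1) \<longrightarrow> norm (\<pi> f) \<le> C)"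
    by (rule \<pi>_bounded) blast
  from someI_ex[OF this] show "0 \<le> C"
    "f \<in> C0 X \<Longrightarrow> (\<And>t. t \<in> topspace X \<Longrightarrow> 0 \<le> f t \<and> f t \<le> 1) \<Longrightarrow> norm (\<pi> f) \<le> C"
    unfolding C_def by blast+
qed

lemma qform_\<pi>_le:
  assumes "f \<in> C0 X" "\<And>t. t \<in> topspace X \<Longrightarrow> 0 \<le> f t \<and> f t \<le> 1"
  shows "qform (\<pi> f) x \<le> C * (norm x)\<^sup>2"
  using qform_le_norm[of "\<pi> f" x] mult_right_mono[OF \<pi>_le_C[OF assms], of "(norm x)\<^sup>2"] by simp

sublocale \<Lambda>: bounded_positive_functional X "\<lambda>f. qform (\<pi> f) x" "C * (norm x)\<^sup>2" for x
  by unfold_locales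
    (simp_all add: lc hd \<pi>_add \<pi>_cmult C0_of_Cc \<pi>_nonneg qform_\<pi>_le)

section \<open>The scalar measures of the operator\<close>

abbreviation N :: "'h \<Rightarrow> 'x measure"
  where "N x \<equiv> \<Lambda>.N x"

lemma qform_\<pi>_Cc: "f \<in> Cc X \<Longrightarrow> qform (\<pi> f) x = (\<integral>t. f t \<partial>N x)"
  by (rule \<Lambda>.\<Lambda>_eq_integral)

lemma C0_measurable: "f \<in> C0 X \<Longrightarrow> f \<in> borel_measurable (borel_of X)"
  by (rule continuous_map_measurable[OF C0_continuous])

lemma C0_bounded:
  assumes "f \<in> C0 X"
  obtains B where "\<And>x. \<bar>f x\<bar> \<le> B"
proof -
  let ?K = "{x \<in> topspace X. 1 \<le> \<bar>f x\<bar>}"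
  have "compactin euclideanreal (f ` ?K)"
    using assms by (intro image_compactin[OF C0_compact C0_continuous]) auto
  then have "bounded (f ` ?K)" by (simp add: compact_imp_bounded)
  then obtain B where B: "\<And>x. x \<in> ?K \<Longrightarrow> \<bar>f x\<bar> \<le> B" unfolding bounded_iff by auto
  have "\<bar>f x\<bar> \<le> max B 1" for x
    using B[of x] C0_outside[OF assms, of x] by (cases "x \<in> ?K") auto
  then show ?thesis by (rule that)
qed

lemma integrable_C0:
  assumes "f \<in> C0 X"
  shows "integrable (N x) f"
proof -
  obtain B where "\<And>x. \<bar>f x\<bar> \<le> B" using C0_bounded[OF assms] by auto
  moreover have "f \<in> borel_measurable (N x)"
    using C0_measurable[OF assms] measurable_cong_sets[OF \<Lambda>.sets_N refl] by auto
  ultimately show ?thesis by (intro \<Lambda>.N.integrable_const_bound[where B = B]) auto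
qed

text \<open>Cutting at a small height \<open>d\<close> splits \<open>f\<close> into
  \<open>max (f t - d) 0\<close>, which has compact support because \<open>f\<close> vanishes at
  infinity, and a remainder between 0 and \<open>d\<close>, which contributes at most
  \<open>d\<close> times a constant to either side.\<close>

lemma qform_\<pi>_C0_nonneg:
  assumes f: "f \<in> C0 X" "\<And>t. t \<in> topspace X \<Longrightarrow> 0 \<le> f t"
  shows "qform (\<pi> f) x = (\<integral>t. f t \<partial>N x)"
proof -
  let ?c = "C * (norm x)\<^sup>2 + measure (N x) (topspace X)"
  have c: "0 \<le> ?c" using C_nonneg by (simp add: zero_le_mult_iff)
  have "\<bar>qform (\<pi> f) x - (\<integral>t. f t \<partial>N x)\<bar> \<le> 0 + e" if e: "e > 0" for e
  proof -
    \<comment> \<open>\<open>?c\<close> adds the bounds for the two contributions of the remainder,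
      through \<open>\<pi>\<close> and through the mass of \<open>N x\<close>; the summand 1 avoids
      division by 0.\<close>
    define d where "d = e / (?c + 1)"
    have d: "d > 0" using e c by (simp add: d_def add_nonneg_pos)
    let ?g = "\<lambda>t. max (f t - d) 0" and ?r = "\<lambda>t. min (f t) d"
    have gC0: "?g \<in> C0 X"
      using d by (intro C0_compose[OF f(1), where h = "\<lambda>t. max (t - d) 0"]) (auto intro!: continuous_intros)
    have r: "?r \<in> C0 X"
      using d by (intro C0_compose[OF f(1), where h = "\<lambda>t. min t d"]) (auto intro!: continuous_intros)
    have car: "carried X ?g {t \<in> topspace X. d \<le> \<bar>f t\<bar>}"
      using C0_compact[OF f(1) d] by (auto simp: carried_def max_def)
    have g: "?g \<in> Cc X"
      by (rule CcI[OF hd C0_continuous[OF gC0] C0_outside[OF gC0] car])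
    have split: "f = (\<lambda>t. ?g t + ?r t)" by (auto simp: max_def min_def)
    have "qform (\<pi> f) x = qform (\<pi> ?g) x + qform (\<pi> ?r) x"
      by (subst split) (simp add: \<pi>_add[OF gC0 r])
    moreover have "(\<integral>t. f t \<partial>N x) = (\<integral>t. ?g t \<partial>N x) + (\<integral>t. ?r t \<partial>N x)"
      by (subst split) (rule Bochner_Integration.integral_add[OF integrable_C0[OF gC0] integrable_C0[OF r]])
    ultimately have eq: "qform (\<pi> f) x - (\<integral>t. f t \<partial>N x) = qform (\<pi> ?r) x - (\<integral>t. ?r t \<partial>N x)"
      by (simp add: qform_\<pi>_Cc[OF g])
    have q0: "0 \<le> qform (\<pi> ?r) x" using f(2) d by (intro \<pi>_nonneg r) auto
    have "qform (\<pi> (\<lambda>t. (1/d) * ?r t)) x \<le> C * (norm x)\<^sup>2"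
      using f(2) d by (intro qform_\<pi>_le C0_cmult r) (auto simp: field_simps)
    then have q1: "qform (\<pi> ?r) x \<le> d * (C * (norm x)\<^sup>2)"
      using d unfolding \<pi>_cmult[OF r] by (simp add: field_simps)
    have i0: "0 \<le> (\<integral>t. ?r t \<partial>N x)"
      using f(2) d by (intro Bochner_Integration.integral_nonneg) (auto simp: \<Lambda>.space_N)
    have "(\<integral>t. ?r t \<partial>N x) \<le> (\<integral>t. d \<partial>N x)"
      by (intro integral_mono integrable_C0[OF r]) auto
    then have i1: "(\<integral>t. ?r t \<partial>N x) \<le> d * measure (N x) (topspace X)"
      by (simp add: \<Lambda>.space_N mult.commute)
    have "\<bar>qform (\<pi> f) x - (\<integral>t. f t \<partial>N x)\<bar> \<le> d * (C * (norm x)\<^sup>2) + d * measure (N x) (topspace X)"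
      unfolding eq using q0 q1 i0 i1 by linarith
    also have "\<dots> = d * ?c" by (simp add: algebra_simps)
    also have "\<dots> \<le> e" using e c by (simp add: d_def field_simps)
    finally show ?thesis by simp
  qed
  then have "\<bar>qform (\<pi> f) x - (\<integral>t. f t \<partial>N x)\<bar> \<le> 0" by (rule field_le_epsilon)
  then show ?thesis by simp
qed

lemma qform_\<pi>:
  assumes f: "f \<in> C0 X"
  shows "qform (\<pi> f) x = (\<integral>t. f t \<partial>N x)"
proof -
  have p: "(\<lambda>t. max (f t) 0) \<in> C0 X" and n: "(\<lambda>t. max (- f t) 0) \<in> C0 X"
    by (rule C0_compose[OF f, where h = "\<lambda>t. max t 0"] C0_compose[OF f, where h = "\<lambda>t. max (- t) 0"],
        auto intro!: continuous_intros)+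
  have f_eq: "f = (\<lambda>t. max (f t) 0 - max (- f t) 0)" by (auto simp: max_def)
  have "qform (\<pi> f) x = qform (\<pi> (\<lambda>t. max (f t) 0)) x - qform (\<pi> (\<lambda>t. max (- f t) 0)) x"
    by (subst f_eq) (simp add: \<pi>_diff[OF p n])
  also have "\<dots> = (\<integral>t. max (f t) 0 - max (- f t) 0 \<partial>N x)"
    by (simp add: qform_\<pi>_C0_nonneg[OF p] qform_\<pi>_C0_nonneg[OF n] integrable_C0[OF p] integrable_C0[OF n])
  finally show ?thesis using f_eq by simp
qed

end

section \<open>Regularity and the quadratic forms\<close>

lemma regular_finite_measure_inner:
  assumes N: "regular_finite_measure X N" and V: "openin X V"
    and le: "\<And>K. compactin X K \<Longrightarrow> K \<subseteq> V \<Longrightarrow> measure N K \<le> c"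
  shows "measure N V \<le> c"
proof (rule field_le_epsilon)
  fix e :: real assume "e > 0"
  then have "\<exists>K. compactin X K \<and> K \<subseteq> V \<and> measure N V < measure N K + e"
    using N V unfolding regular_finite_measure_def by simp
  then obtain K where "compactin X K" "K \<subseteq> V" "measure N V < measure N K + e" by auto
  then show "measure N V \<le> c + e" using le[of K] by simp
qed

lemma regular_finite_measure_outer:
  assumes N: "regular_finite_measure X N" and D: "D \<in> sets (borel_of X)"
    and le: "\<And>V. openin X V \<Longrightarrow> D \<subseteq> V \<Longrightarrow> c \<le> measure N V"
  shows "c \<le> measure N D"
proof (rule field_le_epsilon)
  fix e :: real assume "e > 0"
  then have "\<exists>V. openin X V \<and> D \<subseteq> V \<and> measure N V < measure N D + e"
    using N D unfolding regular_finite_measure_def by simp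
  then obtain V where "openin X V" "D \<subseteq> V" "measure N V < measure N D + e" by auto
  then show "c \<le> measure N D + e" using le[of V] by simp
qed

text \<open>Formulated for an arbitrary finite Borel measure, since it is applied to
  \<open>N x\<close> and, in the uniqueness proof, to the scalar measures of a restricted
  competitor.\<close>

lemma measure_le_integral_dominates:
  assumes X: "Hausdorff_space X" and N: "finite_measure N" "sets N = sets (borel_of X)" "integrable N f"
    and K: "compactin X K" and f: "dominates X K f"
  shows "measure N K \<le> (\<integral>t. f t \<partial>N)"
proof -
  interpret finite_measure N by fact
  have Ks: "K \<in> sets N" using K X N(2) by (simp add: borel_of_compact)
  have sp: "space N = topspace X" using sets_eq_imp_space_eq[OF N(2)] by simp
  have "measure N K = (\<integral>t. indicator K t \<partial>N)" using Ks by simp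
  also have "\<dots> \<le> (\<integral>t. f t \<partial>N)"
    using f Ks
    by (intro integral_mono N(3) integrable_real_indicator)
      (auto simp: dominates_def sp indicator_def less_top[symmetric])
  finally show ?thesis .
qed

lemma integral_le_measure_carried:
  assumes X: "Hausdorff_space X" and N: "finite_measure N" "sets N = sets (borel_of X)" "integrable N f"
    and f: "\<And>t. t \<in> topspace X \<Longrightarrow> f t \<le> 1" and K: "carried X f K"
  shows "(\<integral>t. f t \<partial>N) \<le> measure N K"
proof -
  interpret finite_measure N by fact
  have Ks: "K \<in> sets N" using K X N(2) by (simp add: borel_of_compact carried_def)
  have sp: "space N = topspace X" using sets_eq_imp_space_eq[OF N(2)] by simp
  have "(\<integral>t. f t \<partial>N) \<le> (\<integral>t. indicator K t \<partial>N)"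
    using f K Ks
    by (intro integral_mono N(3) integrable_real_indicator)
      (auto simp: carried_def sp indicator_def less_top[symmetric])
  also have "\<dots> = measure N K" using Ks by simp
  finally show ?thesis .
qed

context positive_C0_operator
begin

lemma regular_N: "regular_finite_measure X (N x)"
  by (rule \<Lambda>.regular_N)

lemma finite_measure_N: "finite_measure (N x)"
  by (rule \<Lambda>.N.finite_measure_axioms)

lemma subordinate_C0: "subordinate X f V \<Longrightarrow> f \<in> C0 X"
  and dominates_C0: "dominates X K f \<Longrightarrow> f \<in> C0 X"
  by (auto simp: subordinate_def dominates_def C0_of_Cc)

lemma measure_le_qform:
  assumes "compactin X K" "dominates X K f"
  shows "measure (N x) K \<le> qform (\<pi> f) x"
  using measure_le_integral_dominates[OF hd finite_measure_N \<Lambda>.sets_N \<Lambda>.integrable_Cc assms]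
    assms(2) qform_\<pi>_Cc[of f x] by (simp add: dominates_def)

lemma qform_le_measure:
  assumes V: "openin X V" and f: "subordinate X f V"
  shows "qform (\<pi> f) x \<le> measure (N x) V"
proof -
  have fC: "f \<in> Cc X" using f by (simp add: subordinate_def)
  have "qform (\<pi> f) x \<le> measure (N x) (supp X f)"
    unfolding qform_\<pi>_Cc[OF fC] using f
    by (intro integral_le_measure_carried[OF hd finite_measure_N \<Lambda>.sets_N] \<Lambda>.integrable_Cc fC carried_supp)
      (auto simp: subordinate_def)
  also have "\<dots> \<le> measure (N x) V"
    using f V by (intro finite_measure.finite_measure_mono[OF finite_measure_N])
      (auto simp: subordinate_def \<Lambda>.sets_N borel_of_open)
  finally show ?thesis .
qed

text \<open>Over each compact \<open>K\<close> in \<open>V\<close> Urysohn's lemma puts a function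
  subordinate to \<open>V\<close>, so a bound on the forms bounds all
  \<open>measure (N x) K\<close>, and inner regularity passes to \<open>V\<close>. This is the
  least-upper-bound half of the formula for open sets.\<close>

lemma measure_open_le:
  assumes V: "openin X V" and c: "\<And>f. subordinate X f V \<Longrightarrow> qform (\<pi> f) x \<le> c"
  shows "measure (N x) V \<le> c"
proof (rule regular_finite_measure_inner[OF regular_N V])
  fix K assume K: "compactin X K" "K \<subseteq> V"
  obtain f where "dominates X K f" "subordinate X f V" by (rule Cc_Urysohn[OF lc hd K(1) V K(2)])
  then show "measure (N x) K \<le> c" using measure_le_qform[OF K(1), of f x] c[of f] by simp
qed

text \<open>A common upper bound for all nets: its form \<open>C * (norm x)\<^sup>2\<close> bounds
  both the forms of \<open>\<pi> f\<close> for \<open>f\<close> with values in [0, 1] and the mass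
  of \<open>N x\<close>.\<close>

definition B :: "'h \<Rightarrow>\<^sub>L 'h"
  where "B = C *\<^sub>R id_blinfun"

lemma B_sa: "B \<in> selfadjoint_ops"
  unfolding B_def by (rule subspace_scale[OF subspace_selfadjoint_ops id_selfadjoint])

lemma qform_B: "qform B x = C * (norm x)\<^sup>2"
  by (simp add: B_def qform_id)

definition is_form :: "('h \<Rightarrow>\<^sub>L 'h) \<Rightarrow> 'x set \<Rightarrow> bool"
  where "is_form T D \<longleftrightarrow> T \<in> L \<inter> selfadjoint_ops \<and> (\<forall>x. qform T x = measure (N x) D)"

lemma is_form_unique: "is_form S D \<Longrightarrow> is_form T D \<Longrightarrow> S = T"
  unfolding is_form_def by (intro selfadjoint_ops_eqI) auto

lemma open_form_exists:
  assumes V: "openin X V"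
  shows "\<exists>T. is_form T V \<and> (\<forall>P. closedin SOT P \<longrightarrow> \<pi> ` Cc X \<subseteq> P \<longrightarrow> T \<in> P)"
proof -
  let ?D = "{\<pi> f | f. subordinate X f V}"
  have DL: "?D \<subseteq> L \<inter> selfadjoint_ops" using \<pi>_Lsa subordinate_C0 by blast
  have ne: "?D \<noteq> {}" using \<Lambda>.subordinate_zero by blast
  have dir: "\<exists>U\<in>?D. op_le S U \<and> op_le T U" if "S \<in> ?D" "T \<in> ?D" for S T
  proof -
    obtain f g where fg: "S = \<pi> f" "T = \<pi> g" "subordinate X f V" "subordinate X g V"
      using \<open>S \<in> ?D\<close> \<open>T \<in> ?D\<close> by auto
    let ?h = "\<lambda>t. max (f t) (g t)"
    have fC: "f \<in> Cc X" "g \<in> Cc X" using fg by (auto simp: subordinate_def)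
    have hC: "?h \<in> Cc X" by (rule Cc_max[OF hd fC])
    have car: "carried X ?h (supp X f \<union> supp X g)"
      using carried_supp[OF fC(1)] carried_supp[OF fC(2)] unfolding carried_def
      by (auto intro: compactin_Un simp: max_def split: if_splits)
    have "supp X ?h \<subseteq> supp X f \<union> supp X g" by (rule supp_subset[OF hd car])
    also have "\<dots> \<subseteq> V" using fg(3,4) by (simp add: subordinate_def)
    finally have "supp X ?h \<subseteq> V" .
    then have "subordinate X ?h V"
      using hC fg(3,4) unfolding subordinate_def by (simp add: le_max_iff_disj)
    moreover have "op_le S (\<pi> ?h)" "op_le T (\<pi> ?h)"
      unfolding fg(1,2) by (rule \<pi>_mono; use fC hC in \<open>simp add: C0_of_Cc\<close>)+
    ultimately show ?thesis by blast
  qed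
  have DB: "op_le S B" if "S \<in> ?D" for S
    unfolding op_le_def qform_B using that
    by (auto intro!: qform_\<pi>_le subordinate_C0 simp: subordinate_def)
  obtain T where T: "is_sup (sa_space L) ?D T"
    "\<forall>x c. (\<forall>S\<in>?D. qform S x \<le> c) \<longrightarrow> qform T x \<le> c"
    "\<forall>M. closedin SOT M \<longrightarrow> ?D \<subseteq> M \<longrightarrow> T \<in> M"
    by (rule sot_directed_sup[OF L DL ne dir B_sa DB])
  have up: "qform (\<pi> f) x \<le> qform T x" if "subordinate X f V" for f x
    using T(1) DL that unfolding is_sup_iff by (auto simp: op_le_def)
  have "qform T x = measure (N x) V" for x
  proof (rule antisym)
    show "qform T x \<le> measure (N x) V"
      using qform_le_measure[OF V] by (intro T(2)[rule_format]) auto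
    show "measure (N x) V \<le> qform T x"
      using up by (intro measure_open_le[OF V])
  qed
  moreover have "T \<in> P" if "closedin SOT P" "\<pi> ` Cc X \<subseteq> P" for P
    using that by (intro T(3)[rule_format]) (auto simp: subordinate_def)
  moreover have "T \<in> L \<inter> selfadjoint_ops" using T(1) by (simp add: is_sup_iff)
  ultimately show ?thesis unfolding is_form_def by blast
qed

section \<open>The operators of Borel sets\<close>

definition op :: "'x set \<Rightarrow> 'h \<Rightarrow>\<^sub>L 'h"
  where "op D = (THE T. is_form T D)"

lemma op_eq: "is_form T D \<Longrightarrow> op D = T"
  unfolding op_def by (rule the_equality) (auto intro: is_form_unique)

lemma op_open:
  assumes "openin X V"
  shows "is_form (op V) V" "closedin SOT P \<Longrightarrow> \<pi> ` Cc X \<subseteq> P \<Longrightarrow> op V \<in> P"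
  using open_form_exists[OF assms] op_eq by metis+

text \<open>Existence of the operator and its membership in \<open>P\<close> share one induction,
  because both pass through differences and monotone strong limits; open sets are a generator stable
  under intersections. Taking \<open>P = L\<close> gives existence, other choices of
  \<open>P\<close> compare spans.\<close>

lemma op_Dynkin:
  assumes D: "D \<in> sets (borel_of X)" and P: "sot_subspace P" and op_P: "\<And>V. openin X V \<Longrightarrow> op V \<in> P"
  shows "is_form (op D) D \<and> op D \<in> P"
proof -
  let ?G = "{U. openin X U}"
  have "Int_stable ?G" by (auto simp: Int_stable_def)
  moreover have "?G \<subseteq> Pow (topspace X)" by (auto dest: openin_subset)
  moreover have "D \<in> sigma_sets (topspace X) ?G" using D by (simp add: sets_borel_of)
  ultimately show ?thesis
  proof (induction rule: sigma_sets_induct_disjoint)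
    case (basic A)
    then show ?case using op_open(1) op_P by simp
  next
    case empty
    show ?case using op_open(1)[of "{}"] op_P[of "{}"] by simp
  next
    case (compl A)
    let ?T = "op (topspace X) - op A"
    have X: "is_form (op (topspace X)) (topspace X)" "op (topspace X) \<in> P"
      using op_open(1) op_P by auto
    have "measure (N x) (topspace X - A) = measure (N x) (topspace X) - measure (N x) A" for x
      using finite_measure.finite_measure_compl[OF finite_measure_N, of A x] compl(1)
      by (simp add: \<Lambda>.sets_N \<Lambda>.space_N sets_borel_of)
    moreover have "?T \<in> L \<inter> selfadjoint_ops"
      using X compl subspace_diff[OF sot_subspaceD(2)[OF L]] subspace_diff[OF subspace_selfadjoint_ops]
      by (auto simp: is_form_def)
    ultimately have "is_form ?T (topspace X - A)"
      using X compl by (simp add: is_form_def)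
    moreover have "?T \<in> P" using X compl by (intro subspace_diff sot_subspaceD(2) P) auto
    ultimately show ?case using op_eq by metis
  next
    case (union A)
    let ?S = "\<lambda>n. \<Sum>i<n. op (A i)"
    have A: "is_form (op (A i)) (A i)" "op (A i) \<in> P" for i using union by auto
    have As: "A i \<in> sets (N x)" for i x using union(2) by (auto simp: \<Lambda>.sets_N sets_borel_of)
    have qA: "qform (op (A i)) x = measure (N x) (A i)" for i x using A by (simp add: is_form_def)
    have SL: "?S n \<in> L \<inter> selfadjoint_ops" for n
      using A by (intro IntI subspace_sum sot_subspaceD(2) L subspace_selfadjoint_ops) (auto simp: is_form_def)
    have inc: "incseq (\<lambda>n. qform (?S n) x)" for x
      by (simp add: qform_sum qA incseq_Suc_iff)
    have "(\<lambda>i. measure (N x) (A i)) sums measure (N x) (\<Union>i. A i)" for x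
      using As union(1) by (intro finite_measure.finite_measure_UNION[OF finite_measure_N]) auto
    then have lim: "(\<lambda>n. qform (?S n) x) \<longlonglongrightarrow> measure (N x) (\<Union>i. A i)" for x
      by (simp add: qform_sum qA sums_def)
    \<comment> \<open>The scalar partial sums stay below the total mass of \<open>N x\<close>, so
      the same \<open>B\<close> serves for every disjoint sequence.\<close>
    have "op_le (?S n) B" for n
      unfolding op_le_def
    proof
      fix x
      have "qform (?S n) x \<le> measure (N x) (\<Union>i. A i)" by (rule incseq_le[OF inc lim])
      also have "\<dots> \<le> qform B x" unfolding qform_B by (rule \<Lambda>.measure_N_le)
      finally show "qform (?S n) x \<le> qform B x" .
    qed
    then obtain T where T: "is_sup (sa_space L) (range ?S) T" "\<forall>x. (\<lambda>n. qform (?S n) x) \<longlonglongrightarrow> qform T x"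
      "\<forall>M. closedin SOT M \<longrightarrow> range ?S \<subseteq> M \<longrightarrow> T \<in> M"
      by (rule sot_incseq_sup[OF L SL inc B_sa])
    have "qform T x = measure (N x) (\<Union>i. A i)" for x
      using LIMSEQ_unique[OF _ lim] T(2) by blast
    then have "is_form T (\<Union>i. A i)" using T(1) by (simp add: is_form_def is_sup_iff)
    moreover have "range ?S \<subseteq> P"
      using A by (auto intro!: subspace_sum sot_subspaceD(2) P)
    then have "T \<in> P" using T(3) sot_subspaceD(1)[OF P] by blast
    ultimately show ?case using op_eq by metis
  qed
qed

lemma op_form: "D \<in> sets (borel_of X) \<Longrightarrow> is_form (op D) D"
  using op_Dynkin[OF _ L] op_open(1) by (auto simp: is_form_def)

lemma op_Lsa: "D \<in> sets (borel_of X) \<Longrightarrow> op D \<in> L \<inter> selfadjoint_ops"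
  and qform_op: "D \<in> sets (borel_of X) \<Longrightarrow> qform (op D) x = measure (N x) D"
  using op_form by (auto simp: is_form_def)

section \<open>The operator-valued measure and its regularity\<close>

definition \<mu> :: "'x set \<Rightarrow> ('h \<Rightarrow>\<^sub>L 'h) extd"
  where "\<mu> D = Fin (op D)"

lemma the_fin_\<mu> [simp]: "the_fin (\<mu> D) = op D"
  by (simp add: \<mu>_def)

lemma op_cone: "D \<in> sets (borel_of X) \<Longrightarrow> op D \<in> pos_cone (sa_space L)"
  using op_Lsa by (auto simp: pos_cone_sa_space qform_op)

lemma finite_positive_measure_\<mu>: "finite_positive_measure (sa_space L) (borel_of X) \<mu>"
  unfolding finite_positive_measure_def positive_measure_def
proof (intro conjI allI impI)
  show "\<mu> ` sets (borel_of X) \<subseteq> ext_pos_cone (sa_space L)"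
    using op_cone by (auto simp: \<mu>_def ext_pos_cone_def)
  show "\<mu> (space (borel_of X)) \<in> Fin ` pos_cone (sa_space L)"
    using op_cone[of "topspace X"] by (auto simp: \<mu>_def borel_of_open)
  have "is_form 0 {}"
    using subspace_0[OF sot_subspaceD(2)[OF L]] subspace_0[OF subspace_selfadjoint_ops] by (simp add: is_form_def)
  then show "\<mu> {} = 0" by (simp add: \<mu>_def op_eq zero_extd_def)
  fix D :: "nat \<Rightarrow> 'x set" assume D: "range D \<subseteq> sets (borel_of X)" "disjoint_family D"
  let ?S = "\<lambda>k. \<Sum>n\<le>k. op (D n)"
  have Ds: "D n \<in> sets (borel_of X)" for n using D(1) by auto
  have eq: "(\<lambda>N. \<Sum>n\<le>N. \<mu> (D n)) = (\<lambda>N. Fin (?S N))" by (simp add: sum_Fin \<mu>_def)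
  have r: "range (\<lambda>N. \<Sum>n\<le>N. \<mu> (D n)) = Fin ` range ?S"
    unfolding image_image by (rule arg_cong[where f = range, OF eq])
  have SL: "?S k \<in> L \<inter> selfadjoint_ops" for k
    using op_Lsa[OF Ds] by (intro IntI subspace_sum sot_subspaceD(2) L subspace_selfadjoint_ops) auto
  have inc: "incseq (\<lambda>n. qform (?S n) x)" for x
    by (simp add: qform_sum qform_op[OF Ds] incseq_Suc_iff)
  have "(\<lambda>i. measure (N x) (D i)) sums measure (N x) (\<Union>i. D i)" for x
    using Ds D(2) by (intro finite_measure.finite_measure_UNION[OF finite_measure_N]) (auto simp: \<Lambda>.sets_N)
  then have lim: "(\<lambda>n. qform (?S n) x) \<longlonglongrightarrow> qform (op (\<Union>i. D i)) x" for x
    using Ds by (simp add: qform_sum qform_op sums_def_le)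
  have sub: "range ?S \<subseteq> carrier (sa_space L)" using SL by auto
  have "op (\<Union>i. D i) \<in> L \<inter> selfadjoint_ops" using Ds by (intro op_Lsa) auto
  then show "is_sup (extended (sa_space L)) (range (\<lambda>N. \<Sum>n\<le>N. \<mu> (D n))) (\<mu> (\<Union>n. D n))"
    unfolding r \<mu>_def[of "\<Union>n. D n"] is_sup_Fin(1)[OF sub] sot_incseq_sup_iff[OF L SL inc] using lim by blast
qed

sublocale M: operator_measure L "borel_of X" \<mu>
  by unfold_locales (rule L finite_positive_measure_\<mu>)+

lemma M_m [simp]: "M.m D = op D"
  by (simp add: M.m_def)

text \<open>Identifies the scalar measures derived from \<open>\<mu>\<close> with the Riesz measures
  it was built from, so that the integral formulas of the general theory speak about
  \<open>\<pi>\<close>.\<close>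

lemma M_N: "M.N x = N x"
proof (rule measure_eqI)
  fix D assume "D \<in> sets (M.N x)"
  then have "D \<in> sets (borel_of X)" by simp
  then show "emeasure (M.N x) D = emeasure (N x) D"
    by (simp add: M.emeasure_N qform_op finite_measure.emeasure_eq_measure[OF finite_measure_N])
qed (simp add: \<Lambda>.sets_N)

lemma op_mono: "D \<in> sets (borel_of X) \<Longrightarrow> E \<in> sets (borel_of X) \<Longrightarrow> D \<subseteq> E \<Longrightarrow> op_le (op D) (op E)"
  using M.m_mono by simp

text \<open>Whether \<open>u\<close> lies above or below an operator is tested vector by vector, and
  for each vector the regularity of \<open>N x\<close> applies; the approximating compact or open
  sets may differ from vector to vector.\<close>

lemma regular_\<mu>: "regular_borel_measure (sa_space L) X \<mu>"
  unfolding regular_borel_measure_def borel_measure_def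
proof (intro conjI allI impI ballI)
  show "positive_measure (sa_space L) (borel_of X) \<mu>"
    using finite_positive_measure_\<mu> by (simp add: finite_positive_measure_def)
  show "\<mu> K \<in> Fin ` carrier (sa_space L)" if "compactin X K" for K
    using op_Lsa[OF borel_of_compact[OF hd that]] by (auto simp: \<mu>_def)
next
  fix V assume V: "openin X V"
  let ?A = "{op K | K. compactin X K \<and> K \<subseteq> V}"
  have sub: "?A \<subseteq> carrier (sa_space L)" using op_Lsa[OF borel_of_compact[OF hd]] by auto
  have eq: "{\<mu> K | K. compactin X K \<and> K \<subseteq> V} = Fin ` ?A" by (auto simp: \<mu>_def)
  have "is_sup (sa_space L) ?A (op V)"
    unfolding is_sup_iff
  proof (intro conjI ballI impI)
    show "op V \<in> carrier (sa_space L)" using op_Lsa[OF borel_of_open[OF V]] by simp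
    show "le (sa_space L) a (op V)" if "a \<in> ?A \<inter> carrier (sa_space L)" for a
      using that by (auto intro!: op_mono borel_of_open[OF V] borel_of_compact[OF hd])
    fix u assume u: "\<forall>a\<in>?A \<inter> carrier (sa_space L). le (sa_space L) a u"
    have uK: "measure (N x) K \<le> qform u x" if K: "compactin X K" "K \<subseteq> V" for K x
    proof -
      have "op K \<in> ?A \<inter> carrier (sa_space L)" using K sub by blast
      from bspec[OF u this] have "op_le (op K) u" by simp
      then show ?thesis using qform_op[OF borel_of_compact[OF hd K(1)]] by (auto simp: op_le_def)
    qed
    show "le (sa_space L) (op V) u"
      using regular_finite_measure_inner[OF regular_N V uK] by (simp add: op_le_def qform_op borel_of_open V)
  qed
  then show "inner_regular_at (sa_space L) X \<mu> V"
    unfolding inner_regular_at_def eq \<mu>_def[of V] is_sup_Fin(1)[OF sub] .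
next
  fix D assume D: "D \<in> sets (borel_of X)"
  let ?A = "{op V | V. openin X V \<and> D \<subseteq> V}"
  have sub: "?A \<subseteq> carrier (sa_space L)" using op_Lsa[OF borel_of_open] by auto
  have "D \<subseteq> topspace X" using sets.sets_into_space[OF D] by simp
  then have ne: "?A \<noteq> {}" using openin_topspace by blast
  have eq: "{\<mu> V | V. openin X V \<and> D \<subseteq> V} = Fin ` ?A" by (auto simp: \<mu>_def)
  have "is_inf (sa_space L) ?A (op D)"
    unfolding is_inf_iff
  proof (intro conjI ballI impI)
    show "op D \<in> carrier (sa_space L)" using op_Lsa[OF D] by simp
    show "le (sa_space L) (op D) a" if "a \<in> ?A \<inter> carrier (sa_space L)" for a
      using that by (auto intro!: op_mono borel_of_open D)
    fix u assume u: "\<forall>a\<in>?A \<inter> carrier (sa_space L). le (sa_space L) u a"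
    have uV: "qform u x \<le> measure (N x) V" if V: "openin X V" "D \<subseteq> V" for V x
    proof -
      have "op V \<in> ?A \<inter> carrier (sa_space L)" using V sub by blast
      from bspec[OF u this] have "op_le u (op V)" by simp
      then show ?thesis using qform_op[OF borel_of_open[OF V(1)]] by (auto simp: op_le_def)
    qed
    show "le (sa_space L) u (op D)"
      using regular_finite_measure_outer[OF regular_N D uV] by (simp add: op_le_def qform_op D)
  qed
  then show "outer_regular_at (sa_space L) X \<mu> D"
    unfolding outer_regular_at_def eq \<mu>_def[of D] is_inf_Fin[OF sub ne] .
qed

lemma op_open_sup:
  assumes V: "openin X V"
  shows "is_sup (sa_space L) {\<pi> f | f. subordinate X f V} (op V)"
  unfolding is_sup_iff
proof (intro conjI ballI impI)
  show "op V \<in> carrier (sa_space L)" using op_Lsa[OF borel_of_open[OF V]] by simp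
  show "le (sa_space L) a (op V)" if "a \<in> {\<pi> f | f. subordinate X f V} \<inter> carrier (sa_space L)" for a
    using that by (auto simp: op_le_def qform_op borel_of_open V qform_le_measure)
  fix u assume u: "\<forall>a\<in>{\<pi> f | f. subordinate X f V} \<inter> carrier (sa_space L). le (sa_space L) a u"
  have "qform (\<pi> f) x \<le> qform u x" if f: "subordinate X f V" for f x
  proof -
    have "op_le (\<pi> f) u" using u f \<pi>_Lsa[OF subordinate_C0[OF f]] by auto
    then show ?thesis by (simp add: op_le_def)
  qed
  then show "le (sa_space L) (op V) u"
    by (auto simp: op_le_def qform_op borel_of_open V intro: measure_open_le[OF V])
qed

text \<open>A lower bound \<open>u\<close> lies below each \<open>\<pi> f\<close> that Urysohn's
  lemma inserts between \<open>K\<close> and an open \<open>V\<close>, hence below the measure of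
  every such \<open>V\<close>; outer regularity brings it down to \<open>K\<close>.\<close>

lemma op_compact_inf:
  assumes K: "compactin X K"
  shows "is_inf (sa_space L) {\<pi> f | f. dominates X K f} (op K)"
  unfolding is_inf_iff
proof (intro conjI ballI impI)
  have Ks: "K \<in> sets (borel_of X)" by (rule borel_of_compact[OF hd K])
  show "op K \<in> carrier (sa_space L)" using op_Lsa[OF Ks] by simp
  show "le (sa_space L) (op K) a" if "a \<in> {\<pi> f | f. dominates X K f} \<inter> carrier (sa_space L)" for a
    using that by (auto simp: op_le_def qform_op Ks measure_le_qform K)
  fix u assume u: "\<forall>a\<in>{\<pi> f | f. dominates X K f} \<inter> carrier (sa_space L). le (sa_space L) u a"
  have uf: "qform u x \<le> qform (\<pi> f) x" if f: "dominates X K f" for f x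
  proof -
    have "op_le u (\<pi> f)" using u f \<pi>_Lsa[OF dominates_C0[OF f]] by auto
    then show ?thesis by (simp add: op_le_def)
  qed
  have "qform u x \<le> measure (N x) K" for x
  proof (rule regular_finite_measure_outer[OF regular_N Ks])
    fix V assume V: "openin X V" "K \<subseteq> V"
    obtain f where "dominates X K f" "subordinate X f V" by (rule Cc_Urysohn[OF lc hd K V])
    then show "qform u x \<le> measure (N x) V"
      using uf[of f x] qform_le_measure[OF V(1), of f x] by simp
  qed
  then show "le (sa_space L) u (op K)" by (simp add: op_le_def qform_op Ks)
qed

section \<open>Integrals and scalar measures of the constructed measure\<close>

lemma C0_L1: "C0 X \<subseteq> L1 (sa_space L) (borel_of X) \<mu>"
proof
  fix f assume f: "f \<in> C0 X"
  obtain c where "\<And>t. \<bar>f t\<bar> \<le> c" using C0_bounded[OF f] by auto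
  then show "f \<in> L1 (sa_space L) (borel_of X) \<mu>"
    by (intro M.L1_bounded[OF C0_measurable[OF f]])
qed

lemma bounded_borel_L1: "bounded_borel X \<subseteq> L1 (sa_space L) (borel_of X) \<mu>"
proof
  fix f assume f: "f \<in> bounded_borel X"
  then obtain c where "\<And>t. t \<in> topspace X \<Longrightarrow> \<bar>f t\<bar> \<le> c"
    by (auto simp: bounded_borel_def bounded_iff)
  then show "f \<in> L1 (sa_space L) (borel_of X) \<mu>"
    using f by (intro M.L1_bounded[of f c]) (auto simp: bounded_borel_def)
qed

lemma order_integral_C0: "f \<in> C0 X \<Longrightarrow> order_integral (sa_space L) (borel_of X) \<mu> f = \<pi> f"
  using C0_L1 by (intro M.order_integral_eqI) (auto simp: \<pi>_sa M_N qform_\<pi>)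

lemma regular_scalar_measure: "regular_borel_measure real_space X (\<lambda>D. Fin (scalar_measure \<mu> x D))"
proof -
  have sm: "scalar_measure \<mu> x D = measure (N x) D" if "D \<in> sets (borel_of X)" for D
    using that by (simp add: M.scalar_measure_eq qform_op)
  have [simp]: "carrier real_space = UNIV" "le real_space = (\<le>)" by (simp_all add: real_space_def)
  have cone: "a \<in> pos_cone real_space \<longleftrightarrow> 0 \<le> a" for a by (simp add: pos_cone_def)
  show ?thesis
    unfolding regular_borel_measure_def borel_measure_def positive_measure_def
  proof (intro conjI allI impI ballI)
    show "(\<lambda>D. Fin (scalar_measure \<mu> x D)) ` sets (borel_of X) \<subseteq> ext_pos_cone real_space"
      by (auto simp: ext_pos_cone_def cone sm)
    show "Fin (scalar_measure \<mu> x {}) = 0" by (simp add: sm zero_extd_def)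
    show "Fin (scalar_measure \<mu> x K) \<in> Fin ` carrier real_space" for K by simp
    fix D :: "nat \<Rightarrow> 'x set" assume D: "range D \<subseteq> sets (borel_of X)" "disjoint_family D"
    let ?S = "\<lambda>k. \<Sum>n\<le>k. measure (N x) (D n)"
    have Ds: "D n \<in> sets (borel_of X)" for n using D(1) by auto
    have eq: "(\<lambda>N. \<Sum>n\<le>N. Fin (scalar_measure \<mu> x (D n))) = (\<lambda>k. Fin (?S k))"
      by (simp add: sum_Fin sm[OF Ds])
    have r: "range (\<lambda>N. \<Sum>n\<le>N. Fin (scalar_measure \<mu> x (D n))) = Fin ` range ?S"
      unfolding image_image by (rule arg_cong[where f = range, OF eq])
    have "(\<lambda>i. measure (N x) (D i)) sums measure (N x) (\<Union>i. D i)"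
      using Ds D(2) by (intro finite_measure.finite_measure_UNION[OF finite_measure_N]) (auto simp: \<Lambda>.sets_N)
    then have lim: "?S \<longlonglongrightarrow> measure (N x) (\<Union>i. D i)" by (simp add: sums_def_le)
    have inc: "incseq ?S" by (simp add: incseq_Suc_iff)
    have "scalar_measure \<mu> x (\<Union>n. D n) = measure (N x) (\<Union>n. D n)" using Ds by (intro sm) auto
    moreover have "is_sup real_space (range ?S) (measure (N x) (\<Union>i. D i))"
      unfolding is_sup_iff using incseq_le[OF inc lim] by (auto intro: LIMSEQ_le_const2[OF lim])
    ultimately show "is_sup (extended real_space) (range (\<lambda>N. \<Sum>n\<le>N. Fin (scalar_measure \<mu> x (D n))))
        (Fin (scalar_measure \<mu> x (\<Union>n. D n)))"
      unfolding r by (subst is_sup_Fin(1)) auto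
  next
    fix V assume V: "openin X V"
    let ?A = "{measure (N x) K | K. compactin X K \<and> K \<subseteq> V}"
    have eq: "{Fin (scalar_measure \<mu> x K) | K. compactin X K \<and> K \<subseteq> V} = Fin ` ?A"
      unfolding setcompr_eq_image image_image using sm[OF borel_of_compact[OF hd]] by (intro image_cong) auto
    have "is_sup real_space ?A (measure (N x) V)"
      unfolding is_sup_iff
      using regular_finite_measure_inner[OF regular_N V]
      by (auto intro!: finite_measure.finite_measure_mono[OF finite_measure_N] simp: \<Lambda>.sets_N borel_of_open V) blast
    then show "inner_regular_at real_space X (\<lambda>D. Fin (scalar_measure \<mu> x D)) V"
      unfolding inner_regular_at_def eq sm[OF borel_of_open[OF V]] by (subst is_sup_Fin(1)) auto
  next
    fix D assume D: "D \<in> sets (borel_of X)"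
    let ?A = "{measure (N x) V | V. openin X V \<and> D \<subseteq> V}"
    have "D \<subseteq> topspace X" using sets.sets_into_space[OF D] by simp
    then have ne: "?A \<noteq> {}" using openin_topspace by blast
    have eq: "{Fin (scalar_measure \<mu> x V) | V. openin X V \<and> D \<subseteq> V} = Fin ` ?A"
      unfolding setcompr_eq_image image_image using sm[OF borel_of_open] by (intro image_cong) auto
    have "is_inf real_space ?A (measure (N x) D)"
      unfolding is_inf_iff
      using regular_finite_measure_outer[OF regular_N D]
      by (auto intro!: finite_measure.finite_measure_mono[OF finite_measure_N] simp: \<Lambda>.sets_N borel_of_open) blast
    then show "outer_regular_at real_space X (\<lambda>D. Fin (scalar_measure \<mu> x D)) D"
      unfolding outer_regular_at_def eq sm[OF D] using ne by (subst is_inf_Fin) auto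
  qed
qed

end

section \<open>Uniqueness\<close>

lemma scale_extd_zero [simp]: "scale_extd 0 a = 0"
  by (cases a) (simp_all add: zero_extd_def)

text \<open>Only the level set for \<open>r = 0\<close> can reach outside \<open>K\<close>, and its
  weight 0 cancels even the value \<open>Infty\<close>. This matters because \<open>\<nu>\<close>
  may be infinite off \<open>K\<close>.\<close>

lemma elementary_integral_restrict:
  assumes "\<And>t. t \<in> space M \<Longrightarrow> t \<notin> K \<Longrightarrow> \<phi> t = 0"
  shows "elementary_integral M \<nu> \<phi> = elementary_integral M (\<lambda>D. \<nu> (D \<inter> K)) \<phi>"
  unfolding elementary_integral_def
proof (rule sum.cong)
  fix r
  show "scale_extd r (\<nu> (\<phi> -` {r} \<inter> space M)) = scale_extd r (\<nu> (\<phi> -` {r} \<inter> space M \<inter> K))"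
  proof (cases "r = 0")
    case False
    then have "\<phi> -` {r} \<inter> space M \<inter> K = \<phi> -` {r} \<inter> space M" using assms by auto
    then show ?thesis by simp
  qed simp
qed simp

text \<open>Off \<open>K\<close> an approximating sequence is nonnegative and increases to 0, hence
  is 0 throughout. The descriptions under the two \<open>THE\<close> operators are therefore
  equivalent, whether or not they have a solution.\<close>

lemma order_integral_pos_restrict:
  assumes f: "\<And>t. t \<in> space M \<Longrightarrow> t \<notin> K \<Longrightarrow> f t = 0"
  shows "order_integral_pos F M \<nu> f = order_integral_pos F M (\<lambda>D. \<nu> (D \<inter> K)) f"
proof -
  have "elementary_integral M \<nu> (\<phi> n) = elementary_integral M (\<lambda>D. \<nu> (D \<inter> K)) (\<phi> n)"
    if el: "\<forall>n. elementary M (\<phi> n)"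
      and ap: "\<forall>x\<in>space M. incseq (\<lambda>n. \<phi> n x) \<and> (\<lambda>n. ennreal (\<phi> n x)) \<longlonglongrightarrow> f x" for \<phi> :: "nat \<Rightarrow> _ \<Rightarrow> real" and n
  proof (rule elementary_integral_restrict)
    fix t assume t: "t \<in> space M" "t \<notin> K"
    have "incseq (\<lambda>n. ennreal (\<phi> n t))" "(\<lambda>n. ennreal (\<phi> n t)) \<longlonglongrightarrow> 0"
      using ap t f[OF t] by (auto simp: incseq_def ennreal_leI)
    then have "ennreal (\<phi> n t) \<le> 0" by (rule incseq_le)
    then show "\<phi> n t = 0" using el t(1) by (auto simp: elementary_def ennreal_eq_0_iff intro: antisym)
  qed
  then show ?thesis
    unfolding order_integral_pos_def by (intro arg_cong[where f = The] ext ex_cong1) (simp cong: conj_cong)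
qed

lemma order_integral_restrict:
  assumes "\<And>t. t \<in> space M \<Longrightarrow> t \<notin> K \<Longrightarrow> f t = 0"
  shows "order_integral F M \<nu> f = order_integral F M (\<lambda>D. \<nu> (D \<inter> K)) f"
  unfolding order_integral_def using assms
  by (subst (1 2) order_integral_pos_restrict[where K = K]) auto

text \<open>A competing measure may be infinite on the whole space, but a Borel measure is finite on
  compact sets, so cutting it down to one gives access to the theory of finite measures.\<close>

lemma restrict_finite_positive_measure:
  assumes \<nu>: "positive_measure F M \<nu>" and K: "K \<in> sets M" "\<nu> K \<in> Fin ` carrier F"
  shows "finite_positive_measure F M (\<lambda>D. \<nu> (D \<inter> K))"
proof -
  have sp: "space M \<inter> K = K" using sets.sets_into_space[OF K(1)] by auto
  have cone: "\<nu> ` sets M \<subseteq> ext_pos_cone F" using \<nu> by (simp add: positive_measure_def)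
  have "\<nu> K \<in> Fin ` pos_cone F"
    using cone K by (force simp: ext_pos_cone_def)
  moreover have "positive_measure F M (\<lambda>D. \<nu> (D \<inter> K))"
    unfolding positive_measure_def
  proof (intro conjI allI impI)
    show "(\<lambda>D. \<nu> (D \<inter> K)) ` sets M \<subseteq> ext_pos_cone F" using cone K(1) by auto
    show "\<nu> ({} \<inter> K) = 0" using \<nu> by (simp add: positive_measure_def)
    fix D :: "nat \<Rightarrow> 'b set" assume D: "range D \<subseteq> sets M" "disjoint_family D"
    have "range (\<lambda>n. D n \<inter> K) \<subseteq> sets M" "disjoint_family (\<lambda>n. D n \<inter> K)"
      using D K(1) by (auto simp: disjoint_family_on_def)
    then have "is_sup (extended F) (range (\<lambda>N. \<Sum>n\<le>N. \<nu> (D n \<inter> K))) (\<nu> (\<Union>n. D n \<inter> K))"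
      using \<nu> unfolding positive_measure_def by blast
    then show "is_sup (extended F) (range (\<lambda>N. \<Sum>n\<le>N. \<nu> (D n \<inter> K))) (\<nu> ((\<Union>n. D n) \<inter> K))"
      by simp
  qed
  ultimately show ?thesis by (simp add: finite_positive_measure_def sp)
qed

context positive_C0_operator
begin

context
  fixes \<nu> :: "'x set \<Rightarrow> ('h \<Rightarrow>\<^sub>L 'h) extd"
  assumes \<nu>: "regular_borel_measure (sa_space L) X \<nu>"
    and \<pi>_\<nu>: "\<And>f. f \<in> Cc X \<Longrightarrow> \<pi> f = order_integral (sa_space L) (borel_of X) \<nu> f"
begin

lemma restricted_operator_measure:
  assumes K: "compactin X K"
  shows "operator_measure L (borel_of X) (\<lambda>D. \<nu> (D \<inter> K))"
proof
  show "finite_positive_measure (sa_space L) (borel_of X) (\<lambda>D. \<nu> (D \<inter> K))"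
    using \<nu> K by (intro restrict_finite_positive_measure borel_of_compact hd)
      (auto simp: regular_borel_measure_def borel_measure_def)
qed (rule L)

text \<open>Restriction to the carrier \<open>S\<close> leaves the integral of \<open>f\<close>
  unchanged and makes the measure finite, so that both bounds are read off from scalar integrals,
  one vector at a time.\<close>

lemma Cc_restricted_bounds:
  assumes f: "f \<in> Cc X" "\<And>t. t \<in> topspace X \<Longrightarrow> 0 \<le> f t \<and> f t \<le> 1" and S: "carried X f S"
  shows "le_extd op_le (Fin (\<pi> f)) (\<nu> S)"
    and "compactin X K \<Longrightarrow> K \<subseteq> S \<Longrightarrow> (\<And>t. t \<in> K \<Longrightarrow> f t = 1) \<Longrightarrow> le_extd op_le (\<nu> K) (Fin (\<pi> f))"
proof -
  have Sc: "compactin X S" using S by (simp add: carried_def)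
  interpret R: operator_measure L "borel_of X" "\<lambda>D. \<nu> (D \<inter> S)"
    by (rule restricted_operator_measure[OF Sc])
  have fL1: "f \<in> L1 (sa_space L) (borel_of X) (\<lambda>D. \<nu> (D \<inter> S))"
    using f by (intro R.L1_bounded[of f 1] Cc_measurable) (auto simp: abs_le_iff dest: order_trans[of 0])
  have "\<pi> f = order_integral (sa_space L) (borel_of X) (\<lambda>D. \<nu> (D \<inter> S)) f"
    unfolding \<pi>_\<nu>[OF f(1)] using S by (intro order_integral_restrict) (auto simp: carried_def)
  then have q: "qform (\<pi> f) x = (\<integral>t. f t \<partial>R.N x)" for x
    using R.L1_order_integral(3)[OF fL1] by simp
  have int: "integrable (R.N x) f" for x by (rule R.L1_order_integral(2)[OF fL1])
  have "qform (\<pi> f) x \<le> qform (R.m S) x" for x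
    using integral_le_measure_carried[OF hd R.finite_measure_N R.sets_N int _ S] f(2)
    by (simp add: q R.measure_N borel_of_compact hd Sc)
  moreover have "\<nu> S = Fin (R.m S)"
    using R.\<mu>_eq[OF borel_of_compact[OF hd Sc]] by simp
  ultimately show "le_extd op_le (Fin (\<pi> f)) (\<nu> S)" by (simp add: op_le_def)
  assume K: "compactin X K" "K \<subseteq> S" and K1: "\<And>t. t \<in> K \<Longrightarrow> f t = 1"
  have "dominates X K f" using f K1 by (simp add: dominates_def)
  then have "qform (R.m K) x \<le> qform (\<pi> f) x" for x
    using measure_le_integral_dominates[OF hd R.finite_measure_N R.sets_N int K(1), of x]
    by (simp add: q R.measure_N borel_of_compact hd K(1))
  moreover have "K \<inter> S = K" using K(2) by auto
  then have "\<nu> K = Fin (R.m K)"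
    using R.\<mu>_eq[OF borel_of_compact[OF hd K(1)]] by simp
  ultimately show "le_extd op_le (\<nu> K) (Fin (\<pi> f))" by (simp add: op_le_def)
qed

lemma \<nu>_carrier: "D \<in> sets (borel_of X) \<Longrightarrow> \<nu> D \<in> carrier (extended (sa_space L))"
proof -
  have "\<nu> ` sets (borel_of X) \<subseteq> ext_pos_cone (sa_space L)"
    using \<nu> by (simp add: regular_borel_measure_def borel_measure_def positive_measure_def)
  also have "\<dots> \<subseteq> carrier (extended (sa_space L))"
    by (auto simp: ext_pos_cone_def pos_cone_sa_space)
  finally show "D \<in> sets (borel_of X) \<Longrightarrow> \<nu> D \<in> carrier (extended (sa_space L))" by blast
qed

lemma le_extended_trans:
  "le_extd op_le a b \<Longrightarrow> le_extd op_le b c \<Longrightarrow> le_extd op_le a c"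
  by (cases a; cases b; cases c) (auto intro: op_le_trans)

text \<open>Urysohn's lemma puts some \<open>\<pi> f\<close> above each \<open>\<nu> K\<close>, and
  each \<open>\<pi> f\<close> lies below \<open>\<nu> (supp X f)\<close>, so the two families have
  the same upper bounds and inner regularity applies. The extended space is used because
  \<open>\<nu> V\<close> is not yet known to be finite.\<close>

lemma \<nu>_open_sup:
  assumes V: "openin X V"
  shows "is_sup (extended (sa_space L)) (Fin ` {\<pi> f | f. subordinate X f V}) (\<nu> V)"
proof -
  let ?F = "extended (sa_space L)"
  have sup: "is_sup ?F {\<nu> K | K. compactin X K \<and> K \<subseteq> V} (\<nu> V)"
    using \<nu> V by (auto simp: regular_borel_measure_def inner_regular_at_def)
  have le_V: "le_extd op_le (\<nu> K) (\<nu> V)" if "compactin X K" "K \<subseteq> V" for K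
    using sup that \<nu>_carrier[OF borel_of_compact[OF hd that(1)]] unfolding is_sup_iff extended_simps le_sa_space by blast
  show ?thesis
    unfolding is_sup_iff
  proof (intro conjI ballI impI)
    show "\<nu> V \<in> carrier ?F" by (rule \<nu>_carrier[OF borel_of_open[OF V]])
    fix a assume "a \<in> Fin ` {\<pi> f | f. subordinate X f V} \<inter> carrier ?F"
    then obtain f where f: "a = Fin (\<pi> f)" "subordinate X f V" by auto
    then have "le_extd op_le (Fin (\<pi> f)) (\<nu> (supp X f))"
      by (intro Cc_restricted_bounds(1) carried_supp) (auto simp: subordinate_def)
    moreover have "le_extd op_le (\<nu> (supp X f)) (\<nu> V)"
      using f by (intro le_V) (auto simp: subordinate_def compactin_supp)
    ultimately show "le ?F a (\<nu> V)" unfolding f(1) extended_simps le_sa_space by (rule le_extended_trans)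
  next
    fix u assume u: "u \<in> carrier ?F" "\<forall>a\<in>Fin ` {\<pi> f | f. subordinate X f V} \<inter> carrier ?F. le ?F a u"
    have "le ?F (\<nu> K) u" if K: "compactin X K" "K \<subseteq> V" for K
    proof -
      obtain f where f: "dominates X K f" "subordinate X f V" by (rule Cc_Urysohn[OF lc hd K(1) V K(2)])
      \<comment> \<open>The support of \<open>f\<close> is the compact set to which
        \<open>\<nu>\<close> is restricted, and the lower bound is available only for compact
        subsets of it.\<close>
      have "K \<subseteq> supp X f"
        using f(1) compactin_subset_topspace[OF K(1)] by (force simp: dominates_def intro: supp_nonzero)
      then have "le_extd op_le (\<nu> K) (Fin (\<pi> f))"
        using f by (intro Cc_restricted_bounds(2)[where S = "supp X f"] carried_supp K(1))
          (auto simp: subordinate_def dominates_def)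
      moreover have "Fin (\<pi> f) \<in> Fin ` {\<pi> f | f. subordinate X f V} \<inter> carrier ?F"
        using f(2) \<pi>_Lsa[OF subordinate_C0[OF f(2)]] by auto
      from bspec[OF u(2) this] have "le_extd op_le (Fin (\<pi> f)) u" by simp
      ultimately show ?thesis unfolding extended_simps le_sa_space by (rule le_extended_trans)
    qed
    then show "le ?F (\<nu> V) u" using sup u(1) unfolding is_sup_iff by blast
  qed
qed

end

text \<open>The family in \<open>\<nu>_open_sup\<close> does not involve \<open>\<nu>\<close>, and
  \<open>\<mu>\<close> itself is a regular measure representing \<open>\<pi>\<close>; so both agree
  on open sets, and outer regularity extends this to all Borel sets.\<close>

lemma regular_unique:
  assumes \<nu>: "regular_borel_measure (sa_space L) X \<nu>"
    and \<pi>_\<nu>: "\<And>f. f \<in> Cc X \<Longrightarrow> \<pi> f = order_integral (sa_space L) (borel_of X) \<nu> f"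
    and D: "D \<in> sets (borel_of X)"
  shows "\<nu> D = \<mu> D"
proof -
  have opn: "\<nu> V = \<mu> V" if V: "openin X V" for V
  proof (rule is_sup_unique)
    show "is_sup (extended (sa_space L)) (Fin ` {\<pi> f | f. subordinate X f V}) (\<nu> V)"
      by (rule \<nu>_open_sup[OF \<nu> \<pi>_\<nu> V])
    show "is_sup (extended (sa_space L)) (Fin ` {\<pi> f | f. subordinate X f V}) (\<mu> V)"
      by (rule \<nu>_open_sup[OF regular_\<mu> _ V]) (simp add: order_integral_C0 C0_of_Cc)
  qed (rule extended_sa_antisym)
  have eq: "{\<nu> V | V. openin X V \<and> D \<subseteq> V} = {\<mu> V | V. openin X V \<and> D \<subseteq> V}"
    unfolding setcompr_eq_image using opn by (intro image_cong) auto
  show ?thesis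
  proof (rule is_inf_unique)
    show "is_inf (extended (sa_space L)) {\<mu> V | V. openin X V \<and> D \<subseteq> V} (\<nu> D)"
      using \<nu> D unfolding eq[symmetric] by (simp add: regular_borel_measure_def outer_regular_at_def)
    show "is_inf (extended (sa_space L)) {\<mu> V | V. openin X V \<and> D \<subseteq> V} (\<mu> D)"
      using regular_\<mu> D by (simp add: regular_borel_measure_def outer_regular_at_def)
  qed (rule extended_sa_antisym)
qed

section \<open>Strongly closed subspaces\<close>

lemma op_in_if_\<pi>:
  assumes "sot_subspace P" "\<pi> ` Cc X \<subseteq> P" "D \<in> sets (borel_of X)"
  shows "op D \<in> P"
  using op_Dynkin[OF assms(3,1)] op_open(2)[OF _ sot_subspaceD(1)[OF assms(1)] assms(2)] by blast

lemma op_in_if_open: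
  assumes "sot_subspace P" "\<And>V. openin X V \<Longrightarrow> op V \<in> P" "D \<in> sets (borel_of X)"
  shows "op D \<in> P"
  using op_Dynkin[OF assms(3,1,2)] by blast

text \<open>Inner regularity gives \<open>op V\<close> only as an order supremum. Uniqueness of
  suprema identifies it with the strong limit of the directed family of all \<open>op K\<close>, and
  that limit stays in \<open>P\<close>.\<close>

lemma op_in_if_compact:
  assumes P: "sot_subspace P" "\<And>K. compactin X K \<Longrightarrow> op K \<in> P" and V: "openin X V"
  shows "op V \<in> P"
proof -
  let ?A = "{op K | K. compactin X K \<and> K \<subseteq> V}"
  have sub: "?A \<subseteq> L \<inter> selfadjoint_ops" using op_Lsa[OF borel_of_compact[OF hd]] by auto
  have ne: "?A \<noteq> {}" using compactin_empty by blast
  have eq: "{\<mu> K | K. compactin X K \<and> K \<subseteq> V} = Fin ` ?A" by (auto simp: \<mu>_def)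
  have subc: "?A \<subseteq> carrier (sa_space L)" using sub by simp
  have "is_sup (extended (sa_space L)) {\<mu> K | K. compactin X K \<and> K \<subseteq> V} (\<mu> V)"
    using regular_\<mu> V by (simp add: regular_borel_measure_def inner_regular_at_def)
  then have supV: "is_sup (sa_space L) ?A (op V)"
    unfolding eq \<mu>_def[of V] is_sup_Fin(1)[OF subc] .
  have dir: "\<exists>U\<in>?A. op_le S U \<and> op_le T U" if "S \<in> ?A" "T \<in> ?A" for S T
  proof -
    obtain K K' where K: "S = op K" "T = op K'" "compactin X K" "compactin X K'" "K \<subseteq> V" "K' \<subseteq> V"
      using \<open>S \<in> ?A\<close> \<open>T \<in> ?A\<close> by auto
    have "op (K \<union> K') \<in> ?A" using K by (auto intro!: compactin_Un)
    moreover have "op_le S (op (K \<union> K'))" "op_le T (op (K \<union> K'))"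
      unfolding K(1,2) using K by (auto intro!: op_mono borel_of_compact hd compactin_Un)
    ultimately show ?thesis by blast
  qed
  have bd: "op V \<in> selfadjoint_ops" using op_Lsa[OF borel_of_open[OF V]] by simp
  have up: "op_le S (op V)" if "S \<in> ?A" for S
    using that by (auto intro!: op_mono borel_of_compact[OF hd] borel_of_open[OF V])
  obtain T where "is_sup (sa_space L) ?A T"
    "\<forall>x c. (\<forall>S\<in>?A. qform S x \<le> c) \<longrightarrow> qform T x \<le> c"
    "\<forall>M. closedin SOT M \<longrightarrow> ?A \<subseteq> M \<longrightarrow> T \<in> M"
    by (rule sot_directed_sup[OF L sub ne dir bd up])
  moreover have "?A \<subseteq> P" using P(2) by auto
  ultimately show ?thesis
    using is_sup_sa_unique[OF supV] sot_subspaceD(1)[OF P(1)] by blast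
qed

abbreviation I :: "('x \<Rightarrow> real) \<Rightarrow> 'h \<Rightarrow>\<^sub>L 'h"
  where "I \<equiv> order_integral (sa_space L) (borel_of X) \<mu>"

lemma I_in:
  assumes "sot_subspace P" "\<And>D. D \<in> sets (borel_of X) \<Longrightarrow> op D \<in> P"
    and "f \<in> L1 (sa_space L) (borel_of X) \<mu>"
  shows "I f \<in> P"
  using assms by (intro M.L1_order_integral(4)) simp_all

text \<open>A closed span is the intersection of the closed subspaces containing the generators, so
  it suffices to compare inclusion in each \<open>P\<close>. From the operators of open or compact
  sets one reaches all \<open>op D\<close>, and from these all integrals.\<close>

lemma generating_sets:
  assumes P: "sot_subspace P"
    and G: "G \<in> {\<pi> ` C0 X, I ` bounded_borel X, I ` L1 (sa_space L) (borel_of X) \<mu>,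
      {op V | V. openin X V}, {op K | K. compactin X K}, {op D | D. D \<in> sets (borel_of X)}}"
  shows "G \<subseteq> P \<longleftrightarrow> \<pi> ` Cc X \<subseteq> P"
proof
  assume GP: "G \<subseteq> P"
  \<comment> \<open>\<open>\<pi> f\<close> is an integral against \<open>\<mu>\<close>, hence a
    difference of strong limits of linear combinations of the operators \<open>op D\<close>.\<close>
  have C0: "\<pi> f \<in> P" if "\<And>D. D \<in> sets (borel_of X) \<Longrightarrow> op D \<in> P" "f \<in> Cc X" for f
  proof -
    have f: "f \<in> C0 X" by (rule C0_of_Cc[OF that(2)])
    then have "I f \<in> P" using C0_L1 by (intro I_in[OF P that(1)]) auto
    then show ?thesis by (simp add: order_integral_C0[OF f])
  qed
  have CcL1: "I f = \<pi> f" "f \<in> bounded_borel X" "f \<in> L1 (sa_space L) (borel_of X) \<mu>" if "f \<in> Cc X" for f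
  proof -
    have f: "f \<in> C0 X" by (rule C0_of_Cc[OF that])
    obtain c where "\<And>t. \<bar>f t\<bar> \<le> c" using C0_bounded[OF f] by auto
    then show "f \<in> bounded_borel X"
      unfolding bounded_borel_def bounded_iff using C0_measurable[OF f] by auto
    show "I f = \<pi> f" "f \<in> L1 (sa_space L) (borel_of X) \<mu>" using f C0_L1 order_integral_C0 by auto
  qed
  have via: "\<pi> ` Cc X \<subseteq> P" if "\<And>f. f \<in> Cc X \<Longrightarrow> I f \<in> P"
  proof (rule image_subsetI)
    fix f assume f: "f \<in> Cc X"
    show "\<pi> f \<in> P" using that[OF f] CcL1(1)[OF f] by simp
  qed
  from G consider "G = \<pi> ` C0 X" | "G = I ` bounded_borel X" | "G = I ` L1 (sa_space L) (borel_of X) \<mu>"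
    | "G = {op V | V. openin X V}" | "G = {op K | K. compactin X K}"
    | "G = {op D | D. D \<in> sets (borel_of X)}" by blast
  then show "\<pi> ` Cc X \<subseteq> P"
  proof cases
    case 1
    then show ?thesis using GP C0_of_Cc by blast
  next
    case 2
    then show ?thesis using GP CcL1(2) by (intro via) blast
  next
    case 3
    then show ?thesis using GP CcL1(3) by (intro via) blast
  next
    case 4
    then have "op V \<in> P" if "openin X V" for V using GP that by blast
    from op_in_if_open[OF P this] show ?thesis using C0 by blast
  next
    case 5
    then have "op K \<in> P" if "compactin X K" for K using GP that by blast
    from op_in_if_open[OF P op_in_if_compact[OF P this]] show ?thesis using C0 by blast
  next
    case 6
    then have "op D \<in> P" if "D \<in> sets (borel_of X)" for D using GP that by blast
    then show ?thesis using C0 by blast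
  qed
next
  assume "\<pi> ` Cc X \<subseteq> P"
  then have op: "op D \<in> P" if "D \<in> sets (borel_of X)" for D by (rule op_in_if_\<pi>[OF P _ that])
  have IP: "I f \<in> P" if "f \<in> L1 (sa_space L) (borel_of X) \<mu>" for f by (rule I_in[OF P op that])
  have "\<pi> f \<in> P" if "f \<in> C0 X" for f
    using IP[of f] that C0_L1 order_integral_C0[OF that] by auto
  moreover have "op V \<in> P" if "openin X V" for V by (rule op[OF borel_of_open[OF that]])
  moreover have "op K \<in> P" if "compactin X K" for K by (rule op[OF borel_of_compact[OF hd that]])
  ultimately show "G \<subseteq> P" using G op IP bounded_borel_L1 by auto
qed

end

lemma complex_subspace_imp_real:
  fixes M :: "('h::complex_hilbert \<Rightarrow>\<^sub>L 'h) set"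
  assumes "complex_subspace M"
  shows "real_subspace M"
proof -
  have "c *\<^sub>R T = scaleC_op (complex_of_real c) T" for c and T :: "'h \<Rightarrow>\<^sub>L 'h"
    by (rule blinfun_eqI) (simp add: blinfun.scaleR_left scaleR_eq_scaleC)
  then show ?thesis using assms by (auto simp: complex_subspace_def real_subspace_def subspace_def)
qed

text \<open>Strongly closed complex subspaces are among the real ones, so one equivalence over the
  real test subspaces gives equal families, and equal hulls, in both cases.\<close>

lemma sot_span_eqI:
  assumes "\<And>P. sot_subspace P \<Longrightarrow> G \<subseteq> P \<longleftrightarrow> G' \<subseteq> P"
  shows "sot_real_span G = sot_real_span G'" "sot_complex_span G = sot_complex_span G'"
proof -
  show "sot_real_span G = sot_real_span G'"
    unfolding sot_real_span_def hull_def using assms by (auto simp: sot_subspace_def)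
  have "{P. (complex_subspace P \<and> closedin SOT P) \<and> G \<subseteq> P} = {P. (complex_subspace P \<and> closedin SOT P) \<and> G' \<subseteq> P}"
    using assms complex_subspace_imp_real by (auto simp: sot_subspace_def)
  then show "sot_complex_span G = sot_complex_span G'"
    unfolding sot_complex_span_def hull_def by simp
qed

theorem theorem6p12:
  fixes X :: "'x topology"
    and \<pi> :: "('x \<Rightarrow> real) \<Rightarrow> ('h::complex_hilbert \<Rightarrow>\<^sub>L 'h)"
    and L :: "('h \<Rightarrow>\<^sub>L 'h) set"
  assumes "locally_compact_space X" and "Hausdorff_space X"
    and "positive_operator X (C0 X) (sa_space bounded_ops) \<pi>"
    and "complex_subspace L" and "closedin SOT L"
    and "\<pi> ` C0 X \<subseteq> L"
  shows "\<exists>\<mu> :: 'x set \<Rightarrow> ('h \<Rightarrow>\<^sub>L 'h) extd.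
    regular_borel_measure (sa_space L) X \<mu> \<and>
    Cc X \<subseteq> L1 (sa_space L) (borel_of X) \<mu> \<and>
    (\<forall>f\<in>Cc X. \<pi> f = order_integral (sa_space L) (borel_of X) \<mu> f) \<and>
    (\<forall>\<nu>. regular_borel_measure (sa_space L) X \<nu> \<longrightarrow>
       (\<forall>f\<in>Cc X. \<pi> f = order_integral (sa_space L) (borel_of X) \<nu> f) \<longrightarrow>
       (\<forall>\<Delta>\<in>sets (borel_of X). \<nu> \<Delta> = \<mu> \<Delta>)) \<and>
    finite_positive_measure (sa_space L) (borel_of X) \<mu> \<and>
    C0 X \<subseteq> L1 (sa_space L) (borel_of X) \<mu> \<and>
    bounded_borel X \<subseteq> L1 (sa_space L) (borel_of X) \<mu> \<and>
    (\<forall>f\<in>C0 X. \<pi> f = order_integral (sa_space L) (borel_of X) \<mu> f) \<and>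
    (\<forall>V. openin X V \<longrightarrow> V \<noteq> {} \<longrightarrow>
       is_sup (sa_space L) {\<pi> f | f. subordinate X f V} (the_fin (\<mu> V))) \<and>
    (\<forall>K. compactin X K \<longrightarrow>
       is_inf (sa_space L) {\<pi> f | f. dominates X K f} (the_fin (\<mu> K))) \<and>
    (\<forall>D :: nat \<Rightarrow> 'x set. range D \<subseteq> sets (borel_of X) \<longrightarrow> disjoint_family D \<longrightarrow>
       (\<forall>x. (\<lambda>n. the_fin (\<mu> (D n)) x) sums (the_fin (\<mu> (\<Union>n. D n)) x))) \<and>
    (\<forall>f\<in>L1 (sa_space L) (borel_of X) \<mu>.
       order_integral (sa_space L) (borel_of X) \<mu> f \<in> carrier (sa_space L)) \<and>
    (\<forall>x. (\<forall>\<Delta>\<in>sets (borel_of X).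
            cinner (the_fin (\<mu> \<Delta>) x) x = complex_of_real (scalar_measure \<mu> x \<Delta>) \<and>
            0 \<le> scalar_measure \<mu> x \<Delta>) \<and>
         regular_borel_measure real_space X (\<lambda>\<Delta>. Fin (scalar_measure \<mu> x \<Delta>))) \<and>
    (\<forall>f\<in>L1 (sa_space L) (borel_of X) \<mu>.
       (\<forall>x. integrable (lebesgue_of (borel_of X) (scalar_measure \<mu> x)) f) \<and>
       (\<forall>T :: 'h \<Rightarrow>\<^sub>L 'h. T \<in> bounded_ops \<longrightarrow>
          ((\<forall>x. cinner (T x) x = complex_of_real
              (\<integral>t. f t \<partial>lebesgue_of (borel_of X) (scalar_measure \<mu> x))) \<longleftrightarrow>
          T = order_integral (sa_space L) (borel_of X) \<mu> f))) \<and>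
    (\<forall>G \<in> {\<pi> ` C0 X,
            order_integral (sa_space L) (borel_of X) \<mu> ` bounded_borel X,
            order_integral (sa_space L) (borel_of X) \<mu> ` L1 (sa_space L) (borel_of X) \<mu>,
            {the_fin (\<mu> V) | V. openin X V},
            {the_fin (\<mu> K) | K. compactin X K},
            {the_fin (\<mu> \<Delta>) | \<Delta>. \<Delta> \<in> sets (borel_of X)}}.
       sot_real_span G = sot_real_span (\<pi> ` Cc X) \<and>
       sot_complex_span G = sot_complex_span (\<pi> ` Cc X))"
proof -
  interpret P: positive_C0_operator X \<pi> L
    using assms complex_subspace_imp_real by unfold_locales (auto simp: sot_subspace_def)
  show ?thesis
  proof (rule exI[of _ P.\<mu>], intro conjI)
    show "regular_borel_measure (sa_space L) X P.\<mu>" by (rule P.regular_\<mu>)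
    show "finite_positive_measure (sa_space L) (borel_of X) P.\<mu>" by (rule P.finite_positive_measure_\<mu>)
    show "C0 X \<subseteq> L1 (sa_space L) (borel_of X) P.\<mu>" by (rule P.C0_L1)
    then show "Cc X \<subseteq> L1 (sa_space L) (borel_of X) P.\<mu>" using C0_of_Cc by blast
    show "bounded_borel X \<subseteq> L1 (sa_space L) (borel_of X) P.\<mu>" by (rule P.bounded_borel_L1)
    show "\<forall>f\<in>C0 X. \<pi> f = order_integral (sa_space L) (borel_of X) P.\<mu> f"
      by (simp add: P.order_integral_C0)
    then show "\<forall>f\<in>Cc X. \<pi> f = order_integral (sa_space L) (borel_of X) P.\<mu> f"
      using C0_of_Cc by blast
    show "\<forall>\<nu>. regular_borel_measure (sa_space L) X \<nu> \<longrightarrow>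
       (\<forall>f\<in>Cc X. \<pi> f = order_integral (sa_space L) (borel_of X) \<nu> f) \<longrightarrow>
       (\<forall>\<Delta>\<in>sets (borel_of X). \<nu> \<Delta> = P.\<mu> \<Delta>)"
      using P.regular_unique by blast
    show "\<forall>V. openin X V \<longrightarrow> V \<noteq> {} \<longrightarrow>
       is_sup (sa_space L) {\<pi> f | f. subordinate X f V} (the_fin (P.\<mu> V))"
      by (simp add: P.op_open_sup)
    show "\<forall>K. compactin X K \<longrightarrow> is_inf (sa_space L) {\<pi> f | f. dominates X K f} (the_fin (P.\<mu> K))"
      by (simp add: P.op_compact_inf)
    show "\<forall>D :: nat \<Rightarrow> 'x set. range D \<subseteq> sets (borel_of X) \<longrightarrow> disjoint_family D \<longrightarrow>
       (\<forall>x. (\<lambda>n. the_fin (P.\<mu> (D n)) x) sums (the_fin (P.\<mu> (\<Union>n. D n)) x))"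
      using P.M.m_sums_strong by simp
    show "\<forall>f\<in>L1 (sa_space L) (borel_of X) P.\<mu>.
       order_integral (sa_space L) (borel_of X) P.\<mu> f \<in> carrier (sa_space L)"
      using P.M.L1_order_integral(1) by simp
    show "\<forall>x. (\<forall>\<Delta>\<in>sets (borel_of X).
            cinner (the_fin (P.\<mu> \<Delta>) x) x = complex_of_real (scalar_measure P.\<mu> x \<Delta>) \<and>
            0 \<le> scalar_measure P.\<mu> x \<Delta>) \<and>
         regular_borel_measure real_space X (\<lambda>\<Delta>. Fin (scalar_measure P.\<mu> x \<Delta>))"
      using P.op_Lsa P.regular_scalar_measure
      by (simp add: cinner_selfadjoint P.M.scalar_measure_eq P.M.m_nonneg[unfolded P.M_m])
    show "\<forall>f\<in>L1 (sa_space L) (borel_of X) P.\<mu>.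
       (\<forall>x. integrable (lebesgue_of (borel_of X) (scalar_measure P.\<mu> x)) f) \<and>
       (\<forall>T :: 'h \<Rightarrow>\<^sub>L 'h. T \<in> bounded_ops \<longrightarrow>
          ((\<forall>x. cinner (T x) x = complex_of_real
              (\<integral>t. f t \<partial>lebesgue_of (borel_of X) (scalar_measure P.\<mu> x))) \<longleftrightarrow>
          T = order_integral (sa_space L) (borel_of X) P.\<mu> f))"
      using P.M.L1_order_integral(2) P.M.L1_order_integral_unique unfolding P.M.N_def by blast
    show "\<forall>G \<in> {\<pi> ` C0 X,
            order_integral (sa_space L) (borel_of X) P.\<mu> ` bounded_borel X,
            order_integral (sa_space L) (borel_of X) P.\<mu> ` L1 (sa_space L) (borel_of X) P.\<mu>,
            {the_fin (P.\<mu> V) | V. openin X V},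
            {the_fin (P.\<mu> K) | K. compactin X K},
            {the_fin (P.\<mu> \<Delta>) | \<Delta>. \<Delta> \<in> sets (borel_of X)}}.
       sot_real_span G = sot_real_span (\<pi> ` Cc X) \<and>
       sot_complex_span G = sot_complex_span (\<pi> ` Cc X)"
      unfolding P.the_fin_\<mu> by (intro ballI conjI sot_span_eqI P.generating_sets)
  qed
qed

end
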